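(* Let $\mathbbm{k}$ be an algebraically closed field of characteristic zero and let $\mathbb{D}_\infty=\langle g,x\mid x^2=1,\ xgx=g^{-1}\rangle$ be the infinite dihedral group. Let $\mathbbm{k}\mathbb{D}_{\infty^\circ}$ be the Hopf algebra generated as an algebra by $F$ and $\phi_\lambda,\psi_\lambda$ ($\lambda\in\mathbbm{k}^*$) subject to $$F\phi_\lambda=\phi_\lambda F,\quad F\psi_\lambda=\psi_\lambda F,\quad \phi_1=1,\quad \phi_\lambda\psi_{\lambda'}=\psi_{\lambda'}\phi_\lambda=\psi_{\lambda\lambda'},\quad \phi_\lambda\phi_{\lambda'}=\phi_{\lambda\lambda'},\quad \psi_\lambda\psi_{\lambda'}=\phi_{\lambda\lambda'}$$ for all $\lambda,\lambda'\in\mathbbm{k}^*$, with comultiplication, counit and antipode $$\Delta(F)=F\otimes 1+\psi_1\otimes F,\quad \Delta(\phi_\lambda)=\tfrac12(\phi_\lambda+\psi_\lambda)\otimes\phi_\lambda+\tfrac12(\phi_\lambda-\psi_\lambda)\otimes\phi_{\lambda^{-1}},$$ $$\Delta(\psi_\lambda)=\tfrac12(\phi_\lambda+\psi_\lambda)\otimes\psi_\lambda-\tfrac12(\phi_\lambda-\psi_\lambda)\otimes\psi_{\lambda^{-1}},\quad \varepsilon(F)=0,\ \varepsilon(\phi_\lambda)=\varepsilon(\psi_\lambda)=1,$$ $$S(F)=-\psi_1F,\quad S(\phi_\lambda)=\tfrac12(\phi_{\lambda^{-1}}+\psi_{\lambda^{-1}})+\tfrac12(\phi_\lambda-\psi_\lambda),\quad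 S(\psi_\lambda)=\tfrac12(\phi_{\lambda^{-1}}+\psi_{\lambda^{-1}})-\tfrac12(\phi_\lambda-\psi_\lambda).$$ Then there is an isomorphism of Hopf algebras $(\mathbbm{k}\mathbb{D}_\infty)^\circ\cong \mathbbm{k}\mathbb{D}_{\infty^\circ}$.
   Context: For a Hopf algebra $H$, the finite dual $H^\circ$ is the Hopf algebra consisting of all linear functionals $f\in H^*$ that vanish on some two-sided ideal $I\subset H$ of finite codimension, with the structure dual to that of $H$. $\mathbbm{k}\mathbb{D}_\infty$ is the group algebra with its standard Hopf structure ($g,x$ group-like). *)

theory Defs
  imports
    "HOL-Library.Poly_Mapping"
    "HOL-Computational_Algebra.Polynomial"
    "HOL-Algebra.QuotRing"
    "HOL-Algebra.Module"
begin

section \<open>Algebras over a field\<close>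

text \<open>
  The ground field is a type \<open>'k\<close> of class \<^class>\<open>field\<close>; algebras over it are carrier-based
  \<^type>\<open>module_scheme\<close> records, their scalar ring being \<open>scalars\<close>, the type \<open>'k\<close> repackaged as a
  record. Since \<open>scalars\<close> is itself given as a \<open>module\<close> record, it doubles as the
  one-dimensional algebra.
\<close>

definition scalars :: "('k::field, 'k) module" where
  "scalars = \<lparr>carrier = UNIV, mult = (*), one = 1, zero = 0, add = (+), smult = (*)\<rparr>"

locale k_algebra = module scalars A + ring A
  for A :: "('k::field, 'a, 'm) module_scheme" (structure) +
  assumes smult_mult_left:
      "\<lbrakk>x \<in> carrier A; y \<in> carrier A\<rbrakk> \<Longrightarrow> (c \<odot> x) \<otimes> y = c \<odot> (x \<otimes> y)"
    and smult_mult_right: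
      "\<lbrakk>x \<in> carrier A; y \<in> carrier A\<rbrakk> \<Longrightarrow> x \<otimes> (c \<odot> y) = c \<odot> (x \<otimes> y)"

definition lin_map ::
  "('k::field, 'a, 'm) module_scheme \<Rightarrow> ('k, 'b, 'n) module_scheme \<Rightarrow> ('a \<Rightarrow> 'b) set" where
  "lin_map V W = {f. f \<in> carrier V \<rightarrow> carrier W \<and>
     (\<forall>x\<in>carrier V. \<forall>y\<in>carrier V. f (x \<oplus>\<^bsub>V\<^esub> y) = f x \<oplus>\<^bsub>W\<^esub> f y) \<and>
     (\<forall>c. \<forall>x\<in>carrier V. f (c \<odot>\<^bsub>V\<^esub> x) = c \<odot>\<^bsub>W\<^esub> f x)}"

definition alg_hom ::
  "('k::field, 'a, 'm) module_scheme \<Rightarrow> ('k, 'b, 'n) module_scheme \<Rightarrow> ('a \<Rightarrow> 'b) set" where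
  "alg_hom A B = ring_hom A B \<inter> lin_map A B"

definition lin_span :: "('k::field, 'a, 'm) module_scheme \<Rightarrow> 'a set \<Rightarrow> 'a set" where
  "lin_span V S = \<Inter>{N. submodule N scalars V \<and> S \<subseteq> N}"

definition opposite :: "('k::field, 'a, 'm) module_scheme \<Rightarrow> ('k, 'a, 'm) module_scheme" where
  "opposite A = A\<lparr>mult := \<lambda>x y. y \<otimes>\<^bsub>A\<^esub> x\<rparr>"

text \<open>
  \<open>quot_alg A I\<close> is \<^term>\<open>A Quot I\<close> with the induced scalar multiplication.
\<close>

definition quot_alg ::
  "('k::field, 'a, 'm) module_scheme \<Rightarrow> 'a set \<Rightarrow> ('k, 'a set) module" where
  "quot_alg A I =
     \<lparr>carrier = carrier (A Quot I), mult = mult (A Quot I), one = one (A Quot I),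
      zero = zero (A Quot I), add = add (A Quot I),
      smult = (\<lambda>c S. \<Union>a\<in>S. I +>\<^bsub>A\<^esub> (c \<odot>\<^bsub>A\<^esub> a))\<rparr>"

text \<open>
  The monoid algebra: finitely supported functions on the monoid under convolution.
  \<^term>\<open>Poly_Mapping.single g 1\<close> is the basis element of \<open>g\<close>.
\<close>

definition monoid_algebra ::
  "('g, 'm) monoid_scheme \<Rightarrow> ('k::field, 'g \<Rightarrow>\<^sub>0 'k) module" where
  "monoid_algebra G =
     \<lparr>carrier = {u. Poly_Mapping.keys u \<subseteq> carrier G},
      mult = (\<lambda>u v. \<Sum>a\<in>Poly_Mapping.keys u. \<Sum>b\<in>Poly_Mapping.keys v.
        Poly_Mapping.single (a \<otimes>\<^bsub>G\<^esub> b) (Poly_Mapping.lookup u a * Poly_Mapping.lookup v b)),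
      one = Poly_Mapping.single \<one>\<^bsub>G\<^esub> 1,
      zero = 0,
      add = (+),
      smult = (\<lambda>c. Poly_Mapping.map ((*) c))\<rparr>"

text \<open>Linear extension to formal linear combinations of a map \<open>b\<close> given on the basis.\<close>

definition lin_ext ::
  "('k::field, 'v, 'm) module_scheme \<Rightarrow> ('p \<Rightarrow> 'v) \<Rightarrow> ('p \<Rightarrow>\<^sub>0 'k) \<Rightarrow> 'v" where
  "lin_ext V b u = (\<Oplus>\<^bsub>V\<^esub>p\<in>Poly_Mapping.keys u. Poly_Mapping.lookup u p \<odot>\<^bsub>V\<^esub> b p)"


section \<open>Tensor products\<close>

text \<open>
  \<open>A \<otimes> B\<close> is the free vector space on \<open>A \<times> B\<close> modulo the span of the bilinearity relations.
  Taking the free vector space as the monoid algebra of the multiplicative monoid \<open>A \<times> B\<close>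
  makes the quotient carry the product \<open>(x \<otimes> y) (x' \<otimes> y') = x x' \<otimes> y y'\<close>: the span is stable
  under multiplication by basis elements, hence is an ideal.
\<close>

definition bilinear_relations ::
  "('k::field, 'a, 'm) module_scheme \<Rightarrow> ('k, 'b, 'n) module_scheme \<Rightarrow> ('a \<times> 'b \<Rightarrow>\<^sub>0 'k) set" where
  "bilinear_relations A B =
     {Poly_Mapping.single (x \<oplus>\<^bsub>A\<^esub> x', y) 1 - Poly_Mapping.single (x, y) 1
        - Poly_Mapping.single (x', y) 1 | x x' y.
        x \<in> carrier A \<and> x' \<in> carrier A \<and> y \<in> carrier B} \<union>
     {Poly_Mapping.single (x, y \<oplus>\<^bsub>B\<^esub> y') 1 - Poly_Mapping.single (x, y) 1
        - Poly_Mapping.single (x, y') 1 | x y y'.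
        x \<in> carrier A \<and> y \<in> carrier B \<and> y' \<in> carrier B} \<union>
     {Poly_Mapping.single (c \<odot>\<^bsub>A\<^esub> x, y) 1 - Poly_Mapping.single (x, y) c | c x y.
        x \<in> carrier A \<and> y \<in> carrier B} \<union>
     {Poly_Mapping.single (x, c \<odot>\<^bsub>B\<^esub> y) 1 - Poly_Mapping.single (x, y) c | c x y.
        x \<in> carrier A \<and> y \<in> carrier B}"

definition tensor_null ::
  "('k::field, 'a, 'm) module_scheme \<Rightarrow> ('k, 'b, 'n) module_scheme \<Rightarrow> ('a \<times> 'b \<Rightarrow>\<^sub>0 'k) set" where
  "tensor_null A B = lin_span (monoid_algebra (A \<times>\<times> B)) (bilinear_relations A B)"

type_synonym ('k, 'a, 'b) tens = "('a \<times> 'b \<Rightarrow>\<^sub>0 'k) set"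

definition tensor ::
  "('k::field, 'a, 'm) module_scheme \<Rightarrow> ('k, 'b, 'n) module_scheme
     \<Rightarrow> ('k, ('k, 'a, 'b) tens) module" where
  "tensor A B = quot_alg (monoid_algebra (A \<times>\<times> B)) (tensor_null A B)"

definition pure ::
  "('k::field, 'a, 'm) module_scheme \<Rightarrow> ('k, 'b, 'n) module_scheme
     \<Rightarrow> 'a \<Rightarrow> 'b \<Rightarrow> ('k, 'a, 'b) tens" where
  "pure A B x y =
     tensor_null A B +>\<^bsub>(monoid_algebra (A \<times>\<times> B) :: ('k, _) module)\<^esub> Poly_Mapping.single (x, y) 1"

text \<open>
  The linear map on a tensor product induced by a bilinear map \<open>b\<close>; for bilinear \<open>b\<close> the result
  does not depend on the representative chosen.
\<close>

definition tensor_lift ::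
  "('k::field, 'v, 'm) module_scheme \<Rightarrow> ('a \<Rightarrow> 'b \<Rightarrow> 'v) \<Rightarrow> ('k, 'a, 'b) tens \<Rightarrow> 'v" where
  "tensor_lift V b t = lin_ext V (\<lambda>(x, y). b x y) (SOME u. u \<in> t)"

definition tensor_map ::
  "('k::field, 'c, 'm) module_scheme \<Rightarrow> ('k, 'd, 'n) module_scheme
     \<Rightarrow> ('a \<Rightarrow> 'c) \<Rightarrow> ('b \<Rightarrow> 'd) \<Rightarrow> ('k, 'a, 'b) tens \<Rightarrow> ('k, 'c, 'd) tens" where
  "tensor_map C D f g = tensor_lift (tensor C D) (\<lambda>x y. pure C D (f x) (g y))"

text \<open>The associativity isomorphism \<open>(A \<otimes> B) \<otimes> C \<rightarrow> A \<otimes> (B \<otimes> C)\<close>.\<close>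

definition tensor_assoc ::
  "('k::field, 'a, 'm) module_scheme \<Rightarrow> ('k, 'b, 'n) module_scheme \<Rightarrow> ('k, 'c, 'l) module_scheme
     \<Rightarrow> ('k, ('k, 'a, 'b) tens, 'c) tens \<Rightarrow> ('k, 'a, ('k, 'b, 'c) tens) tens" where
  "tensor_assoc A B C =
     tensor_lift (tensor A (tensor B C))
       (\<lambda>t z. tensor_lift (tensor A (tensor B C))
                (\<lambda>x y. pure A (tensor B C) x (pure B C y z)) t)"


section \<open>Hopf algebras\<close>

record (overloaded) ('k, 'a) hopf = "('k, 'a) module" +
  comult :: "'a \<Rightarrow> ('k, 'a, 'a) tens"
  counit :: "'a \<Rightarrow> 'k"
  antipode :: "'a \<Rightarrow> 'a"

locale hopf_algebra = k_algebra H for H :: "('k::field, 'a) hopf" (structure) +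
  assumes comult_hom: "comult H \<in> alg_hom H (tensor H H)"
    and counit_hom: "counit H \<in> alg_hom H scalars"
    and antipode_linear: "antipode H \<in> lin_map H H"
    and coassoc: "h \<in> carrier H \<Longrightarrow>
      tensor_assoc H H H (tensor_map (tensor H H) H (comult H) id (comult H h)) =
      tensor_map H (tensor H H) id (comult H) (comult H h)"
    and counit_left: "h \<in> carrier H \<Longrightarrow>
      tensor_lift H (\<lambda>x y. counit H x \<odot> y) (comult H h) = h"
    and counit_right: "h \<in> carrier H \<Longrightarrow>
      tensor_lift H (\<lambda>x y. counit H y \<odot> x) (comult H h) = h"
    and antipode_left: "h \<in> carrier H \<Longrightarrow>
      tensor_lift H (\<lambda>x y. antipode H x \<otimes> y) (comult H h) = counit H h \<odot> \<one>"
    and antipode_right: "h \<in> carrier H \<Longrightarrow>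
      tensor_lift H (\<lambda>x y. x \<otimes> antipode H y) (comult H h) = counit H h \<odot> \<one>"

definition hopf_iso :: "('k::field, 'a) hopf \<Rightarrow> ('k, 'b) hopf \<Rightarrow> ('a \<Rightarrow> 'b) set" where
  "hopf_iso H K = {f. f \<in> alg_hom H K \<and> bij_betw f (carrier H) (carrier K) \<and>
     (\<forall>h\<in>carrier H. comult K (f h) = tensor_map K K f f (comult H h)) \<and>
     (\<forall>h\<in>carrier H. counit K (f h) = counit H h) \<and>
     (\<forall>h\<in>carrier H. antipode K (f h) = f (antipode H h))}"


section \<open>The finite dual\<close>

text \<open>
  Functionals on \<open>H\<close> are kept extensional, so that equality of functions is equality on the
  carrier. \<open>I\<close> has finite codimension iff \<open>I\<close> and some finite set together span \<open>H\<close>; an ideal of a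
  unital algebra is automatically a subspace.
\<close>

definition finite_codim :: "('k::field, 'a, 'm) module_scheme \<Rightarrow> 'a set \<Rightarrow> bool" where
  "finite_codim H I \<longleftrightarrow>
     (\<exists>B. finite B \<and> B \<subseteq> carrier H \<and> I <+>\<^bsub>H\<^esub> lin_span H B = carrier H)"

definition finite_dual_carrier :: "('k::field, 'a, 'm) module_scheme \<Rightarrow> ('a \<Rightarrow> 'k) set" where
  "finite_dual_carrier H = {f \<in> lin_map H scalars \<inter> extensional (carrier H).
     \<exists>I. ideal I H \<and> finite_codim H I \<and> (\<forall>h\<in>I. f h = 0)}"

definition finite_dual_algebra :: "('k::field, 'a) hopf \<Rightarrow> ('k, 'a \<Rightarrow> 'k) module" where
  "finite_dual_algebra H =
     \<lparr>carrier = finite_dual_carrier H,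
      mult = (\<lambda>f g. \<lambda>h\<in>carrier H. tensor_lift scalars (\<lambda>x y. f x * g y) (comult H h)),
      one = (\<lambda>h\<in>carrier H. counit H h),
      zero = (\<lambda>h\<in>carrier H. 0),
      add = (\<lambda>f g. \<lambda>h\<in>carrier H. f h + g h),
      smult = (\<lambda>c f. \<lambda>h\<in>carrier H. c * f h)\<rparr>"

text \<open>
  The comultiplication sends \<open>f\<close> to the element of the tensor square of the finite dual whose
  associated bilinear form on \<open>H\<close> is \<open>(a, b) \<mapsto> f (a b)\<close>. That element exists because \<open>f\<close> kills an
  ideal of finite codimension, and it is unique since an element of the tensor square is
  determined by its bilinear form.
\<close>

definition finite_dual_comult ::
  "('k::field, 'a) hopf \<Rightarrow> ('a \<Rightarrow> 'k) \<Rightarrow> ('k, 'a \<Rightarrow> 'k, 'a \<Rightarrow> 'k) tens" where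
  "finite_dual_comult H f =
     (THE t. t \<in> carrier (tensor (finite_dual_algebra H) (finite_dual_algebra H)) \<and>
        (\<forall>a\<in>carrier H. \<forall>b\<in>carrier H.
           tensor_lift scalars (\<lambda>p q. p a * q b) t = f (a \<otimes>\<^bsub>H\<^esub> b)))"

definition finite_dual :: "('k::field, 'a) hopf \<Rightarrow> ('k, 'a \<Rightarrow> 'k) hopf" where
  "finite_dual H =
     module.extend (finite_dual_algebra H)
       (hopf.fields
          (finite_dual_comult H)
          (\<lambda>f. f \<one>\<^bsub>H\<^esub>)
          (\<lambda>f. \<lambda>h\<in>carrier H. f (antipode H h)))"


section \<open>The group algebra of the infinite dihedral group\<close>

definition group_hopf :: "('g, 'm) monoid_scheme \<Rightarrow> ('k::field, 'g \<Rightarrow>\<^sub>0 'k) hopf" where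
  "group_hopf G =
     module.extend (monoid_algebra G)
       (hopf.fields
          (lin_ext (tensor (monoid_algebra G) (monoid_algebra G))
             (\<lambda>g. pure (monoid_algebra G) (monoid_algebra G)
                    (Poly_Mapping.single g 1) (Poly_Mapping.single g 1)))
          (lin_ext scalars (\<lambda>g. 1))
          (lin_ext (monoid_algebra G) (\<lambda>g. Poly_Mapping.single (inv\<^bsub>G\<^esub> g) 1)))"

text \<open>
  Group presentations: a word is a list of letters \<open>(a, True)\<close>, standing for the generator \<open>a\<close>,
  and \<open>(a, False)\<close>, standing for its inverse; a pair \<open>(l, r)\<close> in \<open>R\<close> is the relation \<open>l = r\<close>.
\<close>

type_synonym 'a word = "('a \<times> bool) list"

inductive word_cong :: "('a word \<times> 'a word) set \<Rightarrow> 'a word \<Rightarrow> 'a word \<Rightarrow> bool"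
  for R :: "('a word \<times> 'a word) set" where
  refl: "word_cong R w w"
| sym: "word_cong R v w \<Longrightarrow> word_cong R w v"
| trans: "word_cong R u v \<Longrightarrow> word_cong R v w \<Longrightarrow> word_cong R u w"
| cancel: "word_cong R (u @ [(a, s), (a, \<not> s)] @ v) (u @ v)"
| rel: "(l, r) \<in> R \<Longrightarrow> word_cong R (u @ l @ v) (u @ r @ v)"

definition presented_group :: "('a word \<times> 'a word) set \<Rightarrow> 'a word set monoid" where
  "presented_group R =
     \<lparr>carrier = UNIV // {(v, w). word_cong R v w},
      mult = (\<lambda>U V. {w. \<exists>u\<in>U. \<exists>v\<in>V. word_cong R (u @ v) w}),
      one = {w. word_cong R [] w}\<rparr>"

datatype dihedral_gen = Gen_g | Gen_x

definition infinite_dihedral :: "dihedral_gen word set monoid" where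
  "infinite_dihedral = presented_group
     {([(Gen_x, True), (Gen_x, True)], []),
      ([(Gen_x, True), (Gen_g, True), (Gen_x, True)], [(Gen_g, False)])}"


section \<open>The Hopf algebra given by generators and relations\<close>

text \<open>
  The free algebra on a set \<open>X\<close> is the monoid algebra of the words over \<open>X\<close>.
\<close>

definition free_monoid :: "'s set \<Rightarrow> 's list monoid" where
  "free_monoid X = \<lparr>carrier = lists X, mult = (@), one = []\<rparr>"

definition presented_algebra ::
  "'s set \<Rightarrow> ('s list \<Rightarrow>\<^sub>0 'k::field) set \<Rightarrow> ('k, ('s list \<Rightarrow>\<^sub>0 'k) set) module" where
  "presented_algebra X R =
     quot_alg (monoid_algebra (free_monoid X))
       (Idl\<^bsub>(monoid_algebra (free_monoid X) :: ('k, _) module)\<^esub> R)"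

text \<open>
  The algebra map to \<open>B\<close> out of a presented algebra determined by the images \<open>v\<close> of the
  generators; independent of the representative whenever \<open>v\<close> respects the relations.
\<close>

definition gen_hom ::
  "('k::field, 'b, 'm) module_scheme \<Rightarrow> ('s \<Rightarrow> 'b) \<Rightarrow> ('s list \<Rightarrow>\<^sub>0 'k) set \<Rightarrow> 'b" where
  "gen_hom B v S =
     lin_ext B (\<lambda>w. foldr (\<lambda>s p. v s \<otimes>\<^bsub>B\<^esub> p) w \<one>\<^bsub>B\<^esub>) (SOME u. u \<in> S)"

text \<open>Only \<open>Gen_phi c\<close> and \<open>Gen_psi c\<close> with \<open>c \<noteq> 0\<close> are generators.\<close>

datatype 'k gen = Gen_F | Gen_phi 'k | Gen_psi 'k

definition gens :: "'k::field gen set" where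
  "gens = {Gen_F} \<union> {Gen_phi c | c. c \<noteq> 0} \<union> {Gen_psi c | c. c \<noteq> 0}"

abbreviation mon :: "'k gen list \<Rightarrow> ('k gen list \<Rightarrow>\<^sub>0 'k::field)" where
  "mon w \<equiv> Poly_Mapping.single w 1"

definition rels :: "('k gen list \<Rightarrow>\<^sub>0 'k::field) set" where
  "rels =
     {mon [Gen_F, Gen_phi a] - mon [Gen_phi a, Gen_F] | a. a \<noteq> 0} \<union>
     {mon [Gen_F, Gen_psi a] - mon [Gen_psi a, Gen_F] | a. a \<noteq> 0} \<union>
     {mon [Gen_phi 1] - mon []} \<union>
     {mon [Gen_phi a, Gen_psi b] - mon [Gen_psi (a * b)] | a b. a \<noteq> 0 \<and> b \<noteq> 0} \<union>
     {mon [Gen_psi b, Gen_phi a] - mon [Gen_psi (a * b)] | a b. a \<noteq> 0 \<and> b \<noteq> 0} \<union>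
     {mon [Gen_phi a, Gen_phi b] - mon [Gen_phi (a * b)] | a b. a \<noteq> 0 \<and> b \<noteq> 0} \<union>
     {mon [Gen_psi a, Gen_psi b] - mon [Gen_phi (a * b)] | a b. a \<noteq> 0 \<and> b \<noteq> 0}"

type_synonym 'k elt = "('k gen list \<Rightarrow>\<^sub>0 'k) set"

definition dihedral_dual_algebra :: "('k::field, 'k elt) module" where
  "dihedral_dual_algebra = presented_algebra gens rels"

definition gen_elt :: "'k::field gen \<Rightarrow> 'k elt" where
  "gen_elt s =
     Idl\<^bsub>(monoid_algebra (free_monoid gens) :: ('k, _) module)\<^esub> rels
       +>\<^bsub>(monoid_algebra (free_monoid gens) :: ('k, _) module)\<^esub> mon [s]"

context
begin

private abbreviation (input) "\<A> \<equiv> dihedral_dual_algebra"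
private abbreviation (input) "\<A>2 \<equiv> tensor dihedral_dual_algebra dihedral_dual_algebra"
private abbreviation (input) "elt_F \<equiv> gen_elt Gen_F"
private abbreviation (input) "\<phi> c \<equiv> gen_elt (Gen_phi c)"
private abbreviation (input) "\<psi> c \<equiv> gen_elt (Gen_psi c)"
private abbreviation (input) "tens x y \<equiv> pure dihedral_dual_algebra dihedral_dual_algebra x y"

fun comult_gen :: "'k::field gen \<Rightarrow> ('k, 'k elt, 'k elt) tens" where
  "comult_gen Gen_F = tens elt_F \<one>\<^bsub>\<A>\<^esub> \<oplus>\<^bsub>\<A>2\<^esub> tens (\<psi> 1) elt_F"
| "comult_gen (Gen_phi c) =
     (1/2) \<odot>\<^bsub>\<A>2\<^esub> tens (\<phi> c \<oplus>\<^bsub>\<A>\<^esub> \<psi> c) (\<phi> c) \<oplus>\<^bsub>\<A>2\<^esub>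
     (1/2) \<odot>\<^bsub>\<A>2\<^esub> tens (\<phi> c \<ominus>\<^bsub>\<A>\<^esub> \<psi> c) (\<phi> (inverse c))"
| "comult_gen (Gen_psi c) =
     (1/2) \<odot>\<^bsub>\<A>2\<^esub> tens (\<phi> c \<oplus>\<^bsub>\<A>\<^esub> \<psi> c) (\<psi> c) \<ominus>\<^bsub>\<A>2\<^esub>
     (1/2) \<odot>\<^bsub>\<A>2\<^esub> tens (\<phi> c \<ominus>\<^bsub>\<A>\<^esub> \<psi> c) (\<psi> (inverse c))"

fun counit_gen :: "'k::field gen \<Rightarrow> 'k" where
  "counit_gen Gen_F = 0"
| "counit_gen (Gen_phi c) = 1"
| "counit_gen (Gen_psi c) = 1"

fun antipode_gen :: "'k::field gen \<Rightarrow> 'k elt" where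
  "antipode_gen Gen_F = \<ominus>\<^bsub>\<A>\<^esub> (\<psi> 1 \<otimes>\<^bsub>\<A>\<^esub> elt_F)"
| "antipode_gen (Gen_phi c) =
     (1/2) \<odot>\<^bsub>\<A>\<^esub> (\<phi> (inverse c) \<oplus>\<^bsub>\<A>\<^esub> \<psi> (inverse c)) \<oplus>\<^bsub>\<A>\<^esub>
     (1/2) \<odot>\<^bsub>\<A>\<^esub> (\<phi> c \<ominus>\<^bsub>\<A>\<^esub> \<psi> c)"
| "antipode_gen (Gen_psi c) =
     (1/2) \<odot>\<^bsub>\<A>\<^esub> (\<phi> (inverse c) \<oplus>\<^bsub>\<A>\<^esub> \<psi> (inverse c)) \<ominus>\<^bsub>\<A>\<^esub>
     (1/2) \<odot>\<^bsub>\<A>\<^esub> (\<phi> c \<ominus>\<^bsub>\<A>\<^esub> \<psi> c)"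

end

text \<open>
  Comultiplication and counit extend as algebra maps, the antipode as an anti-homomorphism.
\<close>

definition dihedral_dual :: "('k::field, 'k elt) hopf" where
  "dihedral_dual =
     module.extend dihedral_dual_algebra
       (hopf.fields
          (gen_hom (tensor dihedral_dual_algebra dihedral_dual_algebra) comult_gen)
          (gen_hom scalars counit_gen)
          (gen_hom (opposite dihedral_dual_algebra) antipode_gen))"

end

theory Submission
  imports Defs
begin

text \<open>
  Both Hopf algebras are realised by functions on the dihedral group, identified with
  \<open>int \<times> bool\<close> so that the product is pointwise, the comultiplication is dual to the group
  law, and counit and antipode are evaluation at the unit and composition with inversion. An
  element of a tensor product of such algebras is determined by its values on pairs of group
  elements, so every Hopf axiom, and the fact that the structure maps respect the defining
  relations, is checked by evaluation; an isomorphism only requires the two spaces of functions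
  to coincide. For the presented algebra the generators evaluate at \<open>g\<^sup>i x\<^sup>j\<close> to \<open>F = i\<close>,
  \<open>\<phi>\<^sub>c = c\<^sup>i\<close>, \<open>\<psi>\<^sub>c = (-1)\<^sup>j c\<^sup>i\<close>; the evaluation is injective because the functions
  \<open>i\<^sup>n c\<^sup>i\<close> are linearly independent. A functional on the group algebra that kills an ideal of
  finite codimension satisfies, in \<open>i\<close> for each fixed \<open>j\<close>, a linear recurrence, whose
  solutions over an algebraically closed field of characteristic 0 are combinations of the
  \<open>i\<^sup>n c\<^sup>i\<close>. Conversely, applying the comultiplication twice shows that such combinations kill
  an ideal of finite codimension.
\<close>

text \<open>That the finite dual is closed under convolution, and that its comultiplication, a
  definite description, denotes anything, is not derived from ideals. Once every functional in it is
  known to agree on the group with an element of the presented algebra, the finite dual is a linear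
  image of that algebra, and closure, the algebra axioms and the tensors needed for the
  comultiplication are carried over. Finite codimension serves only to produce the recurrence:
  modulo the ideal the powers of \<open>g\<close> are linearly dependent, so the ideal contains a
  nonzero polynomial in \<open>g\<close> together with its translates. The other obstacle is that
  tensors and elements of presented algebras are cosets, and maps out of them are defined through a
  chosen representative. Each such map needs a proof that it kills the relations; for the structure
  maps of the presented algebra this is again settled by values, since a defining relation equates
  two monomials with the same values. Polynomials in \<open>i\<close> are kept in the basis of
  binomial coefficients, on which the shift acts by Pascal's rule.\<close>

abbreviation (input) "keys \<equiv> Poly_Mapping.keys"
abbreviation (input) "lookup \<equiv> Poly_Mapping.lookup"
abbreviation (input) "single \<equiv> Poly_Mapping.single"

section \<open>The ground field as an algebra, and transport of the algebra axioms\<close>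

lemma scalars_simps [simp]:
  "carrier scalars = UNIV" "x \<otimes>\<^bsub>scalars\<^esub> y = x * y" "\<one>\<^bsub>scalars\<^esub> = 1"
  "\<zero>\<^bsub>scalars\<^esub> = 0" "x \<oplus>\<^bsub>scalars\<^esub> y = x + y" "c \<odot>\<^bsub>scalars\<^esub> x = c * x"
  by (simp_all add: scalars_def)

lemma cring_scalars: "cring (scalars :: ('k::field, 'k) module)"
  by (intro cringI abelian_groupI comm_monoidI)
    (auto simp: algebra_simps intro: exI[of _ "- x" for x] add.right_inverse)

text \<open>Scalars appear through the operations of the type \<open>'k\<close> instead of the
  fields of the record \<open>scalars\<close>, so that the axioms of a concrete algebra become goals
  for the simplifier.\<close>

lemma k_algebraI:
  fixes A :: "('k::field, 'a, 'm) module_scheme" (structure)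
  assumes "\<And>x y. \<lbrakk>x \<in> carrier A; y \<in> carrier A\<rbrakk> \<Longrightarrow> x \<oplus> y \<in> carrier A"
    and "\<zero> \<in> carrier A"
    and "\<And>x y z. \<lbrakk>x \<in> carrier A; y \<in> carrier A; z \<in> carrier A\<rbrakk> \<Longrightarrow> (x \<oplus> y) \<oplus> z = x \<oplus> (y \<oplus> z)"
    and "\<And>x y. \<lbrakk>x \<in> carrier A; y \<in> carrier A\<rbrakk> \<Longrightarrow> x \<oplus> y = y \<oplus> x"
    and "\<And>x. x \<in> carrier A \<Longrightarrow> \<zero> \<oplus> x = x"
    and "\<And>x. x \<in> carrier A \<Longrightarrow> \<exists>y\<in>carrier A. y \<oplus> x = \<zero>"
    and "\<And>x y. \<lbrakk>x \<in> carrier A; y \<in> carrier A\<rbrakk> \<Longrightarrow> x \<otimes> y \<in> carrier A"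
    and "\<one> \<in> carrier A"
    and "\<And>x y z. \<lbrakk>x \<in> carrier A; y \<in> carrier A; z \<in> carrier A\<rbrakk> \<Longrightarrow> (x \<otimes> y) \<otimes> z = x \<otimes> (y \<otimes> z)"
    and "\<And>x. x \<in> carrier A \<Longrightarrow> \<one> \<otimes> x = x" "\<And>x. x \<in> carrier A \<Longrightarrow> x \<otimes> \<one> = x"
    and "\<And>x y z. \<lbrakk>x \<in> carrier A; y \<in> carrier A; z \<in> carrier A\<rbrakk> \<Longrightarrow> (x \<oplus> y) \<otimes> z = x \<otimes> z \<oplus> y \<otimes> z"
    and "\<And>x y z. \<lbrakk>x \<in> carrier A; y \<in> carrier A; z \<in> carrier A\<rbrakk> \<Longrightarrow> z \<otimes> (x \<oplus> y) = z \<otimes> x \<oplus> z \<otimes> y"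
    and "\<And>c x. x \<in> carrier A \<Longrightarrow> c \<odot> x \<in> carrier A"
    and "\<And>c d x. x \<in> carrier A \<Longrightarrow> (c + d) \<odot> x = c \<odot> x \<oplus> d \<odot> x"
    and "\<And>c x y. \<lbrakk>x \<in> carrier A; y \<in> carrier A\<rbrakk> \<Longrightarrow> c \<odot> (x \<oplus> y) = c \<odot> x \<oplus> c \<odot> y"
    and "\<And>c d x. x \<in> carrier A \<Longrightarrow> (c * d) \<odot> x = c \<odot> (d \<odot> x)"
    and "\<And>x. x \<in> carrier A \<Longrightarrow> 1 \<odot> x = x"
    and "\<And>c x y. \<lbrakk>x \<in> carrier A; y \<in> carrier A\<rbrakk> \<Longrightarrow> (c \<odot> x) \<otimes> y = c \<odot> (x \<otimes> y)"
    and "\<And>c x y. \<lbrakk>x \<in> carrier A; y \<in> carrier A\<rbrakk> \<Longrightarrow> x \<otimes> (c \<odot> y) = c \<odot> (x \<otimes> y)"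
  shows "k_algebra A"
proof -
  have "abelian_group A" by (rule abelian_groupI) (fact assms)+
  moreover have "Group.monoid A" by (rule monoidI) (fact assms)+
  ultimately show ?thesis
    by (intro k_algebra.intro moduleI ringI cring_scalars k_algebra_axioms.intro)
      (simp_all add: assms(12-))
qed

lemma k_algebra_scalars: "k_algebra (scalars :: ('k::field, 'k) module)"
  by (rule k_algebraI) (auto simp: algebra_simps intro: exI[of _ "- x" for x])

lemma module_scalars: "module scalars (scalars :: ('k::field, 'k) module)"
  using k_algebra_scalars by (rule k_algebra.axioms)

text \<open>The axioms are equations and existence statements over the carrier, so they pass to the
  image of a map that respects the operations. This one argument serves quotients, records extended
  by a Hopf structure, and the finite dual.\<close>

lemma k_algebra_image:
  fixes A :: "('k::field, 'a, 'm) module_scheme" and B :: "('k, 'b, 'n) module_scheme"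
  assumes "k_algebra A" and surj: "\<pi> ` carrier A = carrier B"
    and one: "\<pi> \<one>\<^bsub>A\<^esub> = \<one>\<^bsub>B\<^esub>" and zero: "\<pi> \<zero>\<^bsub>A\<^esub> = \<zero>\<^bsub>B\<^esub>"
    and add: "\<And>x y. \<lbrakk>x \<in> carrier A; y \<in> carrier A\<rbrakk> \<Longrightarrow> \<pi> x \<oplus>\<^bsub>B\<^esub> \<pi> y = \<pi> (x \<oplus>\<^bsub>A\<^esub> y)"
    and mult: "\<And>x y. \<lbrakk>x \<in> carrier A; y \<in> carrier A\<rbrakk> \<Longrightarrow> \<pi> x \<otimes>\<^bsub>B\<^esub> \<pi> y = \<pi> (x \<otimes>\<^bsub>A\<^esub> y)"
    and smult: "\<And>c x. x \<in> carrier A \<Longrightarrow> c \<odot>\<^bsub>B\<^esub> \<pi> x = \<pi> (c \<odot>\<^bsub>A\<^esub> x)"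
  shows "k_algebra B"
proof -
  interpret A: k_algebra A by fact
  have sm [simp]: "x \<in> carrier A \<Longrightarrow> c \<odot>\<^bsub>A\<^esub> x \<in> carrier A" for c x
    using A.smult_closed[of c x] by simp
  have cl: "x \<in> carrier A \<Longrightarrow> \<pi> x \<in> carrier B" for x using surj by auto
  note [simp] = cl one[symmetric] zero[symmetric] add mult smult
  note eqs = A.M.add.m_assoc A.m_assoc A.l_distr A.r_distr A.smult_r_distr A.smult_mult_left A.smult_mult_right
    A.smult_l_distr[simplified] A.smult_assoc1[simplified] A.smult_one[simplified]
  show ?thesis
  proof (rule k_algebraI, unfold surj[symmetric], safe)
    fix x assume "x \<in> carrier A"
    then show "\<exists>y\<in>\<pi> ` carrier A. y \<oplus>\<^bsub>B\<^esub> \<pi> x = \<zero>\<^bsub>B\<^esub>"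
      by (intro bexI[of _ "\<pi> (\<ominus>\<^bsub>A\<^esub> x)"]) (auto simp: A.M.l_neg)
  next
    fix x y assume "x \<in> carrier A" "y \<in> carrier A"
    then show "\<pi> x \<oplus>\<^bsub>B\<^esub> \<pi> y = \<pi> y \<oplus>\<^bsub>B\<^esub> \<pi> x" by (simp add: A.M.add.m_comm)
  qed (simp_all add: eqs)
qed

section \<open>Linear maps\<close>

lemma lin_mapI:
  assumes "\<And>x. x \<in> carrier V \<Longrightarrow> f x \<in> carrier W"
    and "\<And>x y. \<lbrakk>x \<in> carrier V; y \<in> carrier V\<rbrakk> \<Longrightarrow> f (x \<oplus>\<^bsub>V\<^esub> y) = f x \<oplus>\<^bsub>W\<^esub> f y"
    and "\<And>c x. x \<in> carrier V \<Longrightarrow> f (c \<odot>\<^bsub>V\<^esub> x) = c \<odot>\<^bsub>W\<^esub> f x"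
  shows "f \<in> lin_map V W"
  using assms by (auto simp: lin_map_def)

lemma lin_mapD:
  assumes "f \<in> lin_map V W"
  shows "x \<in> carrier V \<Longrightarrow> f x \<in> carrier W"
    and "\<lbrakk>x \<in> carrier V; y \<in> carrier V\<rbrakk> \<Longrightarrow> f (x \<oplus>\<^bsub>V\<^esub> y) = f x \<oplus>\<^bsub>W\<^esub> f y"
    and "x \<in> carrier V \<Longrightarrow> f (c \<odot>\<^bsub>V\<^esub> x) = c \<odot>\<^bsub>W\<^esub> f x"
  using assms by (auto simp: lin_map_def)

lemma lin_map_zero:
  assumes "module scalars V" "module scalars W" "f \<in> lin_map V W"
  shows "f \<zero>\<^bsub>V\<^esub> = \<zero>\<^bsub>W\<^esub>"
proof -
  interpret V: module scalars V by fact
  interpret W: module scalars W by fact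
  have "f (0 \<odot>\<^bsub>V\<^esub> \<zero>\<^bsub>V\<^esub>) = 0 \<odot>\<^bsub>W\<^esub> f \<zero>\<^bsub>V\<^esub>" by (rule lin_mapD(3)[OF assms(3)]) simp
  then show ?thesis
    using V.smult_l_null[of "\<zero>\<^bsub>V\<^esub>"] W.smult_l_null[of "f \<zero>\<^bsub>V\<^esub>"] lin_mapD(1)[OF assms(3)] by simp
qed

lemma alg_homD:
  assumes "f \<in> alg_hom A B"
  shows "f \<in> lin_map A B" "f \<one>\<^bsub>A\<^esub> = \<one>\<^bsub>B\<^esub>"
    and "\<lbrakk>x \<in> carrier A; y \<in> carrier A\<rbrakk> \<Longrightarrow> f (x \<otimes>\<^bsub>A\<^esub> y) = f x \<otimes>\<^bsub>B\<^esub> f y"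
  using assms by (auto simp: alg_hom_def ring_hom_def)

lemma alg_homI:
  assumes "f \<in> lin_map A B" "f \<one>\<^bsub>A\<^esub> = \<one>\<^bsub>B\<^esub>"
    and "\<And>x y. \<lbrakk>x \<in> carrier A; y \<in> carrier A\<rbrakk> \<Longrightarrow> f (x \<otimes>\<^bsub>A\<^esub> y) = f x \<otimes>\<^bsub>B\<^esub> f y"
  shows "f \<in> alg_hom A B"
  using assms by (auto simp: alg_hom_def ring_hom_def lin_map_def)

text \<open>Closure under negation follows from closure under scaling, as negation is scaling by
  -1.\<close>

lemma (in module) submodule_scaleI:
  assumes "N \<subseteq> carrier M" "\<zero>\<^bsub>M\<^esub> \<in> N"
    and "\<And>x y. \<lbrakk>x \<in> N; y \<in> N\<rbrakk> \<Longrightarrow> x \<oplus>\<^bsub>M\<^esub> y \<in> N"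
    and smult: "\<And>c x. \<lbrakk>c \<in> carrier R; x \<in> N\<rbrakk> \<Longrightarrow> c \<odot>\<^bsub>M\<^esub> x \<in> N"
  shows "submodule N R M"
proof (rule submoduleI)
  fix x assume x: "x \<in> N"
  then have "x \<in> carrier M" using assms(1) by auto
  then have "(\<ominus> \<one>) \<odot>\<^bsub>M\<^esub> x = \<ominus>\<^bsub>M\<^esub> x" by (simp add: smult_l_minus)
  then show "\<ominus>\<^bsub>M\<^esub> x \<in> N" using smult[of "\<ominus> \<one>" x] x by simp
qed (use assms in auto)

lemma submoduleD:
  assumes "submodule N scalars V"
  shows "N \<subseteq> carrier V" "\<zero>\<^bsub>V\<^esub> \<in> N"
    and "\<lbrakk>x \<in> N; y \<in> N\<rbrakk> \<Longrightarrow> x \<oplus>\<^bsub>V\<^esub> y \<in> N"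
    and "x \<in> N \<Longrightarrow> c \<odot>\<^bsub>V\<^esub> x \<in> N"
proof -
  interpret submodule N scalars V by fact
  show "N \<subseteq> carrier V" "\<zero>\<^bsub>V\<^esub> \<in> N" using subset one_closed by auto
  show "\<lbrakk>x \<in> N; y \<in> N\<rbrakk> \<Longrightarrow> x \<oplus>\<^bsub>V\<^esub> y \<in> N" using m_closed[of x y] by simp
  show "x \<in> N \<Longrightarrow> c \<odot>\<^bsub>V\<^esub> x \<in> N" using smult_closed[of c x] by simp
qed

lemma lin_span_submodule:
  assumes "module scalars V" "S \<subseteq> carrier V"
  shows "submodule (lin_span V S) scalars V"
proof -
  interpret V: module scalars V by fact
  show ?thesis
  proof (rule V.submodule_scaleI)
    show "lin_span V S \<subseteq> carrier V"
      \<comment> \<open>The carrier is itself one of the submodules intersected; without a member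
        above \<open>S\<close> the intersection would be the whole type.\<close>
      using V.carrier_is_submodule assms(2) by (auto simp: lin_span_def)
  qed (auto simp: lin_span_def intro: submoduleD)
qed

lemma lin_span_superset: "S \<subseteq> lin_span V S"
  by (auto simp: lin_span_def)

lemma lin_span_minimal: "\<lbrakk>submodule N scalars V; S \<subseteq> N\<rbrakk> \<Longrightarrow> lin_span V S \<subseteq> N"
  by (auto simp: lin_span_def)

section \<open>Monoid algebras\<close>

lemma lookup_map_times [simp]:
  "lookup (Poly_Mapping.map ((*) c) u) k = (c :: 'k::field) * lookup u k"
  by (simp add: Poly_Mapping.map.rep_eq when_def)

lemma map_times_single [simp]:
  "Poly_Mapping.map ((*) (c :: 'k::field)) (single a d) = single a (c * d)"
  by (rule poly_mapping_eqI) (simp add: lookup_single when_def)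

lemma map_times_zero [simp]: "Poly_Mapping.map ((*) (c :: 'k::field)) 0 = 0"
  by (rule poly_mapping_eqI) simp

lemma keys_map_times: "keys (Poly_Mapping.map ((*) (c :: 'k::field)) u) \<subseteq> keys u"
  by (auto simp: in_keys_iff)

lemma monoid_algebra_simps [simp]:
  "u \<in> carrier (monoid_algebra G) \<longleftrightarrow> keys u \<subseteq> carrier G"
  "\<one>\<^bsub>monoid_algebra G\<^esub> = single \<one>\<^bsub>G\<^esub> 1"
  "\<zero>\<^bsub>monoid_algebra G\<^esub> = 0"
  "u \<oplus>\<^bsub>monoid_algebra G\<^esub> v = u + v"
  "c \<odot>\<^bsub>monoid_algebra G\<^esub> u = Poly_Mapping.map ((*) c) u"
  by (simp_all add: monoid_algebra_def)

text \<open>Keys are split off one at a time. Linear and multilinear identities are reduced with it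
  to basis elements; the case \<open>single\<close> carries an arbitrary coefficient and so takes
  care of scaling.\<close>

lemma poly_mapping_on_induct [consumes 1, case_names zero add single]:
  fixes u :: "'a \<Rightarrow>\<^sub>0 'b::ab_group_add"
  assumes "keys u \<subseteq> S" and "P 0"
    and "\<And>u v. \<lbrakk>keys u \<subseteq> S; keys v \<subseteq> S; P u; P v\<rbrakk> \<Longrightarrow> P (u + v)"
    and "\<And>a c. a \<in> S \<Longrightarrow> P (single a c)"
  shows "P u"
  using assms(1)
proof (induction "card (keys u)" arbitrary: u)
  case 0
  then have "u = 0" by simp
  then show ?case using assms(2) by simp
next
  case (Suc n)
  then obtain a where a: "a \<in> keys u" by fastforce
  define v where "v = u - single a (lookup u a)"
  have "keys v = keys u - {a}"
    by (auto simp: v_def in_keys_iff lookup_minus lookup_single when_def split: if_splits)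
  moreover from this have "P v" using Suc a by (intro Suc(1)) auto
  ultimately have "P (v + single a (lookup u a))"
    using Suc(3) a by (intro assms(3,4)) (auto split: if_splits)
  then show ?case by (simp add: v_def)
qed

lemma keys_add_subset: "\<lbrakk>keys u \<subseteq> S; keys v \<subseteq> S\<rbrakk> \<Longrightarrow> keys (u + v) \<subseteq> S"
  using Poly_Mapping.keys_add[of u v] by blast

text \<open>The supports of \<open>u\<close>, \<open>v\<close> and \<open>u + v\<close> differ, and
  additivity of the product can be read off only when the three sums run over a common index
  set.\<close>

lemma monoid_algebra_mult_superset:
  fixes u v :: "'g \<Rightarrow>\<^sub>0 'k::field"
  assumes "finite S" "keys u \<subseteq> S" "finite T" "keys v \<subseteq> T"
  shows "u \<otimes>\<^bsub>monoid_algebra G\<^esub> v = (\<Sum>a\<in>S. \<Sum>b\<in>T.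
    single (a \<otimes>\<^bsub>G\<^esub> b) (lookup u a * lookup v b))"
proof -
  have "u \<otimes>\<^bsub>monoid_algebra G\<^esub> v = (\<Sum>a\<in>keys u. \<Sum>b\<in>T.
    single (a \<otimes>\<^bsub>G\<^esub> b) (lookup u a * lookup v b))"
    unfolding monoid_algebra_def
    by (simp, intro sum.cong refl sum.mono_neutral_left) (use assms in \<open>auto simp: in_keys_iff\<close>)
  also have "\<dots> = (\<Sum>a\<in>S. \<Sum>b\<in>T.
    single (a \<otimes>\<^bsub>G\<^esub> b) (lookup u a * lookup v b))"
    by (intro sum.mono_neutral_left) (use assms in \<open>auto simp: in_keys_iff\<close>)
  finally show ?thesis .
qed

lemma monoid_algebra_mult:
  fixes u v w :: "'g \<Rightarrow>\<^sub>0 'k::field"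
  shows "(u + v) \<otimes>\<^bsub>monoid_algebra G\<^esub> w = u \<otimes>\<^bsub>monoid_algebra G\<^esub> w + v \<otimes>\<^bsub>monoid_algebra G\<^esub> w"
    and "w \<otimes>\<^bsub>monoid_algebra G\<^esub> (u + v) = w \<otimes>\<^bsub>monoid_algebra G\<^esub> u + w \<otimes>\<^bsub>monoid_algebra G\<^esub> v"
    and "0 \<otimes>\<^bsub>monoid_algebra G\<^esub> w = 0" and "w \<otimes>\<^bsub>monoid_algebra G\<^esub> 0 = 0"
    and "single a c \<otimes>\<^bsub>monoid_algebra G\<^esub> single b d
      = single (a \<otimes>\<^bsub>G\<^esub> b) (c * d :: 'k)"
proof -
  let ?U = "keys u \<union> keys v" and ?W = "keys w"
  have *: "finite ?U" "finite ?W" "keys u \<subseteq> ?U" "keys v \<subseteq> ?U"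
    "?W \<subseteq> ?W" "keys (u + v) \<subseteq> ?U"
    by (auto dest: subsetD[OF Poly_Mapping.keys_add])
  show "(u + v) \<otimes>\<^bsub>monoid_algebra G\<^esub> w = u \<otimes>\<^bsub>monoid_algebra G\<^esub> w + v \<otimes>\<^bsub>monoid_algebra G\<^esub> w"
    using * by (simp add: monoid_algebra_mult_superset[of ?U _ ?W] lookup_add single_add
        distrib_right sum.distrib)
  show "w \<otimes>\<^bsub>monoid_algebra G\<^esub> (u + v) = w \<otimes>\<^bsub>monoid_algebra G\<^esub> u + w \<otimes>\<^bsub>monoid_algebra G\<^esub> v"
    using * by (simp add: monoid_algebra_mult_superset[of ?W _ ?U] lookup_add single_add
        distrib_left sum.distrib)
  show "0 \<otimes>\<^bsub>monoid_algebra G\<^esub> w = 0" "w \<otimes>\<^bsub>monoid_algebra G\<^esub> 0 = 0"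
    by (simp_all add: monoid_algebra_def)
  show "single a c \<otimes>\<^bsub>monoid_algebra G\<^esub> single b d
      = single (a \<otimes>\<^bsub>G\<^esub> b) (c * d)"
    by (simp add: monoid_algebra_mult_superset[of "{a}" _ "{b}"])
qed

lemma monoid_algebra_mult_diff:
  fixes u v w :: "'g \<Rightarrow>\<^sub>0 'k::field"
  shows "(u - v) \<otimes>\<^bsub>monoid_algebra G\<^esub> w = u \<otimes>\<^bsub>monoid_algebra G\<^esub> w - v \<otimes>\<^bsub>monoid_algebra G\<^esub> w"
    and "w \<otimes>\<^bsub>monoid_algebra G\<^esub> (u - v) = w \<otimes>\<^bsub>monoid_algebra G\<^esub> u - w \<otimes>\<^bsub>monoid_algebra G\<^esub> v"
  using monoid_algebra_mult(1)[of G "u - v" v w] monoid_algebra_mult(2)[of G w "u - v" v]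
  by (simp_all add: eq_diff_eq)

text \<open>The axioms that involve multiplication are linear in each argument, so nested inductions
  leave basis elements, where associativity and units are those of the monoid.\<close>

lemma k_algebra_monoid_algebra:
  assumes "Group.monoid G"
  shows "k_algebra (monoid_algebra G :: ('k::field, 'g \<Rightarrow>\<^sub>0 'k) module)"
proof -
  interpret Group.monoid G by fact
  let ?A = "monoid_algebra G :: ('k, 'g \<Rightarrow>\<^sub>0 'k) module"
  note [simp] = monoid_algebra_mult keys_add_subset
  have map_add: "Poly_Mapping.map ((*) c) (u + v) = Poly_Mapping.map ((*) c) u + Poly_Mapping.map ((*) c) v"
    for c and u v :: "'g \<Rightarrow>\<^sub>0 'k" by (rule poly_mapping_eqI) (simp add: lookup_add algebra_simps)
  show ?thesis
  proof (rule k_algebraI, unfold monoid_algebra_simps)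
    fix u v w :: "'g \<Rightarrow>\<^sub>0 'k" and c d :: 'k
    assume u: "keys u \<subseteq> carrier G"
    show "\<exists>v\<in>carrier ?A. v + u = 0" using u by (intro bexI[of _ "- u"]) (auto simp: in_keys_iff)
    show "single \<one>\<^bsub>G\<^esub> 1 \<otimes>\<^bsub>?A\<^esub> u = u" "u \<otimes>\<^bsub>?A\<^esub> single \<one>\<^bsub>G\<^esub> 1 = u"
      using u by (induction rule: poly_mapping_on_induct; simp)+
    show "keys (Poly_Mapping.map ((*) c) u) \<subseteq> carrier G"
      by (rule order.trans[OF keys_map_times u])
    show "Poly_Mapping.map ((*) (c + d)) u = Poly_Mapping.map ((*) c) u + Poly_Mapping.map ((*) d) u"
      "Poly_Mapping.map ((*) (c * d)) u = Poly_Mapping.map ((*) c) (Poly_Mapping.map ((*) d) u)"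
      "Poly_Mapping.map ((*) 1) u = u"
      by (rule poly_mapping_eqI; simp add: lookup_add algebra_simps)+
    assume v: "keys v \<subseteq> carrier G"
    show "keys (u \<otimes>\<^bsub>?A\<^esub> v) \<subseteq> carrier G" using u
    proof (induction rule: poly_mapping_on_induct)
      case (single a c)
      show ?case using v by (induction rule: poly_mapping_on_induct) (auto simp: single)
    qed auto
    show "Poly_Mapping.map ((*) c) u \<otimes>\<^bsub>?A\<^esub> v = Poly_Mapping.map ((*) c) (u \<otimes>\<^bsub>?A\<^esub> v)" using u
    proof (induction rule: poly_mapping_on_induct)
      case (single a d)
      show ?case using v
        by (induction rule: poly_mapping_on_induct) (auto simp: map_add mult.assoc mult.left_commute)
    qed (auto simp: map_add)
    show "u \<otimes>\<^bsub>?A\<^esub> Poly_Mapping.map ((*) c) v = Poly_Mapping.map ((*) c) (u \<otimes>\<^bsub>?A\<^esub> v)" using v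
    proof (induction rule: poly_mapping_on_induct)
      case (single a d)
      show ?case using u
        by (induction rule: poly_mapping_on_induct) (auto simp: map_add mult.assoc mult.left_commute)
    qed (auto simp: map_add)
    assume w: "keys w \<subseteq> carrier G"
    show "u \<otimes>\<^bsub>?A\<^esub> v \<otimes>\<^bsub>?A\<^esub> w = u \<otimes>\<^bsub>?A\<^esub> (v \<otimes>\<^bsub>?A\<^esub> w)" using u
    proof (induction rule: poly_mapping_on_induct)
      case (single a c)
      show ?case using v
      proof (induction rule: poly_mapping_on_induct)
        case (single b d)
        show ?case using w
          by (induction rule: poly_mapping_on_induct) (auto simp: \<open>a \<in> carrier G\<close> single m_assoc mult.assoc)
      qed auto
    qed auto
  qed (auto simp: algebra_simps map_add)
qed

text \<open>Equality of cosets is expressed with the ring subtraction, whereas the relations are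
  written with the subtraction of finitely supported functions; on the carrier the two
  agree.\<close>

lemma monoid_algebra_minus:
  fixes u v :: "'g \<Rightarrow>\<^sub>0 'k::field"
  assumes "Group.monoid G" "u \<in> carrier (monoid_algebra G)" "v \<in> carrier (monoid_algebra G)"
  shows "u \<ominus>\<^bsub>(monoid_algebra G :: ('k, _) module)\<^esub> v = u - v"
proof -
  interpret k_algebra "monoid_algebra G :: ('k, _) module" by (rule k_algebra_monoid_algebra) fact
  have "\<ominus>\<^bsub>(monoid_algebra G :: ('k, _) module)\<^esub> v = - v"
    using assms by (intro minus_equality) (auto simp: in_keys_iff)
  then show ?thesis by (simp add: a_minus_def)
qed

section \<open>Linear extension\<close>

lemma lin_ext_superset:
  assumes "module scalars V" "finite S" "keys u \<subseteq> S" "\<And>p. p \<in> S \<Longrightarrow> b p \<in> carrier V"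
  shows "lin_ext V b u = (\<Oplus>\<^bsub>V\<^esub>p\<in>S. lookup u p \<odot>\<^bsub>V\<^esub> b p)"
proof -
  interpret V: module scalars V by fact
  have sm [simp]: "x \<in> carrier V \<Longrightarrow> c \<odot>\<^bsub>V\<^esub> x \<in> carrier V" for c x
    using V.smult_closed[of c x] by simp
  have z: "x \<in> carrier V \<Longrightarrow> 0 \<odot>\<^bsub>V\<^esub> x = \<zero>\<^bsub>V\<^esub>" for x using V.smult_l_null by simp
  show ?thesis unfolding lin_ext_def
    by (rule V.add.finprod_mono_neutral_cong_left) (use assms in \<open>auto simp: in_keys_iff z\<close>)
qed

context
  fixes V :: "('k::field, 'v, 'm) module_scheme" and b :: "'p \<Rightarrow> 'v"
  assumes V: "module scalars V"
begin

interpretation V: module scalars V by (rule V)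

private lemma sm [simp]: "x \<in> carrier V \<Longrightarrow> c \<odot>\<^bsub>V\<^esub> x \<in> carrier V"
  using V.smult_closed[of c x] by simp

lemma lin_ext_zero [simp]: "lin_ext V b 0 = \<zero>\<^bsub>V\<^esub>"
  by (simp add: lin_ext_def)

lemma lin_ext_closed:
  "(\<And>p. p \<in> keys u \<Longrightarrow> b p \<in> carrier V) \<Longrightarrow> lin_ext V b u \<in> carrier V"
  unfolding lin_ext_def by (rule V.finsum_closed) auto

lemma lin_ext_single: "b p \<in> carrier V \<Longrightarrow> lin_ext V b (single p c) = c \<odot>\<^bsub>V\<^esub> b p"
  by (subst lin_ext_superset[OF V, of "{p}"]) auto

lemma lin_ext_add:
  assumes "\<And>p. p \<in> keys u \<union> keys v \<Longrightarrow> b p \<in> carrier V"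
  shows "lin_ext V b (u + v) = lin_ext V b u \<oplus>\<^bsub>V\<^esub> lin_ext V b v"
proof -
  let ?S = "keys u \<union> keys v"
  have "keys (u + v) \<subseteq> ?S" by (rule Poly_Mapping.keys_add)
  then show ?thesis using assms
    by (subst (1 2 3) lin_ext_superset[OF V, of ?S])
      (auto simp: lookup_add V.smult_l_distr[simplified] simp flip: V.finsum_addf intro!: V.finsum_cong')
qed

lemma lin_ext_cong:
  assumes "\<And>p. p \<in> keys u \<Longrightarrow> b p \<in> carrier V"
    and "\<And>p. p \<in> keys u \<Longrightarrow> b' p = b p"
  shows "lin_ext V b' u = lin_ext V b u"
  unfolding lin_ext_def by (rule V.finsum_cong') (use assms in auto)

lemma lin_ext_smult:
  assumes "\<And>p. p \<in> keys u \<Longrightarrow> b p \<in> carrier V"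
  shows "lin_ext V b (Poly_Mapping.map ((*) c) u) = c \<odot>\<^bsub>V\<^esub> lin_ext V b u"
proof -
  have "keys u \<subseteq> {p. b p \<in> carrier V}" using assms by auto
  then show ?thesis
  proof (induction rule: poly_mapping_on_induct)
    case (add u v)
    have "Poly_Mapping.map ((*) c) (u + v) = Poly_Mapping.map ((*) c) u + Poly_Mapping.map ((*) c) v"
      by (rule poly_mapping_eqI) (simp add: lookup_add algebra_simps)
    moreover have "keys (Poly_Mapping.map ((*) c) u) \<subseteq> {p. b p \<in> carrier V}"
      "keys (Poly_Mapping.map ((*) c) v) \<subseteq> {p. b p \<in> carrier V}"
      using add by (auto dest: subsetD[OF keys_map_times])
    ultimately have "lin_ext V b (Poly_Mapping.map ((*) c) (u + v))
        = c \<odot>\<^bsub>V\<^esub> lin_ext V b u \<oplus>\<^bsub>V\<^esub> c \<odot>\<^bsub>V\<^esub> lin_ext V b v"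
      using add by (simp add: lin_ext_add subset_eq ball_Un Un_iff) (subst lin_ext_add, auto)
    also have "\<dots> = c \<odot>\<^bsub>V\<^esub> lin_ext V b (u + v)"
      using add by (subst lin_ext_add) (auto simp: V.smult_r_distr intro!: V.smult_r_distr[symmetric] lin_ext_closed)
    finally show ?case .
  qed (auto simp: lin_ext_single V.smult_assoc1[simplified] V.smult_r_null[simplified]
      )
qed

end

lemma lin_map_lin_ext:
  fixes u :: "'p \<Rightarrow>\<^sub>0 'k::field"
  assumes V: "module scalars V" and W: "module scalars W" and g: "g \<in> lin_map V W"
    and b: "\<And>p. p \<in> keys u \<Longrightarrow> b p \<in> carrier V"
  shows "g (lin_ext V b u) = lin_ext W (\<lambda>p. g (b p)) u"
proof -
  have "keys u \<subseteq> {p. b p \<in> carrier V}" using b by auto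
  then show ?thesis
  proof (induction rule: poly_mapping_on_induct)
    case (add u v)
    then have "lin_ext V b (u + v) = lin_ext V b u \<oplus>\<^bsub>V\<^esub> lin_ext V b v"
      "lin_ext W (\<lambda>p. g (b p)) (u + v) = lin_ext W (\<lambda>p. g (b p)) u \<oplus>\<^bsub>W\<^esub> lin_ext W (\<lambda>p. g (b p)) v"
      "lin_ext V b u \<in> carrier V" "lin_ext V b v \<in> carrier V"
      by (auto intro!: lin_ext_add lin_ext_closed V W lin_mapD(1)[OF g])
    then show ?case using add lin_mapD(2)[OF g] by simp
  qed (auto simp: lin_ext_zero V W lin_map_zero[OF V W g] lin_ext_single lin_mapD[OF g])
qed

lemma lin_ext_scalars: "lin_ext scalars b u = (\<Sum>p\<in>keys u. lookup u p * b p)"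
proof -
  interpret module scalars "scalars :: ('a, 'a) module" by (rule module_scalars)
  have "finsum scalars f S = sum f S" if "finite S" for f :: "'b \<Rightarrow> 'a" and S
    using that by induction auto
  then show ?thesis by (simp add: lin_ext_def)
qed

text \<open>Both sides are bilinear in \<open>u\<close> and \<open>v\<close>, so multiplicativity of
  \<open>b\<close> on the monoid suffices.\<close>

lemma lin_ext_mult:
  fixes B :: "('k::field, 'b, 'm) module_scheme"
  assumes B: "k_algebra B" and b: "\<And>p. p \<in> carrier G \<Longrightarrow> b p \<in> carrier B"
    and m: "\<And>p q. \<lbrakk>p \<in> carrier G; q \<in> carrier G\<rbrakk> \<Longrightarrow> b (p \<otimes>\<^bsub>G\<^esub> q) = b p \<otimes>\<^bsub>B\<^esub> b q"
    and G: "Group.monoid G" and u: "keys u \<subseteq> carrier G" and v: "keys v \<subseteq> carrier G"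
  shows "lin_ext B b (u \<otimes>\<^bsub>monoid_algebra G\<^esub> v) = lin_ext B b u \<otimes>\<^bsub>B\<^esub> lin_ext B b v"
proof -
  interpret B: k_algebra B by fact
  interpret G: Group.monoid G by fact
  interpret MA: k_algebra "monoid_algebra G :: ('k, _) module" by (rule k_algebra_monoid_algebra) fact
  have Bm: "module scalars B" by (rule B.module_axioms)
  note cl [simp] = MA.m_closed[simplified]
  have sm [simp]: "x \<in> carrier B \<Longrightarrow> c \<odot>\<^bsub>B\<^esub> x \<in> carrier B" for c x
    using B.smult_closed[of c x] by simp
  have le_cl: "lin_ext B b u \<in> carrier B" if "keys u \<subseteq> carrier G" for u
    using that b by (auto intro!: lin_ext_closed Bm)
  have le_add: "lin_ext B b (u + v) = lin_ext B b u \<oplus>\<^bsub>B\<^esub> lin_ext B b v"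
    if "keys u \<subseteq> carrier G" "keys v \<subseteq> carrier G" for u v
    using that b by (auto intro!: lin_ext_add Bm)
  show ?thesis using u
  proof (induction rule: poly_mapping_on_induct)
    case (single a c)
    show ?case using v
    proof (induction rule: poly_mapping_on_induct)
      case (single a' c')
      with \<open>a \<in> carrier G\<close> show ?case
        by (simp add: monoid_algebra_mult lin_ext_single[OF Bm] b m B.smult_mult_left B.smult_mult_right
            B.smult_assoc1[simplified, symmetric] mult.commute)
    next
      case (add u' v')
      then show ?case using single by (simp add: monoid_algebra_mult le_add le_cl B.r_distr)
    qed (simp add: monoid_algebra_mult lin_ext_zero[OF Bm] lin_ext_single[OF Bm] b single)
  next
    case (add u' v')
    then show ?case using v by (simp add: monoid_algebra_mult le_add le_cl B.l_distr)
  qed (use v in \<open>simp add: monoid_algebra_mult lin_ext_zero[OF Bm] le_cl\<close>)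
qed

section \<open>Quotient algebras\<close>

lemma quot_alg_simps:
  "carrier (quot_alg A I) = (\<lambda>a. I +>\<^bsub>A\<^esub> a) ` carrier A"
  "\<one>\<^bsub>quot_alg A I\<^esub> = I +>\<^bsub>A\<^esub> \<one>\<^bsub>A\<^esub>" "\<zero>\<^bsub>quot_alg A I\<^esub> = I"
  "x \<oplus>\<^bsub>quot_alg A I\<^esub> y = x <+>\<^bsub>A\<^esub> y"
  by (auto simp: quot_alg_def FactRing_def A_RCOSETS_def' a_r_coset_def')

context
  fixes A :: "('k::field, 'a, 'm) module_scheme" and I :: "'a set"
  assumes A: "k_algebra A" and I: "ideal I A"
begin

interpretation A: k_algebra A by (rule A)
interpretation I: ideal I A by (rule I)

text \<open>Scaling by \<open>c\<close> is multiplication by \<open>c\<close> times the unit, which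
  an ideal absorbs.\<close>

lemma k_ideal_smult: "i \<in> I \<Longrightarrow> c \<odot>\<^bsub>A\<^esub> i \<in> I"
  using I.I_l_closed[of i "c \<odot>\<^bsub>A\<^esub> \<one>\<^bsub>A\<^esub>"] A.smult_closed[of c "\<one>\<^bsub>A\<^esub>"] A.smult_mult_left[of "\<one>\<^bsub>A\<^esub>" i c]
  by simp

lemma quot_eq_iff:
  assumes "x \<in> carrier A" "y \<in> carrier A"
  shows "I +>\<^bsub>A\<^esub> x = I +>\<^bsub>A\<^esub> y \<longleftrightarrow> x \<ominus>\<^bsub>A\<^esub> y \<in> I"
  using A.quotient_eq_iff_same_a_r_cos[OF I assms] by simp

lemma quot_add:
  "\<lbrakk>x \<in> carrier A; y \<in> carrier A\<rbrakk> \<Longrightarrow> (I +>\<^bsub>A\<^esub> x) \<oplus>\<^bsub>quot_alg A I\<^esub> (I +>\<^bsub>A\<^esub> y) = I +>\<^bsub>A\<^esub> (x \<oplus>\<^bsub>A\<^esub> y)"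
  by (simp add: quot_alg_simps I.a_rcos_sum)

lemma quot_mult:
  "\<lbrakk>x \<in> carrier A; y \<in> carrier A\<rbrakk> \<Longrightarrow> (I +>\<^bsub>A\<^esub> x) \<otimes>\<^bsub>quot_alg A I\<^esub> (I +>\<^bsub>A\<^esub> y) = I +>\<^bsub>A\<^esub> (x \<otimes>\<^bsub>A\<^esub> y)"
  by (simp add: quot_alg_def FactRing_def I.rcoset_mult_add)

text \<open>Scalar multiplication of a coset is defined as a union over its representatives. Each of
  them contributes the same coset and there is at least one, so the union is that coset.\<close>

lemma quot_smult:
  assumes x: "x \<in> carrier A"
  shows "c \<odot>\<^bsub>quot_alg A I\<^esub> (I +>\<^bsub>A\<^esub> x) = I +>\<^bsub>A\<^esub> (c \<odot>\<^bsub>A\<^esub> x)"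
proof -
  have "I +>\<^bsub>A\<^esub> (c \<odot>\<^bsub>A\<^esub> y) = I +>\<^bsub>A\<^esub> (c \<odot>\<^bsub>A\<^esub> x)" if y: "y \<in> I +>\<^bsub>A\<^esub> x" for y
  proof -
    obtain i where i: "i \<in> I" "y = i \<oplus>\<^bsub>A\<^esub> x" using y by (auto simp: a_r_coset_def')
    have ic: "i \<in> carrier A" using i by simp
    have "c \<odot>\<^bsub>A\<^esub> y = c \<odot>\<^bsub>A\<^esub> i \<oplus>\<^bsub>A\<^esub> c \<odot>\<^bsub>A\<^esub> x" using A.smult_r_distr[of c i x] i x ic by simp
    then have "c \<odot>\<^bsub>A\<^esub> y \<in> I +>\<^bsub>A\<^esub> (c \<odot>\<^bsub>A\<^esub> x)" using k_ideal_smult[OF i(1)] by (auto simp: a_r_coset_def')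
    then show ?thesis using I.a_repr_independence'[of "c \<odot>\<^bsub>A\<^esub> y" "c \<odot>\<^bsub>A\<^esub> x"] x A.smult_closed[of c x] by simp
  qed
  moreover have "I +>\<^bsub>A\<^esub> x \<noteq> {}" using I.a_rcos_self[OF x] by blast
  ultimately show ?thesis unfolding quot_alg_def module.simps by (intro SUP_eq_const)
qed

lemma k_algebra_quot: "k_algebra (quot_alg A I)"
proof (rule k_algebra_image[OF A, of "\<lambda>a. I +>\<^bsub>A\<^esub> a"])
  show "I +>\<^bsub>A\<^esub> \<zero>\<^bsub>A\<^esub> = \<zero>\<^bsub>quot_alg A I\<^esub>" by (simp add: quot_alg_simps I.a_rcos_const)
qed (auto simp: quot_alg_simps(1,2) quot_add quot_mult quot_smult)

text \<open>A representative picked by \<open>SOME\<close> is known only up to the ideal; a linear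
  map that kills \<open>I\<close> does not see the difference.\<close>

lemma quot_some:
  assumes "x \<in> carrier A"
  obtains i where "i \<in> I" "(SOME u. u \<in> I +>\<^bsub>A\<^esub> x) = i \<oplus>\<^bsub>A\<^esub> x"
proof -
  have "(SOME u. u \<in> I +>\<^bsub>A\<^esub> x) \<in> I +>\<^bsub>A\<^esub> x"
    using I.a_rcos_self[OF assms] by (rule someI)
  then show ?thesis using that by (auto simp: a_r_coset_def')
qed

end

text \<open>
  Both \<^const>\<open>tensor_lift\<close> and \<^const>\<open>gen_hom\<close> are instances of the map of the next lemmas.
\<close>

context
  fixes G :: "('g, 'n) monoid_scheme" and I :: "('g \<Rightarrow>\<^sub>0 'k::field) set"
    and V :: "('k, 'v, 'm) module_scheme" and b :: "'g \<Rightarrow> 'v"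
  assumes G: "Group.monoid G" and I: "ideal I (monoid_algebra G :: ('k, _) module)"
    and V: "module scalars V" and b: "\<And>p. p \<in> carrier G \<Longrightarrow> b p \<in> carrier V"
    and kill: "\<And>u. u \<in> I \<Longrightarrow> lin_ext V b u = \<zero>\<^bsub>V\<^esub>"
begin

private abbreviation (input) "MA \<equiv> monoid_algebra G :: ('k, 'g \<Rightarrow>\<^sub>0 'k) module"

interpretation V: module scalars V by (rule V)
interpretation MA: k_algebra MA by (rule k_algebra_monoid_algebra[OF G])
interpretation I: ideal I MA by (rule I)

lemma quot_lift_coset:
  assumes u: "u \<in> carrier MA"
  shows "lin_ext V b (SOME v. v \<in> I +>\<^bsub>MA\<^esub> u) = lin_ext V b u"
proof -
  obtain i where i: "i \<in> I" "(SOME v. v \<in> I +>\<^bsub>MA\<^esub> u) = i + u"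
    using quot_some[OF MA.k_algebra_axioms I u] by auto
  have ic: "keys i \<subseteq> carrier G" using I.a_Hcarr[OF i(1)] by simp
  have "lin_ext V b (i + u) = lin_ext V b i \<oplus>\<^bsub>V\<^esub> lin_ext V b u"
    using ic u b by (intro lin_ext_add[OF V]) auto
  moreover have "lin_ext V b u \<in> carrier V" using u b by (intro lin_ext_closed[OF V]) auto
  ultimately show ?thesis using i kill by simp
qed

lemma quot_lift_lin_map: "(\<lambda>S. lin_ext V b (SOME v. v \<in> S)) \<in> lin_map (quot_alg MA I) V"
proof (rule lin_mapI)
  fix S assume "S \<in> carrier (quot_alg MA I)"
  then obtain u where u: "u \<in> carrier MA" "S = I +>\<^bsub>MA\<^esub> u" by (auto simp: quot_alg_simps simp del: monoid_algebra_simps)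
  show "lin_ext V b (SOME v. v \<in> S) \<in> carrier V"
    using u b by (auto simp: quot_lift_coset intro!: lin_ext_closed[OF V])
  fix c
  have "Poly_Mapping.map ((*) c) u \<in> carrier MA" using MA.smult_closed[of c u] u by simp
  then show "lin_ext V b (SOME v. v \<in> c \<odot>\<^bsub>quot_alg MA I\<^esub> S) = c \<odot>\<^bsub>V\<^esub> lin_ext V b (SOME v. v \<in> S)"
    using u b by (simp add: quot_smult[OF MA.k_algebra_axioms I] quot_lift_coset)
      (intro lin_ext_smult[OF V]; auto)
next
  fix S T assume "S \<in> carrier (quot_alg MA I)" "T \<in> carrier (quot_alg MA I)"
  then obtain u v where u: "u \<in> carrier MA" "S = I +>\<^bsub>MA\<^esub> u" and v: "v \<in> carrier MA" "T = I +>\<^bsub>MA\<^esub> v"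
    by (auto simp: quot_alg_simps simp del: monoid_algebra_simps)
  have "u + v \<in> carrier MA" using u v by (simp add: keys_add_subset)
  moreover have "lin_ext V b (u + v) = lin_ext V b u \<oplus>\<^bsub>V\<^esub> lin_ext V b v"
    using u v b by (intro lin_ext_add[OF V]) auto
  ultimately show "lin_ext V b (SOME v. v \<in> S \<oplus>\<^bsub>quot_alg MA I\<^esub> T)
      = lin_ext V b (SOME v. v \<in> S) \<oplus>\<^bsub>V\<^esub> lin_ext V b (SOME v. v \<in> T)"
    using quot_add[OF MA.k_algebra_axioms I u(1) v(1)] by (simp add: u v quot_lift_coset[simplified] u(1)[simplified] v(1)[simplified])
qed

lemma quot_lift_alg_hom:
  assumes B: "k_algebra V" and one: "b \<one>\<^bsub>G\<^esub> = \<one>\<^bsub>V\<^esub>"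
    and m: "\<And>p q. \<lbrakk>p \<in> carrier G; q \<in> carrier G\<rbrakk> \<Longrightarrow> b (p \<otimes>\<^bsub>G\<^esub> q) = b p \<otimes>\<^bsub>V\<^esub> b q"
  shows "(\<lambda>S. lin_ext V b (SOME v. v \<in> S)) \<in> alg_hom (quot_alg MA I) V"
proof (rule alg_homI[OF quot_lift_lin_map])
  interpret B: k_algebra V by (rule B)
  interpret G: Group.monoid G by (rule G)
  show "lin_ext V b (SOME v. v \<in> \<one>\<^bsub>quot_alg MA I\<^esub>) = \<one>\<^bsub>V\<^esub>"
    using one V.smult_one[of "\<one>\<^bsub>V\<^esub>"]
    by (simp add: quot_alg_simps(2) quot_lift_coset[simplified] lin_ext_single[OF V] b)
  fix S T assume "S \<in> carrier (quot_alg MA I)" "T \<in> carrier (quot_alg MA I)"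
  then obtain u v where u: "u \<in> carrier MA" "S = I +>\<^bsub>MA\<^esub> u" and v: "v \<in> carrier MA" "T = I +>\<^bsub>MA\<^esub> v"
    by (auto simp: quot_alg_simps simp del: monoid_algebra_simps)
  show "lin_ext V b (SOME v. v \<in> S \<otimes>\<^bsub>quot_alg MA I\<^esub> T)
      = lin_ext V b (SOME v. v \<in> S) \<otimes>\<^bsub>V\<^esub> lin_ext V b (SOME v. v \<in> T)"
    using u v MA.m_closed[OF u(1) v(1)] lin_ext_mult[OF B b m G] 
    by (simp add: quot_mult[OF MA.k_algebra_axioms I] quot_lift_coset)
qed

end

section \<open>Tensor products\<close>

definition bilinear ::
  "('k::field, 'a, 'm) module_scheme \<Rightarrow> ('k, 'b, 'n) module_scheme \<Rightarrow> ('k, 'v, 'l) module_scheme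
    \<Rightarrow> ('a \<Rightarrow> 'b \<Rightarrow> 'v) \<Rightarrow> bool" where
  "bilinear A B V b \<longleftrightarrow> (\<forall>y\<in>carrier B. (\<lambda>x. b x y) \<in> lin_map A V) \<and> (\<forall>x\<in>carrier A. b x \<in> lin_map B V)"

lemma bilinearI:
  assumes "\<And>y. y \<in> carrier B \<Longrightarrow> (\<lambda>x. b x y) \<in> lin_map A V" "\<And>x. x \<in> carrier A \<Longrightarrow> b x \<in> lin_map B V"
  shows "bilinear A B V b"
  using assms by (simp add: bilinear_def)

lemma bilinearD:
  assumes "bilinear A B V b"
  shows "\<lbrakk>x \<in> carrier A; y \<in> carrier B\<rbrakk> \<Longrightarrow> b x y \<in> carrier V"
    and "\<lbrakk>x \<in> carrier A; x' \<in> carrier A; y \<in> carrier B\<rbrakk> \<Longrightarrow> b (x \<oplus>\<^bsub>A\<^esub> x') y = b x y \<oplus>\<^bsub>V\<^esub> b x' y"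
    and "\<lbrakk>x \<in> carrier A; y \<in> carrier B; y' \<in> carrier B\<rbrakk> \<Longrightarrow> b x (y \<oplus>\<^bsub>B\<^esub> y') = b x y \<oplus>\<^bsub>V\<^esub> b x y'"
    and "\<lbrakk>x \<in> carrier A; y \<in> carrier B\<rbrakk> \<Longrightarrow> b (c \<odot>\<^bsub>A\<^esub> x) y = c \<odot>\<^bsub>V\<^esub> b x y"
    and "\<lbrakk>x \<in> carrier A; y \<in> carrier B\<rbrakk> \<Longrightarrow> b x (c \<odot>\<^bsub>B\<^esub> y) = c \<odot>\<^bsub>V\<^esub> b x y"
  using assms by (auto simp: bilinear_def lin_map_def)

lemma bilinear_scalars:
  assumes "f \<in> lin_map A scalars" "g \<in> lin_map B scalars"
  shows "bilinear A B scalars (\<lambda>x y. f x * g y)"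
  using assms by (auto simp: bilinear_def lin_map_def algebra_simps)

definition tensor_class ::
  "('k::field, 'a, 'm) module_scheme \<Rightarrow> ('k, 'b, 'n) module_scheme \<Rightarrow> ('a \<times> 'b \<Rightarrow>\<^sub>0 'k) \<Rightarrow> ('k, 'a, 'b) tens" where
  "tensor_class A B u = tensor_null A B +>\<^bsub>(monoid_algebra (A \<times>\<times> B) :: ('k, _) module)\<^esub> u"

context
  fixes A :: "('k::field, 'a, 'm) module_scheme" and B :: "('k, 'b, 'n) module_scheme"
  assumes A: "k_algebra A" and B: "k_algebra B"
begin

interpretation A: k_algebra A by (rule A)
interpretation B: k_algebra B by (rule B)

private abbreviation (input) "AB \<equiv> A \<times>\<times> B"
private abbreviation (input) "MAB \<equiv> monoid_algebra (A \<times>\<times> B) :: ('k, 'a \<times> 'b \<Rightarrow>\<^sub>0 'k) module"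
private abbreviation (input) "N \<equiv> tensor_null A B"

private lemma smA [simp]: "x \<in> carrier A \<Longrightarrow> c \<odot>\<^bsub>A\<^esub> x \<in> carrier A" using A.smult_closed[of c x] by simp
private lemma smB [simp]: "x \<in> carrier B \<Longrightarrow> c \<odot>\<^bsub>B\<^esub> x \<in> carrier B" using B.smult_closed[of c x] by simp

lemma monoid_AB: "Group.monoid AB"
  by (intro DirProd_monoid A.monoid_axioms B.monoid_axioms)

interpretation MA: k_algebra MAB by (rule k_algebra_monoid_algebra[OF monoid_AB])

private lemma rel_memI:
  "\<lbrakk>x \<in> carrier A; x' \<in> carrier A; y \<in> carrier B\<rbrakk> \<Longrightarrow> single (x \<oplus>\<^bsub>A\<^esub> x', y) 1 - single (x, y) 1
        - single (x', y) 1 \<in> bilinear_relations A B"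
  "\<lbrakk>x \<in> carrier A; y \<in> carrier B; y' \<in> carrier B\<rbrakk> \<Longrightarrow> single (x, y \<oplus>\<^bsub>B\<^esub> y') 1 - single (x, y) 1
        - single (x, y') 1 \<in> bilinear_relations A B"
  "\<lbrakk>x \<in> carrier A; y \<in> carrier B\<rbrakk> \<Longrightarrow> single (c \<odot>\<^bsub>A\<^esub> x, y) 1 - single (x, y) c \<in> bilinear_relations A B"
  "\<lbrakk>x \<in> carrier A; y \<in> carrier B\<rbrakk> \<Longrightarrow> single (x, c \<odot>\<^bsub>B\<^esub> y) 1 - single (x, y) c \<in> bilinear_relations A B"
  unfolding bilinear_relations_def by blast+

private lemma keys_diff_subset: "\<lbrakk>keys u \<subseteq> S; keys v \<subseteq> S\<rbrakk> \<Longrightarrow> keys (u - v) \<subseteq> S"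
  for u v :: "'c \<Rightarrow>\<^sub>0 'k" using keys_diff[of u v] by blast

private lemma rel_carrier: "bilinear_relations A B \<subseteq> carrier MAB"
proof (rule subsetI)
  show "r \<in> carrier MAB" if r: "r \<in> bilinear_relations A B" for r
    using r[unfolded bilinear_relations_def] by (elim UnE CollectE exE conjE; simp add: keys_diff_subset)
qed

private lemma N_sub: "submodule N scalars MAB"
  unfolding tensor_null_def by (rule lin_span_submodule[OF MA.module_axioms rel_carrier])

private lemma rel_N: "r \<in> bilinear_relations A B \<Longrightarrow> r \<in> N"
  unfolding tensor_null_def by (rule subsetD[OF lin_span_superset])

text \<open>Multiplication by the basis element \<open>(p, q)\<close> multiplies the entries of each
  pair by \<open>p\<close> and \<open>q\<close>; distributivity and compatibility with scalars then
  preserve the shape of each of the four families of relations.\<close>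

private lemma rel_mult:
  assumes r: "r \<in> bilinear_relations A B" and p: "p \<in> carrier A" and q: "q \<in> carrier B"
  shows "single (p, q) 1 \<otimes>\<^bsub>MAB\<^esub> r \<in> bilinear_relations A B"
    and "r \<otimes>\<^bsub>MAB\<^esub> single (p, q) 1 \<in> bilinear_relations A B"
  using r[unfolded bilinear_relations_def]
  by (elim UnE CollectE exE conjE; simp add: monoid_algebra_mult_diff monoid_algebra_mult p q A.r_distr A.l_distr
      B.r_distr B.l_distr A.smult_mult_left A.smult_mult_right B.smult_mult_left B.smult_mult_right rel_memI)+

lemma tensor_null_ideal: "ideal N MAB"
proof (rule idealI)
  show "ring MAB" by (rule MA.ring_axioms)
  show "subgroup N (add_monoid MAB)" using N_sub by (rule submodule.axioms)
  note N = submoduleD[OF N_sub]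
  have Nc: "u \<in> N \<Longrightarrow> u \<in> carrier MAB" for u by (rule subsetD[OF N(1)])
  have rel: "r \<otimes>\<^bsub>MAB\<^esub> u \<in> N \<and> u \<otimes>\<^bsub>MAB\<^esub> r \<in> N"
    if u: "u \<in> bilinear_relations A B" and r: "r \<in> carrier MAB" for r u
  proof -
    have "keys r \<subseteq> carrier AB" using r by simp
    then show ?thesis
    proof (induction rule: poly_mapping_on_induct)
      case zero
      show ?case using N(2) by (simp add: monoid_algebra_mult)
    next
      case (add r s)
      then show ?case using N(3) by (simp add: monoid_algebra_mult)
    next
      case (single a c)
      obtain p q where a: "a = (p, q)" "p \<in> carrier A" "q \<in> carrier B" using single by (cases a) auto
      let ?s = "single (p, q) (1 :: 'k)"
      have s: "single a c = c \<odot>\<^bsub>MAB\<^esub> ?s" "?s \<in> carrier MAB" using a by auto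
      have uc: "u \<in> carrier MAB" by (rule subsetD[OF rel_carrier u])
      show ?case unfolding s(1) MA.smult_mult_left[OF s(2) uc] MA.smult_mult_right[OF uc s(2)]
        by (intro conjI N(4) rel_N rel_mult[OF u a(2,3)])
    qed
  qed
  \<comment> \<open>The elements of \<open>N\<close> all of whose multiples stay in \<open>N\<close>
    form a subspace that contains the relations, hence also their span \<open>N\<close>.\<close>
  have "N \<subseteq> {u \<in> N. \<forall>r\<in>carrier MAB. r \<otimes>\<^bsub>MAB\<^esub> u \<in> N \<and> u \<otimes>\<^bsub>MAB\<^esub> r \<in> N}" (is "_ \<subseteq> ?M")
    unfolding tensor_null_def[of A B]
  proof (rule lin_span_minimal, fold tensor_null_def)
    show "bilinear_relations A B \<subseteq> ?M"
      by (auto simp del: monoid_algebra_simps intro: rel_N rel[THEN conjunct1] rel[THEN conjunct2])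
    show "submodule ?M scalars MAB"
    proof (rule MA.submodule_scaleI)
      show "?M \<subseteq> carrier MAB" by (auto simp del: monoid_algebra_simps intro: Nc)
      show "\<zero>\<^bsub>MAB\<^esub> \<in> ?M" using N(2) by (simp add: monoid_algebra_mult)
      show "x \<oplus>\<^bsub>MAB\<^esub> y \<in> ?M" if "x \<in> ?M" "y \<in> ?M" for x y
        using that Nc N(3) by (auto simp: monoid_algebra_mult)
      show "c \<odot>\<^bsub>MAB\<^esub> x \<in> ?M" if "x \<in> ?M" for c x
        using that Nc[of x] N(4) MA.smult_mult_left[of x] MA.smult_mult_right[of _ x]
        by (auto simp del: monoid_algebra_simps)
    qed
  qed
  then show "x \<otimes>\<^bsub>MAB\<^esub> a \<in> N" "a \<otimes>\<^bsub>MAB\<^esub> x \<in> N" if "a \<in> N" "x \<in> carrier MAB" for a x using that by blast+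
qed

lemma k_algebra_tensor: "k_algebra (tensor A B)"
  unfolding tensor_def by (rule k_algebra_quot[OF MA.k_algebra_axioms tensor_null_ideal])

interpretation T: k_algebra "tensor A B" by (rule k_algebra_tensor)

private lemma smT [simp]: "x \<in> carrier (tensor A B) \<Longrightarrow> c \<odot>\<^bsub>tensor A B\<^esub> x \<in> carrier (tensor A B)"
  using T.smult_closed[of c x] by simp

lemma tensor_carrierE:
  assumes "t \<in> carrier (tensor A B)"
  obtains u where "keys u \<subseteq> carrier A \<times> carrier B" "t = tensor_class A B u"
  using assms by (auto simp: tensor_def quot_alg_simps tensor_class_def)

lemma tensor_class:
  assumes "keys u \<subseteq> carrier A \<times> carrier B"
  shows "tensor_class A B u \<in> carrier (tensor A B)"
    and "keys v \<subseteq> carrier A \<times> carrier B \<Longrightarrow>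
      tensor_class A B u \<oplus>\<^bsub>tensor A B\<^esub> tensor_class A B v = tensor_class A B (u + v)"
    and "c \<odot>\<^bsub>tensor A B\<^esub> tensor_class A B u = tensor_class A B (Poly_Mapping.map ((*) c) u)"
    and "keys v \<subseteq> carrier A \<times> carrier B \<Longrightarrow> u - v \<in> N \<Longrightarrow> tensor_class A B u = tensor_class A B v"
  unfolding tensor_class_def tensor_def
  using assms quot_add[OF MA.k_algebra_axioms tensor_null_ideal, of u v]
    quot_smult[OF MA.k_algebra_axioms tensor_null_ideal, of u]
    quot_eq_iff[OF MA.k_algebra_axioms tensor_null_ideal, of u v] monoid_algebra_minus[OF monoid_AB, of u v]
  by (auto simp: quot_alg_simps(1))

lemma tensor_class_single:
  assumes "x \<in> carrier A" "y \<in> carrier B"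
  shows "tensor_class A B (single (x, y) c) = pure A B (c \<odot>\<^bsub>A\<^esub> x) y"
    and "tensor_class A B (single (x, y) c) = pure A B x (c \<odot>\<^bsub>B\<^esub> y)"
  unfolding pure_def tensor_class_def[symmetric]
  by (rule tensor_class(4)[symmetric]; use assms in \<open>auto intro: rel_N rel_memI\<close>)+

lemma pure_closed: "\<lbrakk>x \<in> carrier A; y \<in> carrier B\<rbrakk> \<Longrightarrow> pure A B x y \<in> carrier (tensor A B)"
  unfolding pure_def tensor_class_def[symmetric] by (rule tensor_class) simp

lemma pure_bilinear: "bilinear A B (tensor A B) (pure A B)"
proof (intro bilinearI lin_mapI)
  have *: "tensor_class A B u = tensor_class A B v \<oplus>\<^bsub>tensor A B\<^esub> tensor_class A B w"
    if "keys u \<subseteq> carrier A \<times> carrier B" "keys v \<subseteq> carrier A \<times> carrier B"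
      "keys w \<subseteq> carrier A \<times> carrier B" "u - v - w \<in> N" for u v w
    using that by (simp add: tensor_class keys_add_subset diff_diff_eq)
  fix x y assume x: "x \<in> carrier A" and y: "y \<in> carrier B"
  show "pure A B x y \<in> carrier (tensor A B)" "pure A B x y \<in> carrier (tensor A B)"
    using x y by (simp_all add: pure_closed)
  show "pure A B (x \<oplus>\<^bsub>A\<^esub> x') y = pure A B x y \<oplus>\<^bsub>tensor A B\<^esub> pure A B x' y" if "x' \<in> carrier A" for x'
    unfolding pure_def tensor_class_def[symmetric]
    using x y that by (intro * rel_N rel_memI) auto
  show "pure A B x (y \<oplus>\<^bsub>B\<^esub> y') = pure A B x y \<oplus>\<^bsub>tensor A B\<^esub> pure A B x y'" if "y' \<in> carrier B" for y'
    unfolding pure_def tensor_class_def[symmetric]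
    using x y that by (intro * rel_N rel_memI) auto
  show "pure A B (c \<odot>\<^bsub>A\<^esub> x) y = c \<odot>\<^bsub>tensor A B\<^esub> pure A B x y" for c
    using x y by (simp add: tensor_class_single(1)[symmetric]) (simp add: pure_def tensor_class_def[symmetric] tensor_class)
  show "pure A B x (c \<odot>\<^bsub>B\<^esub> y) = c \<odot>\<^bsub>tensor A B\<^esub> pure A B x y" for c
    using x y by (simp add: tensor_class_single(2)[symmetric]) (simp add: pure_def tensor_class_def[symmetric] tensor_class)
qed

text \<open>Sums of pure tensors exhaust the tensor product because a coefficient can be moved into
  the left factor; this is why there is no case for scalar multiples.\<close>

lemma tensor_induct [consumes 1, case_names zero add pure]:
  assumes "t \<in> carrier (tensor A B)" and "P \<zero>\<^bsub>tensor A B\<^esub>"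
    and add: "\<And>s t. \<lbrakk>s \<in> carrier (tensor A B); t \<in> carrier (tensor A B); P s; P t\<rbrakk> \<Longrightarrow> P (s \<oplus>\<^bsub>tensor A B\<^esub> t)"
    and pure: "\<And>x y. \<lbrakk>x \<in> carrier A; y \<in> carrier B\<rbrakk> \<Longrightarrow> P (pure A B x y)"
  shows "P t"
proof -
  obtain u where u: "keys u \<subseteq> carrier A \<times> carrier B" "t = tensor_class A B u"
    using assms(1) by (rule tensor_carrierE)
  show ?thesis unfolding u(2) using u(1)
  proof (induction rule: poly_mapping_on_induct)
    case zero
    have "tensor_class A B 0 = 0 \<odot>\<^bsub>tensor A B\<^esub> tensor_class A B 0" by (simp add: tensor_class)
    also have "\<dots> = \<zero>\<^bsub>tensor A B\<^esub>" using T.smult_l_null[of "tensor_class A B 0"] by (simp add: tensor_class)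
    finally show ?case using assms(2) by simp
  next
    case (add u v)
    then show ?case using assms(3) by (simp add: tensor_class(1) tensor_class(2)[symmetric])
  next
    case (single a c)
    then show ?case using pure by (cases a) (simp add: tensor_class_single(1))
  qed
qed

context
  fixes V :: "('k, 'v, 'l) module_scheme" and b :: "'a \<Rightarrow> 'b \<Rightarrow> 'v"
  assumes V: "module scalars V" and b: "bilinear A B V b"
begin

interpretation V: module scalars V by (rule V)

private lemma bc: "p \<in> carrier AB \<Longrightarrow> (case p of (x, y) \<Rightarrow> b x y) \<in> carrier V"
  using bilinearD(1)[OF b] by auto

private lemma smV [simp]: "x \<in> carrier V \<Longrightarrow> c \<odot>\<^bsub>V\<^esub> x \<in> carrier V" using V.smult_closed[of c x] by simp

text \<open>The elements killed by the linear extension form a subspace, so only the four families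
  of relations have to be tested.\<close>

private lemma kill: "u \<in> N \<Longrightarrow> lin_ext V (\<lambda>(x, y). b x y) u = \<zero>\<^bsub>V\<^esub>"
proof -
  let ?L = "lin_ext V (\<lambda>(x, y). b x y)"
  have add: "?L (u + v) = ?L u \<oplus>\<^bsub>V\<^esub> ?L v"
    if "keys u \<subseteq> carrier AB" "keys v \<subseteq> carrier AB" for u v
    using that bc by (intro lin_ext_add[OF V]) auto
  have minus: "(- c) \<odot>\<^bsub>V\<^esub> z = \<ominus>\<^bsub>V\<^esub> (c \<odot>\<^bsub>V\<^esub> z)" if "z \<in> carrier V" for c z
    using that V.smult_l_distr[of "-c" c z] V.smult_l_null[of z] by (intro V.minus_equality[symmetric]) simp_all
  have one: "1 \<odot>\<^bsub>V\<^esub> z = z" if "z \<in> carrier V" for z using that V.smult_one by simp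
  have single: "?L (single (x, y) c) = c \<odot>\<^bsub>V\<^esub> b x y" if "x \<in> carrier A" "y \<in> carrier B" for x y c
    using that bc[of "(x, y)"] by (subst lin_ext_single[OF V]) auto
  have "N \<subseteq> {u \<in> carrier MAB. ?L u = \<zero>\<^bsub>V\<^esub>}" (is "_ \<subseteq> ?M")
    unfolding tensor_null_def
  proof (rule lin_span_minimal)
    show "bilinear_relations A B \<subseteq> ?M"
    proof (rule subsetI, intro CollectI conjI)
      fix r assume r: "r \<in> bilinear_relations A B"
      then show "r \<in> carrier MAB" using rel_carrier by blast
      \<comment> \<open>Each relation is turned into a sum of basis elements with signed
        coefficients, the form to which additivity of the linear extension applies.\<close>
      note d = diff_conv_add_uminus single_uminus[symmetric] 
      have cancel: "(p \<oplus>\<^bsub>V\<^esub> q) \<oplus>\<^bsub>V\<^esub> \<ominus>\<^bsub>V\<^esub> p \<oplus>\<^bsub>V\<^esub> \<ominus>\<^bsub>V\<^esub> q = \<zero>\<^bsub>V\<^esub>" if "p \<in> carrier V" "q \<in> carrier V" for p q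
        using that by (metis V.M.a_ac(1) V.M.a_closed V.M.a_comm V.M.a_inv_closed V.M.r_neg V.M.r_zero)
      show "?L r = \<zero>\<^bsub>V\<^esub>" using r unfolding bilinear_relations_def
        by (elim UnE CollectE exE conjE; simp only: d)
          (simp_all add: add single keys_add_subset minus one bilinearD[OF b] cancel V.r_neg)
    qed
    show "submodule ?M scalars MAB"
    proof (rule MA.submodule_scaleI)
      show "c \<odot>\<^bsub>MAB\<^esub> x \<in> ?M" if "x \<in> ?M" for c x
      proof -
        have "?L (Poly_Mapping.map ((*) c) x) = c \<odot>\<^bsub>V\<^esub> ?L x" using that bc by (intro lin_ext_smult[OF V]) auto
        then show ?thesis using that MA.smult_closed[of c x] V.smult_r_null[of c] by simp
      qed
    qed (auto simp: lin_ext_zero[OF V] add keys_add_subset)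
  qed
  then show "u \<in> N \<Longrightarrow> ?L u = \<zero>\<^bsub>V\<^esub>" by blast
qed

private lemmas lift_facts = quot_lift_coset[OF monoid_AB tensor_null_ideal V bc kill] quot_lift_lin_map[OF monoid_AB tensor_null_ideal V bc kill]

lemma tensor_lift_lin_map: "tensor_lift V b \<in> lin_map (tensor A B) V"
  unfolding tensor_def tensor_lift_def[abs_def] by (rule lift_facts(2))

lemma tensor_lift_alg_hom:
  assumes B': "k_algebra V" and one: "b \<one>\<^bsub>A\<^esub> \<one>\<^bsub>B\<^esub> = \<one>\<^bsub>V\<^esub>"
    and m: "\<And>x y x' y'. \<lbrakk>x \<in> carrier A; y \<in> carrier B; x' \<in> carrier A; y' \<in> carrier B\<rbrakk> \<Longrightarrow>
      b (x \<otimes>\<^bsub>A\<^esub> x') (y \<otimes>\<^bsub>B\<^esub> y') = b x y \<otimes>\<^bsub>V\<^esub> b x' y'"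
  shows "tensor_lift V b \<in> alg_hom (tensor A B) V"
  unfolding tensor_def tensor_lift_def[abs_def]
  by (rule quot_lift_alg_hom[OF monoid_AB tensor_null_ideal V bc kill B']) (auto simp: one m)

lemma tensor_lift_pure:
  assumes "x \<in> carrier A" "y \<in> carrier B"
  shows "tensor_lift V b (pure A B x y) = b x y"
  unfolding pure_def tensor_lift_def
  using assms bilinearD(1)[OF b assms] V.smult_one[of "b x y"]
  by (subst lift_facts(1)) (simp_all add: lin_ext_single[OF V])

text \<open>Both lifts are computed from the same chosen representative of \<open>t\<close>, so the
  identity is one between linear extensions at that representative. It turns evaluations of lifted
  tensors into evaluations of \<open>t\<close> itself.\<close>

lemma tensor_lift_comp:
  assumes W: "module scalars W" and g: "g \<in> lin_map V W" and t: "t \<in> carrier (tensor A B)"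
    and h: "\<And>x y. \<lbrakk>x \<in> carrier A; y \<in> carrier B\<rbrakk> \<Longrightarrow> g (b x y) = h x y"
  shows "g (tensor_lift V b t) = tensor_lift W h t"
proof -
  obtain u where u: "keys u \<subseteq> carrier A \<times> carrier B" "t = tensor_class A B u"
    using t by (rule tensor_carrierE)
  obtain i where i: "i \<in> N" "(SOME v. v \<in> t) = i + u"
    using quot_some[OF MA.k_algebra_axioms tensor_null_ideal, of u] u unfolding u tensor_class_def by auto
  have ic: "keys i \<subseteq> carrier A \<times> carrier B" using subsetD[OF submoduleD(1)[OF N_sub] i(1)] by simp
  have k: "keys (i + u) \<subseteq> carrier A \<times> carrier B" using keys_add_subset[OF ic u(1)] .
  have "g (lin_ext V (\<lambda>(x, y). b x y) (i + u)) = lin_ext W (\<lambda>p. g (case p of (x, y) \<Rightarrow> b x y)) (i + u)"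
    using k bc by (intro lin_map_lin_ext[OF V W g]) auto
  also have "\<dots> = lin_ext W (\<lambda>(x, y). h x y) (i + u)"
  proof (intro lin_ext_cong[OF W, symmetric])
    fix p assume "p \<in> keys (i + u)"
    with k obtain x y where p: "p = (x, y)" "x \<in> carrier A" "y \<in> carrier B" by auto
    then show "g (case p of (x, y) \<Rightarrow> b x y) \<in> carrier W" using lin_mapD(1)[OF g bc, of p] by simp
    show "(case p of (x, y) \<Rightarrow> h x y) = g (case p of (x, y) \<Rightarrow> b x y)" using p h by simp
  qed
  finally show ?thesis by (simp add: tensor_lift_def i(2))
qed

end

end

section \<open>Separating functionals\<close>

text \<open>The functionals indexed by \<open>d\<close> separate the points of \<open>A\<close>;
  stated as injectivity of \<alpha>, this makes \<open>A\<close> a space of functions on the index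
  type.\<close>

definition linear_embedding :: "('k::field, 'a, 'm) module_scheme \<Rightarrow> ('a \<Rightarrow> 'd \<Rightarrow> 'k) \<Rightarrow> bool" where
  "linear_embedding A \<alpha> \<longleftrightarrow> inj_on \<alpha> (carrier A) \<and> (\<forall>d. (\<lambda>x. \<alpha> x d) \<in> lin_map A scalars)"

lemma linear_embeddingD:
  assumes "linear_embedding A \<alpha>"
  shows "(\<lambda>x. \<alpha> x d) \<in> lin_map A scalars"
    and "\<lbrakk>x \<in> carrier A; y \<in> carrier A; \<And>d. \<alpha> x d = \<alpha> y d\<rbrakk> \<Longrightarrow> x = y"
    and "\<lbrakk>x \<in> carrier A; y \<in> carrier A\<rbrakk> \<Longrightarrow> \<alpha> (x \<oplus>\<^bsub>A\<^esub> y) d = \<alpha> x d + \<alpha> y d"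
    and "x \<in> carrier A \<Longrightarrow> \<alpha> (c \<odot>\<^bsub>A\<^esub> x) d = c * \<alpha> x d"
proof -
  show "x = y" if "x \<in> carrier A" "y \<in> carrier A" "\<And>d. \<alpha> x d = \<alpha> y d"
    using assms that by (intro inj_onD[of \<alpha> "carrier A"]) (auto simp: linear_embedding_def)
qed (use assms in \<open>auto simp: linear_embedding_def lin_map_def\<close>)

text \<open>Lists instead of sets of pairs: a summand may occur twice, and the length is the
  induction measure when a vanishing sum is shortened.\<close>

primrec tensor_sum ::
  "('k::field, 'a, 'm) module_scheme \<Rightarrow> ('k, 'b, 'n) module_scheme \<Rightarrow> ('a \<times> 'b) list \<Rightarrow> ('k, 'a, 'b) tens" where
  "tensor_sum A B [] = \<zero>\<^bsub>tensor A B\<^esub>"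
| "tensor_sum A B (z # zs) = pure A B (fst z) (snd z) \<oplus>\<^bsub>tensor A B\<^esub> tensor_sum A B zs"

definition tensor_eval ::
  "('a \<Rightarrow> 'd \<Rightarrow> 'k::field) \<Rightarrow> ('b \<Rightarrow> 'e \<Rightarrow> 'k) \<Rightarrow> ('k, 'a, 'b) tens \<Rightarrow> 'd \<times> 'e \<Rightarrow> 'k" where
  "tensor_eval \<alpha> \<beta> t = (\<lambda>(d, e). tensor_lift scalars (\<lambda>x y. \<alpha> x d * \<beta> y e) t)"

context
  fixes A :: "('k::field, 'a, 'm) module_scheme" and B :: "('k, 'b, 'n) module_scheme"
  assumes A: "k_algebra A" and B: "k_algebra B"
begin

interpretation A: k_algebra A by (rule A)
interpretation B: k_algebra B by (rule B)
interpretation T: k_algebra "tensor A B" by (rule k_algebra_tensor[OF A B])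

private lemma smult_carrier [simp]:
  "x \<in> carrier A \<Longrightarrow> c \<odot>\<^bsub>A\<^esub> x \<in> carrier A"
  "y \<in> carrier B \<Longrightarrow> c \<odot>\<^bsub>B\<^esub> y \<in> carrier B"
  "t \<in> carrier (tensor A B) \<Longrightarrow> c \<odot>\<^bsub>tensor A B\<^esub> t \<in> carrier (tensor A B)"
  using A.smult_closed[of c x] B.smult_closed[of c y] T.smult_closed[of c t] by simp_all

private lemmas pure = bilinearD[OF pure_bilinear[OF A B]]

lemma tensor_sum_closed: "set zs \<subseteq> carrier A \<times> carrier B \<Longrightarrow> tensor_sum A B zs \<in> carrier (tensor A B)"
  by (induction zs) (auto simp: pure(1))

lemma tensor_sum_append:
  "\<lbrakk>set zs \<subseteq> carrier A \<times> carrier B; set ws \<subseteq> carrier A \<times> carrier B\<rbrakk> \<Longrightarrow>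
    tensor_sum A B (zs @ ws) = tensor_sum A B zs \<oplus>\<^bsub>tensor A B\<^esub> tensor_sum A B ws"
  by (induction zs) (auto simp: pure(1) tensor_sum_closed T.M.a_assoc)

lemma tensor_sum_exhaust:
  assumes "t \<in> carrier (tensor A B)"
  obtains zs where "set zs \<subseteq> carrier A \<times> carrier B" "t = tensor_sum A B zs"
proof -
  have "\<exists>zs. set zs \<subseteq> carrier A \<times> carrier B \<and> t = tensor_sum A B zs"
    using assms
  proof (induction rule: tensor_induct[OF A B, consumes 1, case_names zero add pure])
    case zero
    show ?case by (intro exI[of _ "[]"]) simp
  next
    case (add s t)
    then obtain zs ws where "set zs \<subseteq> carrier A \<times> carrier B" "s = tensor_sum A B zs"
      "set ws \<subseteq> carrier A \<times> carrier B" "t = tensor_sum A B ws" by auto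
    then show ?case by (intro exI[of _ "zs @ ws"]) (simp add: tensor_sum_append)
  next
    case (pure x y)
    then show ?case by (intro exI[of _ "[(x, y)]"]) (simp add: pure_closed[OF A B])
  qed
  then show ?thesis using that by blast
qed

text \<open>Expand the pure tensors of x + f(x) x0 with y and collect the terms with left factor
  \<open>x0\<close>; their coefficients move into the right factor. Read backwards, a summand with
  left factor \<open>x0\<close>, whose right factor is the combination of the y with coefficients
  f(x), is absorbed into the others.\<close>

private lemma tensor_sum_shift:
  assumes x0: "x0 \<in> carrier A" and zs: "set zs \<subseteq> carrier A \<times> carrier B"
  shows "foldr (\<lambda>(x, y) s. f x \<odot>\<^bsub>B\<^esub> y \<oplus>\<^bsub>B\<^esub> s) zs \<zero>\<^bsub>B\<^esub> \<in> carrier B"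
    and "tensor_sum A B (map (\<lambda>(x, y). (x \<oplus>\<^bsub>A\<^esub> f x \<odot>\<^bsub>A\<^esub> x0, y)) zs)
      = pure A B x0 (foldr (\<lambda>(x, y) s. f x \<odot>\<^bsub>B\<^esub> y \<oplus>\<^bsub>B\<^esub> s) zs \<zero>\<^bsub>B\<^esub>) \<oplus>\<^bsub>tensor A B\<^esub> tensor_sum A B zs"
proof -
  have cl: "foldr (\<lambda>(x, y) s. f x \<odot>\<^bsub>B\<^esub> y \<oplus>\<^bsub>B\<^esub> s) zs \<zero>\<^bsub>B\<^esub> \<in> carrier B"
    if "set zs \<subseteq> carrier A \<times> carrier B" for zs
    using that by (induction zs) auto
  show "foldr (\<lambda>(x, y) s. f x \<odot>\<^bsub>B\<^esub> y \<oplus>\<^bsub>B\<^esub> s) zs \<zero>\<^bsub>B\<^esub> \<in> carrier B" by (rule cl[OF zs])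
  have pz: "pure A B x0 \<zero>\<^bsub>B\<^esub> = \<zero>\<^bsub>tensor A B\<^esub>"
    using x0 by (intro lin_map_zero[OF B.module_axioms T.module_axioms])
      (use pure_bilinear[OF A B] in \<open>auto simp: bilinear_def\<close>)
  have comm: "(p \<oplus>\<^bsub>tensor A B\<^esub> q) \<oplus>\<^bsub>tensor A B\<^esub> (r \<oplus>\<^bsub>tensor A B\<^esub> s) = (q \<oplus>\<^bsub>tensor A B\<^esub> r) \<oplus>\<^bsub>tensor A B\<^esub> (p \<oplus>\<^bsub>tensor A B\<^esub> s)"
    if "p \<in> carrier (tensor A B)" "q \<in> carrier (tensor A B)" "r \<in> carrier (tensor A B)" "s \<in> carrier (tensor A B)" for p q r s
    using that by (simp add: T.M.a_ac)
  show "tensor_sum A B (map (\<lambda>(x, y). (x \<oplus>\<^bsub>A\<^esub> f x \<odot>\<^bsub>A\<^esub> x0, y)) zs)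
      = pure A B x0 (foldr (\<lambda>(x, y) s. f x \<odot>\<^bsub>B\<^esub> y \<oplus>\<^bsub>B\<^esub> s) zs \<zero>\<^bsub>B\<^esub>) \<oplus>\<^bsub>tensor A B\<^esub> tensor_sum A B zs"
    using zs
  proof (induction zs)
    case (Cons z zs)
    obtain x y where z: "z = (x, y)" "x \<in> carrier A" "y \<in> carrier B" using Cons.prems by (cases z) auto
    have *: "pure A B (f x \<odot>\<^bsub>A\<^esub> x0) y = pure A B x0 (f x \<odot>\<^bsub>B\<^esub> y)" using z x0 by (simp add: pure)
    show ?case using Cons z x0
      by (simp add: pure(1,2,3) * cl[simplified] tensor_sum_closed comm)
  qed (simp add: pz)
qed

context
  fixes \<alpha> :: "'a \<Rightarrow> 'd \<Rightarrow> 'k" and \<beta> :: "'b \<Rightarrow> 'e \<Rightarrow> 'k"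
  assumes \<alpha>: "\<And>d. (\<lambda>x. \<alpha> x d) \<in> lin_map A scalars" and \<beta>: "\<And>e. (\<lambda>y. \<beta> y e) \<in> lin_map B scalars"
begin

private lemma bil: "bilinear A B scalars (\<lambda>x y. \<alpha> x d * \<beta> y e)"
  using \<alpha> \<beta> by (rule bilinear_scalars)

lemma tensor_eval_lin_map: "(\<lambda>t. tensor_eval \<alpha> \<beta> t p) \<in> lin_map (tensor A B) scalars"
  using tensor_lift_lin_map[OF A B module_scalars bil] by (cases p) (simp add: tensor_eval_def)

lemma tensor_eval_pure:
  "\<lbrakk>x \<in> carrier A; y \<in> carrier B\<rbrakk> \<Longrightarrow> tensor_eval \<alpha> \<beta> (pure A B x y) (d, e) = \<alpha> x d * \<beta> y e"
  using tensor_lift_pure[OF A B module_scalars bil] by (simp add: tensor_eval_def)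

lemma tensor_eval_sum:
  "set zs \<subseteq> carrier A \<times> carrier B \<Longrightarrow>
    tensor_eval \<alpha> \<beta> (tensor_sum A B zs) (d, e) = (\<Sum>(x, y)\<leftarrow>zs. \<alpha> x d * \<beta> y e)"
proof (induction zs)
  case Nil
  show ?case using lin_map_zero[OF T.module_axioms module_scalars tensor_eval_lin_map] by simp
next
  case (Cons z zs)
  then show ?case
    using lin_mapD(2)[OF tensor_eval_lin_map, of "pure A B (fst z) (snd z)" "tensor_sum A B zs"]
    by (auto simp: pure(1) tensor_sum_closed tensor_eval_pure split_beta)
qed

lemma tensor_eval_alg_hom:
  assumes "\<And>d. (\<lambda>x. \<alpha> x d) \<in> alg_hom A scalars" "\<And>e. (\<lambda>y. \<beta> y e) \<in> alg_hom B scalars"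
  shows "(\<lambda>t. tensor_eval \<alpha> \<beta> t p) \<in> alg_hom (tensor A B) scalars"
proof -
  obtain d e where p: "p = (d, e)" by (cases p)
  have "tensor_lift scalars (\<lambda>x y. \<alpha> x d * \<beta> y e) \<in> alg_hom (tensor A B) scalars"
    by (rule tensor_lift_alg_hom[OF A B module_scalars bil k_algebra_scalars])
      (use alg_homD(2,3)[OF assms(1)] alg_homD(2,3)[OF assms(2)] in auto)
  then show ?thesis by (simp add: tensor_eval_def p)
qed

end

context
  fixes \<alpha> :: "'a \<Rightarrow> 'd \<Rightarrow> 'k" and \<beta> :: "'b \<Rightarrow> 'e \<Rightarrow> 'k"
  assumes \<alpha>: "linear_embedding A \<alpha>" and \<beta>: "linear_embedding B \<beta>"
begin

private lemmas eval_lin = tensor_eval_lin_map[where \<alpha> = \<alpha> and \<beta> = \<beta>, OF linear_embeddingD(1)[OF \<alpha>] linear_embeddingD(1)[OF \<beta>]]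
private lemmas eval_sum = tensor_eval_sum[where \<alpha> = \<alpha> and \<beta> = \<beta>, OF linear_embeddingD(1)[OF \<alpha>] linear_embeddingD(1)[OF \<beta>]]

text \<open>
  A vanishing sum of tensors is shortened: if \<open>\<alpha> x0 d0 \<noteq> 0\<close>, then \<open>y0\<close> is a combination of the
  other right-hand factors and can be absorbed into the remaining summands.
\<close>

private lemma tensor_sum_separated:
  assumes "set zs \<subseteq> carrier A \<times> carrier B" "\<And>d e. (\<Sum>(x, y)\<leftarrow>zs. \<alpha> x d * \<beta> y e) = 0"
  shows "tensor_sum A B zs = \<zero>\<^bsub>tensor A B\<^esub>"
  using assms
proof (induction "length zs" arbitrary: zs)
  case (Suc n)
  then obtain x0 y0 ws where zs: "zs = (x0, y0) # ws" by (cases zs) auto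
  have x0: "x0 \<in> carrier A" and y0: "y0 \<in> carrier B" and ws: "set ws \<subseteq> carrier A \<times> carrier B"
    using Suc(3) zs by auto
  have sum0: "\<alpha> x0 d * \<beta> y0 e + (\<Sum>(x, y)\<leftarrow>ws. \<alpha> x d * \<beta> y e) = 0" for d e
    using Suc(4)[of d e] zs by simp
  show ?case
  proof (cases "\<forall>d. \<alpha> x0 d = 0")
    case True
    have "\<alpha> (0 \<odot>\<^bsub>A\<^esub> x0) d = 0" for d using linear_embeddingD(4)[OF \<alpha> x0] by simp
    then have "x0 = 0 \<odot>\<^bsub>A\<^esub> x0" using True x0 by (intro linear_embeddingD(2)[OF \<alpha>]) auto
    then have "pure A B x0 y0 = 0 \<odot>\<^bsub>tensor A B\<^esub> pure A B x0 y0" using pure(4)[OF x0 y0, of 0] by simp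
    then have "pure A B x0 y0 = \<zero>\<^bsub>tensor A B\<^esub>" using T.smult_l_null[of "pure A B x0 y0"] pure(1)[OF x0 y0] by simp
    moreover have "tensor_sum A B ws = \<zero>\<^bsub>tensor A B\<^esub>" using Suc(2) zs ws sum0 True by (intro Suc(1)) auto
    ultimately show ?thesis using zs by simp
  next
    case False
    then obtain d0 where d0: "\<alpha> x0 d0 \<noteq> 0" by auto
    \<comment> \<open>Taking \<open>d0\<close> for \<open>d\<close> in the vanishing sum and solving
      for \<open>y0\<close> gives these coefficients.\<close>
    define f where "f x = - (\<alpha> x d0 / \<alpha> x0 d0)" for x
    let ?y = "foldr (\<lambda>(x, y) s. f x \<odot>\<^bsub>B\<^esub> y \<oplus>\<^bsub>B\<^esub> s) ws \<zero>\<^bsub>B\<^esub>"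
    let ?vs = "map (\<lambda>(x, y). (x \<oplus>\<^bsub>A\<^esub> f x \<odot>\<^bsub>A\<^esub> x0, y)) ws"
    have "\<beta> ?y e = (\<Sum>(x, y)\<leftarrow>ws. f x * \<beta> y e)" for e
      using ws
    proof (induction ws)
      case Nil
      show ?case using lin_map_zero[OF B.module_axioms module_scalars linear_embeddingD(1)[OF \<beta>]] by simp
    next
      case (Cons w ws)
      then show ?case using tensor_sum_shift(1)[OF x0, of ws f]
        by (auto simp: linear_embeddingD(3,4)[OF \<beta>])
    qed
    also have "(\<Sum>(x, y)\<leftarrow>ws. f x * \<beta> y e) = - ((\<Sum>(x, y)\<leftarrow>ws. \<alpha> x d0 * \<beta> y e) / \<alpha> x0 d0)" for e
      by (induction ws) (auto simp: f_def field_simps d0)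
    also have "\<dots> e = \<beta> y0 e" for e
      using sum0[of d0 e] d0 by (simp add: field_simps add_eq_0_iff)
    finally have "?y = y0"
      using tensor_sum_shift(1)[OF x0 ws] y0 by (intro linear_embeddingD(2)[OF \<beta>]) auto
    then have "tensor_sum A B zs = tensor_sum A B ?vs"
      using tensor_sum_shift(2)[OF x0 ws, of f] zs by simp
    moreover have "tensor_sum A B ?vs = \<zero>\<^bsub>tensor A B\<^esub>"
    proof (rule Suc(1))
      show "n = length ?vs" using Suc(2) zs by simp
      show "set ?vs \<subseteq> carrier A \<times> carrier B" using ws x0 by auto
      fix d e
      have "(\<Sum>(x, y)\<leftarrow>?vs. \<alpha> x d * \<beta> y e) = (\<Sum>(x, y)\<leftarrow>ws. \<alpha> x d * \<beta> y e) - \<alpha> x0 d / \<alpha> x0 d0 * (\<Sum>(x, y)\<leftarrow>ws. \<alpha> x d0 * \<beta> y e)"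
        using ws
      proof (induction ws)
        case (Cons w ws)
        then show ?case using x0 d0 by (auto simp: linear_embeddingD(3,4)[OF \<alpha>] f_def field_simps)
      qed simp
      \<comment> \<open>Both sums are multiples of \<open>\<beta> y0 e\<close>, with factors
        \<open>- \<alpha> x0 d\<close> and \<open>- \<alpha> x0 d0\<close>, so they cancel.\<close>
      also have "\<dots> = 0" using sum0[of d e] sum0[of d0 e] d0 by (simp add: field_simps add_eq_0_iff)
      finally show "(\<Sum>(x, y)\<leftarrow>?vs. \<alpha> x d * \<beta> y e) = 0" .
    qed
    ultimately show ?thesis by simp
  qed
qed simp

text \<open>Two tensors with the same values differ by one all of whose values are zero, and such a
  tensor, written as a sum of pure ones, vanishes. The conclusion has the form of the hypotheses, so
  it can be iterated to threefold tensor products.\<close>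

lemma linear_embedding_tensor: "linear_embedding (tensor A B) (tensor_eval \<alpha> \<beta>)"
  unfolding linear_embedding_def
proof (intro conjI allI eval_lin inj_onI)
  fix s t assume s: "s \<in> carrier (tensor A B)" and t: "t \<in> carrier (tensor A B)"
    and eq: "tensor_eval \<alpha> \<beta> s = tensor_eval \<alpha> \<beta> t"
  let ?d = "s \<oplus>\<^bsub>tensor A B\<^esub> (-1) \<odot>\<^bsub>tensor A B\<^esub> t"
  have d: "?d \<in> carrier (tensor A B)" using s t by simp
  then obtain zs where zs: "set zs \<subseteq> carrier A \<times> carrier B" "?d = tensor_sum A B zs" by (rule tensor_sum_exhaust)
  have "tensor_eval \<alpha> \<beta> ?d p = 0" for p
    using s t eq lin_mapD(2,3)[OF eval_lin] by simp
  then have "?d = \<zero>\<^bsub>tensor A B\<^esub>" unfolding zs(2)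
    using zs by (intro tensor_sum_separated) (auto simp: eval_sum[symmetric])
  moreover have "(-1) \<odot>\<^bsub>tensor A B\<^esub> t \<oplus>\<^bsub>tensor A B\<^esub> t = \<zero>\<^bsub>tensor A B\<^esub>"
    using t T.smult_l_distr[of "-1" 1 t] T.smult_l_null[of t] T.smult_one[of t] by simp
  ultimately show "s = t" using s t
    by (metis T.M.a_assoc T.M.l_zero T.M.r_zero smult_carrier(3))
qed

end

end

section \<open>Hopf algebras of functions on a group\<close>

text \<open>No Hopf axiom is assumed. The values of the structure maps are prescribed by
  multiplication, unit and inversion of the group, and the axioms are deduced from the group laws.
  The group fills its type, so equality of functions is equality of values on the group.\<close>

locale function_hopf = k_algebra K + G: group G
  for K :: "('k::field, 'a) hopf" and G :: "('d, 'e) monoid_scheme" +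
  fixes ev :: "'a \<Rightarrow> 'd \<Rightarrow> 'k"
  assumes carrier_G: "carrier G = UNIV"
    and ev_inj: "inj_on ev (carrier K)"
    and ev_hom: "(\<lambda>h. ev h d) \<in> alg_hom K scalars"
    and comult_closed: "h \<in> carrier K \<Longrightarrow> comult K h \<in> carrier (tensor K K)"
    and comult_eval: "h \<in> carrier K \<Longrightarrow> tensor_eval ev ev (comult K h) (d, e) = ev h (d \<otimes>\<^bsub>G\<^esub> e)"
    and counit_eval: "h \<in> carrier K \<Longrightarrow> counit K h = ev h \<one>\<^bsub>G\<^esub>"
    and antipode_closed: "h \<in> carrier K \<Longrightarrow> antipode K h \<in> carrier K"
    and antipode_eval: "h \<in> carrier K \<Longrightarrow> ev (antipode K h) d = ev h (inv\<^bsub>G\<^esub> d)"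
begin

lemma kalg: "k_algebra K" by (rule k_algebra_axioms)

lemma kmod: "module scalars K" by (rule module_axioms)

interpretation T: k_algebra "tensor K K" by (rule k_algebra_tensor[OF kalg kalg])

lemma ev_lin: "(\<lambda>h. ev h d) \<in> lin_map K scalars"
  using ev_hom by (rule alg_homD)

lemma emb: "linear_embedding K ev"
  using ev_inj ev_lin by (simp add: linear_embedding_def)

lemma emb2: "linear_embedding (tensor K K) (tensor_eval ev ev)"
  by (rule linear_embedding_tensor[OF kalg kalg emb emb])

lemma emb3: "linear_embedding (tensor K (tensor K K)) (tensor_eval ev (tensor_eval ev ev))"
  by (rule linear_embedding_tensor[OF kalg T.k_algebra_axioms emb emb2])

lemma ev_simps [simp]:
  "\<lbrakk>x \<in> carrier K; y \<in> carrier K\<rbrakk> \<Longrightarrow> ev (x \<oplus>\<^bsub>K\<^esub> y) d = ev x d + ev y d"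
  "\<lbrakk>x \<in> carrier K; y \<in> carrier K\<rbrakk> \<Longrightarrow> ev (x \<otimes>\<^bsub>K\<^esub> y) d = ev x d * ev y d"
  "x \<in> carrier K \<Longrightarrow> ev (c \<odot>\<^bsub>K\<^esub> x) d = c * ev x d"
  "ev \<one>\<^bsub>K\<^esub> d = 1"
  using lin_mapD[OF ev_lin] alg_homD(2,3)[OF ev_hom] by auto

lemma smult_mem [simp]: "x \<in> carrier K \<Longrightarrow> c \<odot>\<^bsub>K\<^esub> x \<in> carrier K"
  using smult_closed[of c x] by simp

lemma smult_mem2 [simp]: "x \<in> carrier (tensor K K) \<Longrightarrow> c \<odot>\<^bsub>tensor K K\<^esub> x \<in> carrier (tensor K K)"
  using T.smult_closed[of c x] by simp

lemma eval2_hom: "(\<lambda>t. tensor_eval ev ev t p) \<in> alg_hom (tensor K K) scalars"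
  by (rule tensor_eval_alg_hom[OF kalg kalg ev_lin ev_lin ev_hom ev_hom])

lemma eval2_simps [simp]:
  "\<lbrakk>x \<in> carrier (tensor K K); y \<in> carrier (tensor K K)\<rbrakk> \<Longrightarrow>
    tensor_eval ev ev (x \<oplus>\<^bsub>tensor K K\<^esub> y) p = tensor_eval ev ev x p + tensor_eval ev ev y p"
  "\<lbrakk>x \<in> carrier (tensor K K); y \<in> carrier (tensor K K)\<rbrakk> \<Longrightarrow>
    tensor_eval ev ev (x \<otimes>\<^bsub>tensor K K\<^esub> y) p = tensor_eval ev ev x p * tensor_eval ev ev y p"
  "x \<in> carrier (tensor K K) \<Longrightarrow> tensor_eval ev ev (c \<odot>\<^bsub>tensor K K\<^esub> x) p = c * tensor_eval ev ev x p"
  "tensor_eval ev ev \<one>\<^bsub>tensor K K\<^esub> p = 1"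
  using lin_mapD[OF alg_homD(1)[OF eval2_hom]] alg_homD(2,3)[OF eval2_hom] by auto

lemma eval_eqI:
  "\<lbrakk>x \<in> carrier K; y \<in> carrier K; \<And>d. ev x d = ev y d\<rbrakk> \<Longrightarrow> x = y"
  using linear_embeddingD(2)[OF emb] .

lemma eval2_eqI:
  "\<lbrakk>x \<in> carrier (tensor K K); y \<in> carrier (tensor K K); \<And>d e. tensor_eval ev ev x (d, e) = tensor_eval ev ev y (d, e)\<rbrakk> \<Longrightarrow> x = y"
  using linear_embeddingD(2)[OF emb2] by auto

text \<open>Evaluation at a pair \<open>(d, e)\<close> and evaluation at the product of
  \<open>d\<close> and \<open>e\<close> are both algebra maps to the field, and pairs separate
  tensors.\<close>

lemma comult_hom: "comult K \<in> alg_hom K (tensor K K)"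
  by (intro alg_homI lin_mapI eval2_eqI) (simp_all add: comult_closed comult_eval)

text \<open>The counit and antipode axioms all have this shape: the value of the lifted map at
  \<open>d\<close> is a product of values at \<open>d'\<close> and \<open>d''\<close>, hence a value
  of \<open>comult K h\<close> at that pair. The pairs used consist of \<open>d\<close> and the unit
  or the inverse of \<open>d\<close>.\<close>

lemma tensor_lift_comult:
  assumes h: "h \<in> carrier K" and b: "bilinear K K K b"
    and ev_b: "\<And>x y. \<lbrakk>x \<in> carrier K; y \<in> carrier K\<rbrakk> \<Longrightarrow> ev (b x y) d = ev x d' * ev y d''"
  shows "ev (tensor_lift K b (comult K h)) d = ev h (d' \<otimes>\<^bsub>G\<^esub> d'')"
proof -
  have "ev (tensor_lift K b (comult K h)) d = tensor_lift scalars (\<lambda>x y. ev x d' * ev y d'') (comult K h)"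
    by (rule tensor_lift_comp[OF kalg kalg kmod b module_scalars ev_lin comult_closed[OF h] ev_b])
  then show ?thesis using comult_eval[OF h, of d' d''] by (simp add: tensor_eval_def)
qed

text \<open>At a triple both sides evaluate to \<open>h\<close> at the product of the three group
  elements, bracketed in the two ways. The labour lies in showing that the nested lifts in
  \<open>tensor_assoc\<close> are lifts of bilinear maps.\<close>

lemma coassociativity:
  assumes h: "h \<in> carrier K"
  shows "tensor_assoc K K K (tensor_map (tensor K K) K (comult K) id (comult K h)) =
      tensor_map K (tensor K K) id (comult K) (comult K h)" (is "?l = ?r")
proof (rule linear_embeddingD(2)[OF emb3])
  note T = T.k_algebra_axioms
  note pure2 = pure_bilinear[OF kalg kalg] and pure12 = pure_bilinear[OF kalg T] and pure21 = pure_bilinear[OF T kalg]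
  note T12 = k_algebra.axioms(1)[OF k_algebra_tensor[OF kalg T]] and T21 = k_algebra.axioms(1)[OF k_algebra_tensor[OF T kalg]]
  note c = alg_homD(1)[OF comult_hom]
  have bil_l: "bilinear K K (tensor (tensor K K) K) (\<lambda>x y. pure (tensor K K) K (comult K x) (id y))"
    by (intro bilinearI lin_mapI) (simp_all add: bilinearD[OF pure21] lin_mapD[OF c])
  have bil_r: "bilinear K K (tensor K (tensor K K)) (\<lambda>x y. pure K (tensor K K) (id x) (comult K y))"
    by (intro bilinearI lin_mapI) (simp_all add: bilinearD[OF pure12] lin_mapD[OF c])
  have bil_in: "bilinear K K (tensor K (tensor K K)) (\<lambda>x y. pure K (tensor K K) x (pure K K y z))" if "z \<in> carrier K" for z
    using that by (intro bilinearI lin_mapI) (simp_all add: bilinearD[OF pure12] bilinearD[OF pure2])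
  let ?in = "\<lambda>t z. tensor_lift (tensor K (tensor K K)) (\<lambda>x y. pure K (tensor K K) x (pure K K y z)) t"
  have in_lin: "(\<lambda>t. ?in t z) \<in> lin_map (tensor K K) (tensor K (tensor K K))" if "z \<in> carrier K" for z
    using tensor_lift_lin_map[OF kalg kalg T12 bil_in[OF that]] .
  let ?t = "tensor_map (tensor K K) K (comult K) id (comult K h)"
  have t: "?t \<in> carrier (tensor (tensor K K) K)"
    unfolding tensor_map_def by (rule lin_mapD(1)[OF tensor_lift_lin_map[OF kalg kalg T21 bil_l] comult_closed[OF h]])
  have eval3_lin: "(\<lambda>t. tensor_eval ev (tensor_eval ev ev) t p) \<in> lin_map (tensor K (tensor K K)) scalars" for p
    by (rule linear_embeddingD(1)[OF emb3])
  have eval3_pure: "tensor_eval ev (tensor_eval ev ev) (pure K (tensor K K) x s) (d, p) = ev x d * tensor_eval ev ev s p"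
    if "x \<in> carrier K" "s \<in> carrier (tensor K K)" for x s d p
    by (rule tensor_eval_pure[OF kalg T ev_lin linear_embeddingD(1)[OF emb2] that])
  have eval2_pure: "tensor_eval ev ev (pure K K x y) (d, e) = ev x d * ev y e"
    if "x \<in> carrier K" "y \<in> carrier K" for x y d e
    by (rule tensor_eval_pure[OF kalg kalg ev_lin ev_lin that])
  have eval3_in: "tensor_eval ev (tensor_eval ev ev) (?in t z) (d, e, f) = tensor_eval ev ev t (d, e) * ev z f"
    if "t \<in> carrier (tensor K K)" "z \<in> carrier K" for t z d e f
    using that(1)
  proof (induction rule: tensor_induct[OF kalg kalg, consumes 1, case_names zero add pure])
    case zero
    show ?case
      using lin_map_zero[OF T.module_axioms module_scalars linear_embeddingD(1)[OF emb2]] lin_map_zero[OF T.module_axioms T12 in_lin[OF that(2)]]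
        lin_map_zero[OF T12 module_scalars eval3_lin] by simp
  next
    case (add s t)
    then show ?case using that(2)
      by (simp add: lin_mapD(1,2)[OF in_lin] lin_mapD(2)[OF eval3_lin] algebra_simps)
  next
    case (pure x y)
    then show ?case using that(2)
      by (simp add: tensor_lift_pure[OF kalg kalg T12 bil_in] eval3_pure eval2_pure bilinearD(1)[OF pure2] mult.assoc)
  qed
  have bil_out: "bilinear (tensor K K) K (tensor K (tensor K K)) ?in"
  proof (rule bilinearI)
    show "(\<lambda>t. ?in t z) \<in> lin_map (tensor K K) (tensor K (tensor K K))" if "z \<in> carrier K" for z
      by (rule in_lin[OF that])
    fix t assume t: "t \<in> carrier (tensor K K)"
    \<comment> \<open>For fixed \<open>t\<close> the dependence on the last factor is hidden inside
      a lift; linearity is read off from the values computed in \<open>eval3_in\<close>.\<close>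
    show "?in t \<in> lin_map K (tensor K (tensor K K))"
    proof (intro lin_mapI linear_embeddingD(2)[OF emb3])
      fix x c y p assume x: "x \<in> carrier K"
      show "?in t x \<in> carrier (tensor K (tensor K K))" by (rule lin_mapD(1)[OF in_lin[OF x] t])
      show "c \<odot>\<^bsub>tensor K (tensor K K)\<^esub> ?in t x \<in> carrier (tensor K (tensor K K))"
        using lin_mapD(1)[OF in_lin[OF x] t] module.smult_closed[OF T12, of c "?in t x"] by simp
      show "?in t (c \<odot>\<^bsub>K\<^esub> x) \<in> carrier (tensor K (tensor K K))"
        using lin_mapD(1)[OF in_lin t, of "c \<odot>\<^bsub>K\<^esub> x"] x by simp
      show "tensor_eval ev (tensor_eval ev ev) (?in t (c \<odot>\<^bsub>K\<^esub> x)) p = tensor_eval ev (tensor_eval ev ev) (c \<odot>\<^bsub>tensor K (tensor K K)\<^esub> ?in t x) p"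
        using x t by (cases p) (simp add: lin_mapD(3)[OF eval3_lin] eval3_in lin_mapD(1)[OF in_lin])
      assume y: "y \<in> carrier K"
      show "?in t (x \<oplus>\<^bsub>K\<^esub> y) \<in> carrier (tensor K (tensor K K))"
        using lin_mapD(1)[OF in_lin t, of "x \<oplus>\<^bsub>K\<^esub> y"] x y by simp
      show "?in t x \<oplus>\<^bsub>tensor K (tensor K K)\<^esub> ?in t y \<in> carrier (tensor K (tensor K K))"
        using lin_mapD(1)[OF in_lin[OF x] t] lin_mapD(1)[OF in_lin[OF y] t] module.axioms(2)[OF T12]
        by (simp add: abelian_group.axioms abelian_monoid.a_closed)
      show "tensor_eval ev (tensor_eval ev ev) (?in t (x \<oplus>\<^bsub>K\<^esub> y)) p
          = tensor_eval ev (tensor_eval ev ev) (?in t x \<oplus>\<^bsub>tensor K (tensor K K)\<^esub> ?in t y) p"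
        using x y t by (cases p) (simp add: lin_mapD(2)[OF eval3_lin] eval3_in lin_mapD(1)[OF in_lin] algebra_simps)
    qed
  qed
  show "?l \<in> carrier (tensor K (tensor K K))"
    unfolding tensor_assoc_def by (rule lin_mapD(1)[OF tensor_lift_lin_map[OF T kalg T12 bil_out] t])
  show "?r \<in> carrier (tensor K (tensor K K))"
    unfolding tensor_map_def by (rule lin_mapD(1)[OF tensor_lift_lin_map[OF kalg kalg T12 bil_r] comult_closed[OF h]])
  fix p :: "'d \<times> 'd \<times> 'd"
  obtain d e f where p: "p = (d, e, f)" by (cases p)
  have bil_s: "bilinear (tensor K K) K scalars (\<lambda>t z. tensor_eval ev ev t (d, e) * ev z f)"
    by (rule bilinear_scalars[OF linear_embeddingD(1)[OF emb2] ev_lin])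
  have "tensor_eval ev (tensor_eval ev ev) ?l p = tensor_lift scalars (\<lambda>t z. tensor_eval ev ev t (d, e) * ev z f) ?t"
    unfolding tensor_assoc_def p by (rule tensor_lift_comp[OF T kalg T12 bil_out module_scalars eval3_lin t eval3_in])
  also have "\<dots> = tensor_lift scalars (\<lambda>x y. ev x (d \<otimes>\<^bsub>G\<^esub> e) * ev y f) (comult K h)"
    unfolding tensor_map_def
    by (rule tensor_lift_comp[OF kalg kalg T21 bil_l module_scalars tensor_lift_lin_map[OF T kalg module_scalars bil_s] comult_closed[OF h]])
      (simp add: tensor_lift_pure[OF T kalg module_scalars bil_s] comult_closed comult_eval)
  also have "\<dots> = ev h (d \<otimes>\<^bsub>G\<^esub> (e \<otimes>\<^bsub>G\<^esub> f))"
    using comult_eval[OF h, of "d \<otimes>\<^bsub>G\<^esub> e" f] G.m_assoc[of d e f] carrier_G by (simp add: tensor_eval_def)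
  also have "\<dots> = tensor_lift scalars (\<lambda>x y. ev x d * ev y (e \<otimes>\<^bsub>G\<^esub> f)) (comult K h)"
    using comult_eval[OF h, of d "e \<otimes>\<^bsub>G\<^esub> f"] by (simp add: tensor_eval_def)
  also have "\<dots> = tensor_eval ev (tensor_eval ev ev) ?r p"
    unfolding tensor_map_def p
    by (rule tensor_lift_comp[OF kalg kalg T12 bil_r module_scalars eval3_lin comult_closed[OF h], symmetric])
      (simp add: eval3_pure comult_closed comult_eval)
  finally show "tensor_eval ev (tensor_eval ev ev) ?l p = tensor_eval ev (tensor_eval ev ev) ?r p" .
qed

theorem hopf: "hopf_algebra K"
proof (intro hopf_algebra.intro hopf_algebra_axioms.intro kalg comult_hom coassociativity)
  have antipode_lin: "antipode K \<in> lin_map K K"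
    by (intro lin_mapI eval_eqI) (simp_all add: antipode_closed antipode_eval)
  then show "antipode K \<in> lin_map K K" .
  have counit_hom: "counit K \<in> alg_hom K scalars"
    by (intro alg_homI lin_mapI) (simp_all add: counit_eval)
  then show "counit K \<in> alg_hom K scalars" .
  note [simp] = lin_mapD[OF antipode_lin] smult_assoc1[simplified, symmetric] smult_l_distr[simplified] smult_r_distr[simplified]
  have b1: "bilinear K K K (\<lambda>x y. counit K x \<odot>\<^bsub>K\<^esub> y)" and b2: "bilinear K K K (\<lambda>x y. counit K y \<odot>\<^bsub>K\<^esub> x)"
    by (intro bilinearI lin_mapI; simp add: counit_eval algebra_simps)+
  have b3: "bilinear K K K (\<lambda>x y. antipode K x \<otimes>\<^bsub>K\<^esub> y)" and b4: "bilinear K K K (\<lambda>x y. x \<otimes>\<^bsub>K\<^esub> antipode K y)"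
    by (intro bilinearI lin_mapI; simp add: l_distr r_distr smult_mult_left smult_mult_right)+
  fix h assume h: "h \<in> carrier K"
  note lift_closed = lin_mapD(1)[OF tensor_lift_lin_map[OF kalg kalg kmod] comult_closed[OF h]]
  have u: "d \<in> carrier G" for d using carrier_G by simp
  show "tensor_lift K (\<lambda>x y. counit K x \<odot>\<^bsub>K\<^esub> y) (comult K h) = h"
  proof (rule eval_eqI[OF lift_closed[OF b1] h])
    show "ev (tensor_lift K (\<lambda>x y. counit K x \<odot>\<^bsub>K\<^esub> y) (comult K h)) d = ev h d" for d
      using tensor_lift_comult[OF h b1, of d "\<one>\<^bsub>G\<^esub>" d] by (simp add: counit_eval u)
  qed
  show "tensor_lift K (\<lambda>x y. counit K y \<odot>\<^bsub>K\<^esub> x) (comult K h) = h"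
  proof (rule eval_eqI[OF lift_closed[OF b2] h])
    show "ev (tensor_lift K (\<lambda>x y. counit K y \<odot>\<^bsub>K\<^esub> x) (comult K h)) d = ev h d" for d
      using tensor_lift_comult[OF h b2, of d d "\<one>\<^bsub>G\<^esub>"] by (simp add: counit_eval u)
  qed
  have r: "counit K h \<odot>\<^bsub>K\<^esub> \<one>\<^bsub>K\<^esub> \<in> carrier K" by simp
  show "tensor_lift K (\<lambda>x y. antipode K x \<otimes>\<^bsub>K\<^esub> y) (comult K h) = counit K h \<odot>\<^bsub>K\<^esub> \<one>\<^bsub>K\<^esub>"
  proof (rule eval_eqI[OF lift_closed[OF b3] r])
    show "ev (tensor_lift K (\<lambda>x y. antipode K x \<otimes>\<^bsub>K\<^esub> y) (comult K h)) d = ev (counit K h \<odot>\<^bsub>K\<^esub> \<one>\<^bsub>K\<^esub>) d" for d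
      using tensor_lift_comult[OF h b3, of d "inv\<^bsub>G\<^esub> d" d] by (simp add: counit_eval antipode_eval u h G.l_inv)
  qed
  show "tensor_lift K (\<lambda>x y. x \<otimes>\<^bsub>K\<^esub> antipode K y) (comult K h) = counit K h \<odot>\<^bsub>K\<^esub> \<one>\<^bsub>K\<^esub>"
  proof (rule eval_eqI[OF lift_closed[OF b4] r])
    show "ev (tensor_lift K (\<lambda>x y. x \<otimes>\<^bsub>K\<^esub> antipode K y) (comult K h)) d = ev (counit K h \<odot>\<^bsub>K\<^esub> \<one>\<^bsub>K\<^esub>) d" for d
      using tensor_lift_comult[OF h b4, of d d "inv\<^bsub>G\<^esub> d"] by (simp add: counit_eval antipode_eval u h G.r_inv)
  qed
qed

end

text \<open>Elements with the same values are matched. On either side every structure map is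
  determined by values through the same formula in the group, so the matching respects all of
  them.\<close>

theorem function_hopf_iso:
  fixes K :: "('k::field, 'a) hopf" and L :: "('k, 'b) hopf"
  assumes K: "function_hopf K G ev" and L: "function_hopf L G ev'"
    and same: "ev ` carrier K = ev' ` carrier L"
  shows "\<exists>f. f \<in> hopf_iso K L"
proof -
  interpret K: function_hopf K G ev by (rule K)
  interpret L: function_hopf L G ev' by (rule L)
  interpret TL: k_algebra "tensor L L" by (rule k_algebra_tensor[OF L.kalg L.kalg])
  define f where "f x = the_inv_into (carrier L) ev' (ev x)" for x
  have f: "f x \<in> carrier L" "ev' (f x) = ev x" if "x \<in> carrier K" for x
    using that same the_inv_into_into[OF L.ev_inj _ order.refl] f_the_inv_into_f[OF L.ev_inj] by (auto simp: f_def)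
  note [simp] = f
  have hom: "f \<in> alg_hom K L"
    by (intro alg_homI lin_mapI L.eval_eqI) simp_all
  have bij: "bij_betw f (carrier K) (carrier L)"
    unfolding bij_betw_def
  proof
    show "inj_on f (carrier K)" using f(2) K.ev_inj by (metis inj_on_def)
    show "f ` carrier K = carrier L"
    proof
      show "carrier L \<subseteq> f ` carrier K"
      proof
        fix y assume y: "y \<in> carrier L"
        then obtain x where x: "x \<in> carrier K" "ev' y = ev x" using same by (metis imageE imageI)
        then show "y \<in> f ` carrier K" using y f L.ev_inj by (metis imageI inj_onD)
      qed
    qed auto
  qed
  have bil: "bilinear K K (tensor L L) (\<lambda>x y. pure L L (f x) (f y))"
    by (intro bilinearI lin_mapI)
      (simp_all add: bilinearD[OF pure_bilinear[OF L.kalg L.kalg]] lin_mapD[OF alg_homD(1)[OF hom]])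
  have "comult L (f h) = tensor_map L L f f (comult K h)" if h: "h \<in> carrier K" for h
    unfolding tensor_map_def
  proof (rule L.eval2_eqI)
    note ch = K.comult_closed[OF h]
    show "comult L (f h) \<in> carrier (tensor L L)" using h by (simp add: L.comult_closed)
    show "tensor_lift (tensor L L) (\<lambda>x y. pure L L (f x) (f y)) (comult K h) \<in> carrier (tensor L L)"
      by (rule lin_mapD(1)[OF tensor_lift_lin_map[OF K.kalg K.kalg TL.module_axioms bil] ch])
    fix d e
    have "tensor_eval ev' ev' (tensor_lift (tensor L L) (\<lambda>x y. pure L L (f x) (f y)) (comult K h)) (d, e)
        = tensor_lift scalars (\<lambda>x y. ev x d * ev y e) (comult K h)"
      by (rule tensor_lift_comp[OF K.kalg K.kalg TL.module_axioms bil module_scalars alg_homD(1)[OF L.eval2_hom] ch])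
        (simp add: tensor_eval_pure[OF L.kalg L.kalg L.ev_lin L.ev_lin])
    then show "tensor_eval ev' ev' (comult L (f h)) (d, e)
        = tensor_eval ev' ev' (tensor_lift (tensor L L) (\<lambda>x y. pure L L (f x) (f y)) (comult K h)) (d, e)"
      using h K.comult_eval[OF h, of d e] by (simp add: L.comult_eval) (simp add: tensor_eval_def)
  qed
  moreover have "antipode L (f h) = f (antipode K h)" if "h \<in> carrier K" for h
    using that by (intro L.eval_eqI) (simp_all add: L.antipode_closed K.antipode_closed L.antipode_eval K.antipode_eval)
  ultimately show ?thesis
    using hom bij by (intro exI[of _ f]) (simp add: hopf_iso_def L.counit_eval K.counit_eval)
qed

section \<open>The infinite dihedral group\<close>

text \<open>The pair \<open>(i, j)\<close> stands for \<open>g\<^sup>i x\<^sup>j\<close>.\<close>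

definition dih :: "(int \<times> bool) monoid" where
  "dih = \<lparr>carrier = UNIV, mult = (\<lambda>(i, j) (k, l). (i + (if j then - k else k), j \<noteq> l)), one = (0, False)\<rparr>"

lemma dih_simps [simp]:
  "carrier dih = UNIV" "(i, j) \<otimes>\<^bsub>dih\<^esub> (k, l) = (i + (if j then - k else k), j \<noteq> l)" "\<one>\<^bsub>dih\<^esub> = (0, False)"
  by (simp_all add: dih_def)

lemma group_dih: "group dih"
proof (rule groupI)
  fix d :: "int \<times> bool"
  show "\<exists>e\<in>carrier dih. e \<otimes>\<^bsub>dih\<^esub> d = \<one>\<^bsub>dih\<^esub>"
    by (cases d) (auto intro: exI[of _ "if snd d then fst d else - fst d"] exI[of _ "snd d"])
qed auto

lemma inv_dih: "inv\<^bsub>dih\<^esub> (i, j) = (if j then i else - i, j)"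
  by (rule group.inv_equality[OF group_dih]) auto

text \<open>The relation \<open>x\<^sup>2 = 1\<close> makes \<open>x\<close> its own inverse, so its
  two letters share a value.\<close>

fun letter_val :: "dihedral_gen \<times> bool \<Rightarrow> int \<times> bool" where
  "letter_val (Gen_g, s) = (if s then 1 else - 1, False)"
| "letter_val (Gen_x, s) = (0, True)"

definition word_val :: "dihedral_gen word \<Rightarrow> int \<times> bool" where
  "word_val w = foldr (\<lambda>s d. letter_val s \<otimes>\<^bsub>dih\<^esub> d) w \<one>\<^bsub>dih\<^esub>"

text \<open>A normal form in which negative powers of \<open>g\<close> are spelled with inverse
  letters. At exponent 0 no letter of \<open>g\<close> occurs, so the sign chosen there is
  immaterial.\<close>

definition can_word :: "int \<times> bool \<Rightarrow> dihedral_gen word" where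
  "can_word d = replicate (nat \<bar>fst d\<bar>) (Gen_g, 0 \<le> fst d) @ (if snd d then [(Gen_x, True)] else [])"

abbreviation "dih_rels \<equiv> {([(Gen_x, True), (Gen_x, True)], []),
      ([(Gen_x, True), (Gen_g, True), (Gen_x, True)], [(Gen_g, False)])}"

interpretation dih: group dih by (rule group_dih)

lemma word_val_simps [simp]:
  "word_val [] = \<one>\<^bsub>dih\<^esub>" "word_val (s # w) = letter_val s \<otimes>\<^bsub>dih\<^esub> word_val w"
  by (simp_all add: word_val_def)

lemma word_val_append: "word_val (u @ v) = word_val u \<otimes>\<^bsub>dih\<^esub> word_val v"
  by (induction u) (simp_all add: dih.m_assoc del: dih_simps(2,3) One_nat_def)

lemma word_val_can_word [simp]: "word_val (can_word d) = d"
proof -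
  have "word_val (replicate n (Gen_g, s)) = (if s then int n else - int n, False)" for n s
    by (induction n) auto
  then show ?thesis by (cases d) (auto simp: can_word_def word_val_append)
qed

lemma word_cong_imp_val: "word_cong dih_rels u v \<Longrightarrow> word_val u = word_val v"
proof (induction rule: word_cong.induct)
  case (cancel u a s v)
  then show ?case by (cases a; cases "word_val v"; cases "word_val u") (auto simp: word_val_append)
next
  case (rel l r u v)
  then show ?case by (cases "word_val v"; cases "word_val u") (auto simp: word_val_append)
qed simp_all

lemma word_cong_context: "word_cong R u v \<Longrightarrow> word_cong R (p @ u @ q) (p @ v @ q)"
proof (induction rule: word_cong.induct)
  case (trans u v w)
  then show ?case by (blast intro: word_cong.trans)
next
  case (cancel u a s v)
  show ?case using word_cong.cancel[of R "p @ u" a s "v @ q"] by simp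
next
  case (rel l r u v)
  then show ?case using word_cong.rel[of l r R "p @ u" "v @ q"] by simp
qed (auto intro: word_cong.intros)

lemma word_cong_Cons: "word_cong R u v \<Longrightarrow> word_cong R (s # u) (s # v)"
  using word_cong_context[of R u v "[s]" "[]"] by simp

text \<open>Only one letter has to be pushed into a word already in normal form. A letter of
  \<open>g\<close> extends the block of \<open>g\<close> or cancels against it; a letter of
  \<open>x\<close> travels through that block, inverting it, and meets the final
  \<open>x\<close>.\<close>

lemma word_cong_can:
  "word_cong dih_rels w (can_word (word_val w))"
proof (induction w)
  case Nil
  show ?case by (simp add: can_word_def word_cong.refl)
next
  case (Cons s w)
  let ?C = "word_cong dih_rels"
  note tr [trans] = word_cong.trans[of dih_rels]
  have can: "?C ((a, t) # (a, \<not> t) # v) v" for a t v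
    using word_cong.cancel[of dih_rels "[]" a t v] by simp
  have xx: "?C ((Gen_x, True) # (Gen_x, True) # v) v" for v
    using word_cong.rel[of "[(Gen_x, True), (Gen_x, True)]" "[]" dih_rels "[]" v] by simp
  have xgx: "?C ((Gen_x, True) # (Gen_g, True) # (Gen_x, True) # v) ((Gen_g, False) # v)" for v
    using word_cong.rel[of "[(Gen_x, True), (Gen_g, True), (Gen_x, True)]" "[(Gen_g, False)]" dih_rels "[]" v] by simp
  have xF: "?C ((Gen_x, False) # v) ((Gen_x, True) # v)" for v
  proof -
    \<comment> \<open>The pair \<open>x x\<close> is inserted so that its first letter cancels the
      inverse letter.\<close>
    have "?C ((Gen_x, False) # v) ((Gen_x, False) # (Gen_x, True) # (Gen_x, True) # v)"
      by (rule word_cong_Cons[OF word_cong.sym[OF xx]])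
    also have "?C \<dots> ((Gen_x, True) # v)" using can[of Gen_x False] by simp
    finally show ?thesis .
  qed
  have xg: "?C ((Gen_x, True) # (Gen_g, t) # v) ((Gen_g, \<not> t) # (Gen_x, True) # v)" for t v
  proof (cases t)
    case True
    have "?C ((Gen_x, True) # (Gen_g, True) # v) ((Gen_x, True) # (Gen_g, True) # (Gen_x, True) # (Gen_x, True) # v)"
      by (intro word_cong_Cons word_cong.sym[OF xx])
    also have "?C \<dots> ((Gen_g, False) # (Gen_x, True) # v)" by (rule xgx)
    finally show ?thesis using True by simp
  next
    case False
    \<comment> \<open>The relation for \<open>x g x\<close> is applied backwards, which creates a
      leading pair \<open>x x\<close> that disappears.\<close>
    have "?C ((Gen_x, True) # (Gen_g, False) # v) ((Gen_x, True) # (Gen_x, True) # (Gen_g, True) # (Gen_x, True) # v)"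
      by (intro word_cong_Cons word_cong.sym[OF xgx])
    also have "?C \<dots> ((Gen_g, True) # (Gen_x, True) # v)" by (rule xx)
    finally show ?thesis using False by simp
  qed
  have xgn: "?C ((Gen_x, True) # replicate n (Gen_g, t) @ v) (replicate n (Gen_g, \<not> t) @ (Gen_x, True) # v)" for n t v
  proof (induction n)
    case (Suc n)
    have "?C ((Gen_x, True) # replicate (Suc n) (Gen_g, t) @ v) ((Gen_g, \<not> t) # (Gen_x, True) # replicate n (Gen_g, t) @ v)"
      using xg by simp
    also have "?C \<dots> (replicate (Suc n) (Gen_g, \<not> t) @ (Gen_x, True) # v)"
      using word_cong_Cons[OF Suc] by simp
    finally show ?case .
  qed (simp add: word_cong.refl)
  have step: "?C (s # can_word (i, j)) (can_word (letter_val s \<otimes>\<^bsub>dih\<^esub> (i, j)))" for i j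
  proof -
    let ?x = "if j then [(Gen_x, True)] else []"
    consider t where "s = (Gen_g, t)" | t where "s = (Gen_x, t)" by (cases s rule: letter_val.cases) auto
    then show ?thesis
    proof cases
      case (1 t)
      show ?thesis
      \<comment> \<open>In the first case the letter lengthens the block, in the second it cancels
        against it; for \<open>i = 0\<close> the block is empty and takes the sign of the
        letter.\<close>
      proof (cases "i = 0 \<or> t = (0 \<le> i)")
        case True
        let ?k = "(if t then 1 else - 1) + i"
        have "nat \<bar>?k\<bar> = Suc (nat \<bar>i\<bar>)" "0 \<le> ?k \<longleftrightarrow> t" using True by (cases t; auto)+
        then have "can_word (?k, j) = (Gen_g, t) # replicate (nat \<bar>i\<bar>) (Gen_g, t) @ ?x"
          by (simp add: can_word_def)
        also have "replicate (nat \<bar>i\<bar>) (Gen_g, t) = replicate (nat \<bar>i\<bar>) (Gen_g, 0 \<le> i)"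
          using True by auto
        finally have "s # can_word (i, j) = can_word (letter_val s \<otimes>\<^bsub>dih\<^esub> (i, j))"
          using 1 by (simp add: can_word_def)
        then show ?thesis by (simp add: word_cong.refl)
      next
        case False
        define n where "n = nat (\<bar>i\<bar> - 1)"
        have n: "nat \<bar>i\<bar> = Suc n" using False by (auto simp: n_def)
        have "can_word (letter_val s \<otimes>\<^bsub>dih\<^esub> (i, j)) = replicate n (Gen_g, 0 \<le> i) @ ?x"
          using False 1 by (auto simp: can_word_def n_def abs_if split: if_splits)
        moreover have "s # can_word (i, j) = (Gen_g, t) # (Gen_g, \<not> t) # replicate n (Gen_g, 0 \<le> i) @ ?x"
          using False 1 n by (auto simp: can_word_def)
        ultimately show ?thesis using can by simp
      qed
    next
      case (2 t)
      have "?C (s # can_word (i, j)) ((Gen_x, True) # can_word (i, j))"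
        using 2 xF word_cong.refl by (cases t) auto
      also have "?C \<dots> (replicate (nat \<bar>i\<bar>) (Gen_g, \<not> 0 \<le> i) @ (Gen_x, True) # ?x)"
        using xgn by (simp add: can_word_def)
      also have "?C \<dots> (replicate (nat \<bar>i\<bar>) (Gen_g, \<not> 0 \<le> i) @ (if j then [] else [(Gen_x, True)]))"
        using word_cong_context[OF xx[of "[]"], of "replicate (nat \<bar>i\<bar>) (Gen_g, \<not> 0 \<le> i)" "[]"] word_cong.refl
        by (cases j) auto
      also have "\<dots> = can_word (letter_val s \<otimes>\<^bsub>dih\<^esub> (i, j))"
        using 2 by (cases "i = 0") (auto simp: can_word_def)
      finally show ?thesis .
    qed
  qed
  have "?C (s # w) (s # can_word (word_val w))" using Cons by (rule word_cong_Cons)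
  also have "?C \<dots> (can_word (word_val (s # w)))" using step by (cases "word_val w") simp
  finally show ?case .
qed

text \<open>One direction says that the relations hold for pairs, the other that words with the same
  value share a normal form. Congruence classes are thus the fibres of
  \<open>word_val\<close>.\<close>

lemma word_cong_iff: "word_cong dih_rels u v \<longleftrightarrow> word_val u = word_val v"
proof
  assume "word_val u = word_val v"
  then have "word_cong dih_rels (can_word (word_val u)) v"
    using word_cong.sym[OF word_cong_can[of v]] by simp
  then show "word_cong dih_rels u v" by (rule word_cong.trans[OF word_cong_can])
qed (rule word_cong_imp_val)

definition dih_elt :: "int \<times> bool \<Rightarrow> dihedral_gen word set" where
  "dih_elt d = {w. word_val w = d}"

lemma dih_elt_iso: "dih_elt \<in> iso dih infinite_dihedral"
proof -
  have class_eq: "{(v, w). word_val v = word_val w} `` {v} = dih_elt (word_val v)" for v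
    by (auto simp: dih_elt_def)
  have "UNIV // {(v, w). word_val v = word_val w} = range (\<lambda>v. dih_elt (word_val v))"
    unfolding quotient_def class_eq by blast
  also have "\<dots> = dih_elt ` range word_val" by (simp add: image_image)
  also have "range word_val = UNIV" by (rule surjI[of _ can_word]) simp
  finally have "range dih_elt = UNIV // {(v, w). word_val v = word_val w}" by simp
  moreover have "inj dih_elt"
    by (rule injI) (metis (mono_tags) dih_elt_def mem_Collect_eq word_val_can_word)
  moreover have "dih_elt (d \<otimes>\<^bsub>dih\<^esub> e) = dih_elt d \<otimes>\<^bsub>infinite_dihedral\<^esub> dih_elt e" for d e
    by (auto simp: infinite_dihedral_def presented_group_def dih_elt_def word_cong_iff word_val_append
        intro: exI[of _ "can_word d"] exI[of _ "can_word e"])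
  moreover have "carrier infinite_dihedral = UNIV // {(v, w). word_val v = word_val w}"
    by (simp add: infinite_dihedral_def presented_group_def word_cong_iff)
  ultimately show ?thesis
    by (auto simp: iso_def hom_def bij_betw_def simp del: dih_simps(2) split_paired_All)
qed

lemma group_infinite_dihedral: "group infinite_dihedral"
proof -
  have mult: "dih_elt d \<otimes>\<^bsub>infinite_dihedral\<^esub> dih_elt e = dih_elt (d \<otimes>\<^bsub>dih\<^esub> e)" for d e
    using dih_elt_iso by (simp add: iso_def hom_def del: dih_simps(2) split_paired_All)
  have carrier: "carrier infinite_dihedral = range dih_elt"
    using dih_elt_iso by (simp add: iso_def bij_betw_def)
  have one: "\<one>\<^bsub>infinite_dihedral\<^esub> = dih_elt \<one>\<^bsub>dih\<^esub>"
    by (auto simp: infinite_dihedral_def presented_group_def dih_elt_def word_cong_iff)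
  have "Group.monoid infinite_dihedral"
    by (rule monoidI) (auto simp: carrier one mult dih.m_assoc simp del: dih_simps(2,3))
  then show ?thesis using dih.iso_imp_group[of infinite_dihedral] dih_elt_iso by (auto simp: is_iso_def)
qed

section \<open>Subspaces of finite codimension\<close>

text \<open>The common kernel of finitely many functionals has a finite-dimensional complement: a
  functional that does not vanish on the kernel of the earlier ones costs one further vector, any
  other costs nothing.\<close>

lemma finitely_many_functionals:
  assumes V: "module scalars V" and "finite L" and "\<And>l. l \<in> L \<Longrightarrow> l \<in> lin_map V scalars"
  shows "\<exists>B. finite B \<and> B \<subseteq> carrier V \<and>
    (\<forall>v\<in>carrier V. \<exists>w\<in>carrier V. (\<forall>l\<in>L. l w = 0) \<and> (\<exists>b\<in>lin_span V B. v = w \<oplus>\<^bsub>V\<^esub> b))"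
  using assms(2,3)
proof (induction rule: finite_induct)
  case empty
  interpret V: module scalars V by (rule V)
  have "\<zero>\<^bsub>V\<^esub> \<in> lin_span V {}" by (rule submoduleD(2)[OF lin_span_submodule[OF V]]) simp
  then show ?case by (intro exI[of _ "{}"]) force
next
  case (insert l L)
  interpret V: module scalars V by (rule V)
  have sm [simp]: "x \<in> carrier V \<Longrightarrow> c \<odot>\<^bsub>V\<^esub> x \<in> carrier V" for c x using V.smult_closed[of c x] by simp
  obtain B where B: "finite B" "B \<subseteq> carrier V"
    and B': "\<And>v. v \<in> carrier V \<Longrightarrow> \<exists>w\<in>carrier V. (\<forall>l\<in>L. l w = 0) \<and> (\<exists>b\<in>lin_span V B. v = w \<oplus>\<^bsub>V\<^esub> b)"
    using insert.IH[OF insert.prems[OF insertI2]] by auto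
  note lin = lin_mapD[OF insert.prems]
  show ?case
  proof (cases "\<exists>v\<in>carrier V. (\<forall>l\<in>L. l v = 0) \<and> l v \<noteq> 0")
    case False
    then have "\<forall>v\<in>carrier V. \<exists>w\<in>carrier V. (\<forall>l\<in>insert l L. l w = 0) \<and> (\<exists>b\<in>lin_span V B. v = w \<oplus>\<^bsub>V\<^esub> b)"
      using B' by (metis insertE)
    then show ?thesis using B by blast
  next
    case True
    then obtain v0 where v0: "v0 \<in> carrier V" "\<forall>l\<in>L. l v0 = 0" "l v0 \<noteq> 0" by blast
    let ?S = "lin_span V (insert v0 B)"
    have sub: "insert v0 B \<subseteq> carrier V" using B v0 by simp
    note S = submoduleD[OF lin_span_submodule[OF V sub]]
    have "\<exists>w\<in>carrier V. (\<forall>l\<in>insert l L. l w = 0) \<and> (\<exists>b\<in>?S. v = w \<oplus>\<^bsub>V\<^esub> b)" if v: "v \<in> carrier V" for v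
    proof -
      obtain w b where w: "w \<in> carrier V" "\<forall>l\<in>L. l w = 0" and b: "b \<in> lin_span V B" "v = w \<oplus>\<^bsub>V\<^esub> b"
        using B'[OF v] by blast
      \<comment> \<open>With this coefficient \<open>w - c v0\<close> is killed by \<open>l\<close>
        as well, and the earlier functionals still vanish there because they vanish at
        \<open>v0\<close>.\<close>
      define c where "c = l w / l v0"
      let ?w = "w \<oplus>\<^bsub>V\<^esub> (- c) \<odot>\<^bsub>V\<^esub> v0" and ?b = "c \<odot>\<^bsub>V\<^esub> v0 \<oplus>\<^bsub>V\<^esub> b"
      have "lin_span V B \<subseteq> ?S"
        using lin_span_superset[of "insert v0 B" V] by (intro lin_span_minimal lin_span_submodule V sub) auto
      then have bS: "b \<in> ?S" using b by blast
      moreover have "v0 \<in> ?S" using lin_span_superset[of "insert v0 B" V] by blast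
      ultimately have bS': "?b \<in> ?S" by (intro S(3,4))
      have bc: "b \<in> carrier V" using bS S(1) by blast
      have "(- c) \<odot>\<^bsub>V\<^esub> v0 \<oplus>\<^bsub>V\<^esub> c \<odot>\<^bsub>V\<^esub> v0 = \<zero>\<^bsub>V\<^esub>"
        using v0 V.smult_l_distr[of "-c" c v0] V.smult_l_null[of v0] by simp
      moreover have "?w \<oplus>\<^bsub>V\<^esub> ?b = w \<oplus>\<^bsub>V\<^esub> (((- c) \<odot>\<^bsub>V\<^esub> v0 \<oplus>\<^bsub>V\<^esub> c \<odot>\<^bsub>V\<^esub> v0) \<oplus>\<^bsub>V\<^esub> b)"
        using w v0 bc by (simp add: V.M.a_assoc)
      ultimately have "v = ?w \<oplus>\<^bsub>V\<^esub> ?b" using bc b by simp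
      moreover have "l' ?w = 0" if "l' \<in> insert l L" for l'
      proof -
        have "l' ?w = l' w - c * l' v0" using lin[OF that] w v0 by simp
        then show ?thesis using that w v0 by (auto simp: c_def)
      qed
      moreover have "?w \<in> carrier V" using w v0 by simp
      ultimately show ?thesis using bS' by blast
    qed
    then show ?thesis using B sub by (intro exI[of _ "insert v0 B"]) auto
  qed
qed

text \<open>This is the largest two-sided ideal inside the kernel of \<open>f\<close>; taking the
  unit for both outer factors shows that it lies there.\<close>

lemma sandwich_ideal:
  assumes A: "k_algebra A" and f: "f \<in> lin_map A scalars"
  defines "I \<equiv> {u \<in> carrier A. \<forall>a\<in>carrier A. \<forall>b\<in>carrier A. f (a \<otimes>\<^bsub>A\<^esub> u \<otimes>\<^bsub>A\<^esub> b) = 0}"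
  shows "ideal I A" and "u \<in> I \<Longrightarrow> f u = 0"
proof -
  interpret A: k_algebra A by (rule A)
  note f' = lin_mapD[OF f] and f0 = lin_map_zero[OF A.module_axioms module_scalars f]
  have [simp]: "c \<odot>\<^bsub>A\<^esub> u \<in> carrier A" if "u \<in> carrier A" for c u using that A.smult_closed[of c u] by simp
  have sub: "submodule I scalars A"
    by (rule A.submodule_scaleI)
      (auto simp: I_def f0 f' A.l_distr A.r_distr A.smult_mult_left A.smult_mult_right)
  show "ideal I A"
  proof (rule idealI[OF A.ring_axioms submodule.axioms(1)[OF sub]])
    show "x \<otimes>\<^bsub>A\<^esub> a \<in> I" if a: "a \<in> I" and x: "x \<in> carrier A" for a x
    proof -
      have "b \<otimes>\<^bsub>A\<^esub> (x \<otimes>\<^bsub>A\<^esub> a) \<otimes>\<^bsub>A\<^esub> b' = (b \<otimes>\<^bsub>A\<^esub> x) \<otimes>\<^bsub>A\<^esub> a \<otimes>\<^bsub>A\<^esub> b'" if "b \<in> carrier A" "b' \<in> carrier A" for b b'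
        using that a x by (simp add: I_def A.m_assoc)
      then show ?thesis using a x by (auto simp: I_def)
    qed
    show "a \<otimes>\<^bsub>A\<^esub> x \<in> I" if a: "a \<in> I" and x: "x \<in> carrier A" for a x
    proof -
      have "b \<otimes>\<^bsub>A\<^esub> (a \<otimes>\<^bsub>A\<^esub> x) \<otimes>\<^bsub>A\<^esub> b' = b \<otimes>\<^bsub>A\<^esub> a \<otimes>\<^bsub>A\<^esub> (x \<otimes>\<^bsub>A\<^esub> b')" if "b \<in> carrier A" "b' \<in> carrier A" for b b'
        using that a x by (simp add: I_def A.m_assoc)
      then show ?thesis using a x by (auto simp: I_def)
    qed
  qed
  show "f u = 0" if "u \<in> I"
  proof -
    have "f (\<one>\<^bsub>A\<^esub> \<otimes>\<^bsub>A\<^esub> u \<otimes>\<^bsub>A\<^esub> \<one>\<^bsub>A\<^esub>) = 0" "u \<in> carrier A"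
      using that A.one_closed unfolding I_def by blast+
    then show ?thesis by simp
  qed
qed

section \<open>The finite dual of a group algebra\<close>

lemma group_hopf_simps [simp]:
  "carrier (group_hopf G) = carrier (monoid_algebra G)" "mult (group_hopf G) = mult (monoid_algebra G)"
  "one (group_hopf G) = one (monoid_algebra G)" "zero (group_hopf G) = zero (monoid_algebra G)"
  "add (group_hopf G) = add (monoid_algebra G)" "smult (group_hopf G) = smult (monoid_algebra G)"
  "comult (group_hopf G) = lin_ext (tensor (monoid_algebra G) (monoid_algebra G))
     (\<lambda>g. pure (monoid_algebra G) (monoid_algebra G) (single g 1) (single g 1))"
  "counit (group_hopf G) = lin_ext scalars (\<lambda>g. 1)"
  "antipode (group_hopf G) = lin_ext (monoid_algebra G) (\<lambda>g. single (inv\<^bsub>G\<^esub> g) 1)"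
  by (simp_all add: group_hopf_def module.defs hopf.defs)

lemma finite_dual_simps [simp]:
  "carrier (finite_dual H) = finite_dual_carrier H" "mult (finite_dual H) = mult (finite_dual_algebra H)"
  "one (finite_dual H) = one (finite_dual_algebra H)" "zero (finite_dual H) = zero (finite_dual_algebra H)"
  "add (finite_dual H) = add (finite_dual_algebra H)" "smult (finite_dual H) = smult (finite_dual_algebra H)"
  "comult (finite_dual H) = finite_dual_comult H"
  "counit (finite_dual H) = (\<lambda>f. f \<one>\<^bsub>H\<^esub>)"
  "antipode (finite_dual H) = (\<lambda>f. \<lambda>h\<in>carrier H. f (antipode H h))"
  by (simp_all add: finite_dual_def finite_dual_algebra_def module.defs hopf.defs)

lemma finite_dual_algebra_simps [simp]:
  "carrier (finite_dual_algebra H) = finite_dual_carrier H"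
  "f \<otimes>\<^bsub>finite_dual_algebra H\<^esub> g = (\<lambda>h\<in>carrier H. tensor_lift scalars (\<lambda>x y. f x * g y) (comult H h))"
  "\<one>\<^bsub>finite_dual_algebra H\<^esub> = (\<lambda>h\<in>carrier H. counit H h)"
  "\<zero>\<^bsub>finite_dual_algebra H\<^esub> = (\<lambda>h\<in>carrier H. 0)"
  "f \<oplus>\<^bsub>finite_dual_algebra H\<^esub> g = (\<lambda>h\<in>carrier H. f h + g h)"
  "c \<odot>\<^bsub>finite_dual_algebra H\<^esub> f = (\<lambda>h\<in>carrier H. c * f h)"
  by (simp_all add: finite_dual_algebra_def)

text \<open>Tensor products read only algebra fields of a record, so a Hopf algebra and its
  underlying algebra have literally the same tensor square, and results about the latter
  apply.\<close>

lemma tensor_cong: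
  assumes "carrier A' = carrier A" "mult A' = mult A" "one A' = one A" "add A' = add A" "smult A' = smult A"
  shows "tensor A' A' = tensor A A" "pure A' A' = pure A A"
proof -
  have "A' \<times>\<times> A' = A \<times>\<times> A" by (simp add: DirProd_def assms)
  moreover from this have "tensor_null A' A' = tensor_null A A"
    by (simp add: tensor_null_def bilinear_relations_def assms)
  ultimately show "tensor A' A' = tensor A A" "pure A' A' = pure A A"
    by (simp_all add: tensor_def pure_def fun_eq_iff)
qed

lemma ideal_cong:
  assumes "ideal I R" "ring R'" "carrier R' = carrier R" "mult R' = mult R" "zero R' = zero R" "add R' = add R"
  shows "ideal I R'"
proof -
  interpret ideal I R by (rule assms(1))
  show ?thesis
  proof (rule idealI[OF assms(2)])
    show "subgroup I (add_monoid R')"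
      using a_subgroup by (simp add: subgroup_def m_inv_def assms(3-))
  qed (simp_all add: assms(3-) I_l_closed I_r_closed)
qed

text \<open>The group occurs twice: \<open>D\<close> is the model on which elements of
  \<open>K\<close> are functions, \<open>G\<close> the one from which the group algebra is built.
  The assumption \<open>represented\<close> is the single statement about functionals to be
  supplied; that, conversely, elements of \<open>K\<close> define functionals in the finite dual is
  proved from the comultiplication.\<close>

locale represented_dual = K: function_hopf K D ev + G: group G
  for K :: "('k::field, 'a) hopf" and D :: "('d, 'e) monoid_scheme" and ev and G :: "('g, 'n) monoid_scheme" +
  fixes \<gamma> :: "'d \<Rightarrow> 'g"
  assumes \<gamma>: "\<gamma> \<in> iso D G"
    and represented: "f \<in> finite_dual_carrier (group_hopf G :: ('k, _) hopf) \<Longrightarrow>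
      \<exists>h\<in>carrier K. \<forall>d. ev h d = f (single (\<gamma> d) 1)"
begin

abbreviation (input) "MA \<equiv> monoid_algebra G :: ('k, 'g \<Rightarrow>\<^sub>0 'k) module"
abbreviation (input) "H \<equiv> group_hopf G :: ('k, 'g \<Rightarrow>\<^sub>0 'k) hopf"
abbreviation (input) "FA \<equiv> finite_dual_algebra (group_hopf G) :: ('k, ('g \<Rightarrow>\<^sub>0 'k) \<Rightarrow> 'k) module"
abbreviation (input) "FD \<equiv> finite_dual (group_hopf G) :: ('k, ('g \<Rightarrow>\<^sub>0 'k) \<Rightarrow> 'k) hopf"

definition elt :: "'d \<Rightarrow> 'g \<Rightarrow>\<^sub>0 'k" where "elt d = single (\<gamma> d) 1"

definition \<delta> :: "'g \<Rightarrow> 'd" where "\<delta> = the_inv \<gamma>"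

definition \<theta> :: "'a \<Rightarrow> ('g \<Rightarrow>\<^sub>0 'k) \<Rightarrow> 'k" where
  "\<theta> h = (\<lambda>u\<in>carrier MA. lin_ext scalars (\<lambda>a. ev h (\<delta> a)) u)"

lemma MA: "k_algebra MA" by (rule k_algebra_monoid_algebra) (rule G.monoid_axioms)

sublocale MA: k_algebra MA by (rule MA)

lemma H: "k_algebra H"
  by (rule k_algebra_image[OF MA, of "\<lambda>x. x"]) simp_all

lemma \<gamma>_bij: "range \<gamma> = carrier G" "inj \<gamma>"
  using \<gamma> K.carrier_G by (auto simp: iso_def bij_betw_def)

lemma \<gamma>_simps [simp]: "\<gamma> d \<in> carrier G" "\<delta> (\<gamma> d) = d" "a \<in> carrier G \<Longrightarrow> \<gamma> (\<delta> a) = a"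
  using \<gamma>_bij the_inv_f_f[of \<gamma>] f_the_inv_into_f[of \<gamma> UNIV a] by (auto simp: \<delta>_def)

lemma \<gamma>_mult: "\<gamma> d \<otimes>\<^bsub>G\<^esub> \<gamma> e = \<gamma> (d \<otimes>\<^bsub>D\<^esub> e)"
  using \<gamma> K.carrier_G by (simp add: iso_def hom_def)

lemma \<gamma>_one: "\<gamma> \<one>\<^bsub>D\<^esub> = \<one>\<^bsub>G\<^esub>"
  using \<gamma> K.G.group_axioms G.group_axioms by (auto simp: iso_def hom_one)

lemma \<gamma>_inv: "\<gamma> (inv\<^bsub>D\<^esub> d) = inv\<^bsub>G\<^esub> \<gamma> d"
  using K.carrier_G by (intro G.inv_equality[symmetric]) (simp_all add: \<gamma>_mult \<gamma>_one K.G.l_inv)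

lemma elt_closed [simp]: "elt d \<in> carrier MA" by (simp add: elt_def)

lemma functional_sum:
  assumes f: "f \<in> lin_map MA scalars" and u: "u \<in> carrier MA"
  shows "f u = lin_ext scalars (\<lambda>a. f (single a 1)) u"
proof -
  have "keys u \<subseteq> carrier G" using u by simp
  then show ?thesis
  proof (induction rule: poly_mapping_on_induct)
    case zero
    then show ?case using lin_map_zero[OF MA.module_axioms module_scalars f] by (simp add: lin_ext_scalars)
  next
    case (add u v)
    have "lin_ext scalars (\<lambda>a. f (single a 1)) (u + v) = lin_ext scalars (\<lambda>a. f (single a 1)) u
      \<oplus>\<^bsub>scalars\<^esub> lin_ext scalars (\<lambda>a. f (single a 1)) v"
      by (rule lin_ext_add[OF module_scalars]) simp
    then show ?case using add lin_mapD(2)[OF f, of u v] by simp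
  next
    case (single a c)
    then show ?case using lin_mapD(3)[OF f, of "single a 1" c]
      by (simp add: lin_ext_single[OF module_scalars])
  qed
qed

lemma functional_eqI:
  assumes "f \<in> lin_map MA scalars" "f' \<in> lin_map MA scalars" "f \<in> extensional (carrier MA)" "f' \<in> extensional (carrier MA)"
    and eq: "\<And>d. f (elt d) = f' (elt d)"
  shows "f = f'"
proof (rule extensionalityI[OF assms(3,4)])
  fix u assume u: "u \<in> carrier MA"
  have "lin_ext scalars (\<lambda>a. f (single a 1)) u = lin_ext scalars (\<lambda>a. f' (single a 1)) u"
  proof (rule lin_ext_cong[OF module_scalars])
    fix a assume "a \<in> keys u"
    then have "a \<in> carrier G" using u by auto
    then show "f (single a 1) = f' (single a 1)" using eq[of "\<delta> a"] by (simp add: elt_def)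
  qed simp
  then show "f u = f' u" using functional_sum[OF assms(1) u] functional_sum[OF assms(2) u] by simp
qed

lemma lin_ext_functional: "restrict (lin_ext scalars b) (carrier MA) \<in> lin_map MA scalars"
proof (rule lin_mapI)
  fix u v c assume u: "u \<in> carrier MA"
  show "restrict (lin_ext scalars b) (carrier MA) (c \<odot>\<^bsub>MA\<^esub> u) = c \<odot>\<^bsub>scalars\<^esub> restrict (lin_ext scalars b) (carrier MA) u"
    using u MA.smult_closed[of c u] lin_ext_smult[OF module_scalars, of u b c] by simp
  assume v: "v \<in> carrier MA"
  show "restrict (lin_ext scalars b) (carrier MA) (u \<oplus>\<^bsub>MA\<^esub> v)
      = restrict (lin_ext scalars b) (carrier MA) u \<oplus>\<^bsub>scalars\<^esub> restrict (lin_ext scalars b) (carrier MA) v"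
    using u v keys_add_subset[of u "carrier G" v] lin_ext_add[OF module_scalars, of u v b] by simp
qed simp

lemma \<theta>_lin: "\<theta> h \<in> lin_map MA scalars"
  unfolding \<theta>_def by (rule lin_ext_functional)

lemma \<theta>_ext: "\<theta> h \<in> extensional (carrier MA)"
  by (simp add: \<theta>_def)

lemma \<theta>_single [simp]: "a \<in> carrier G \<Longrightarrow> \<theta> h (single a 1) = ev h (\<delta> a)"
  by (simp add: \<theta>_def lin_ext_single[OF module_scalars])

lemma \<theta>_elt [simp]: "\<theta> h (elt d) = ev h d" by (simp add: elt_def)

lemma sum_list_zero: "(\<And>z. z \<in> set zs \<Longrightarrow> F z = (0 :: 'b::monoid_add)) \<Longrightarrow> (\<Sum>z\<leftarrow>zs. F z) = 0"
  by (induction zs) auto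

text \<open>The splitting of h(d e) into finitely many products of a function of d and a function of
  e is the source of finite codimension: it makes the translates of \<open>h\<close> span a
  finite-dimensional space.\<close>

lemma comult_sum:
  assumes "h \<in> carrier K"
  obtains zs where "set zs \<subseteq> carrier K \<times> carrier K" "comult K h = tensor_sum K K zs"
    "\<And>d e. ev h (d \<otimes>\<^bsub>D\<^esub> e) = (\<Sum>(p, q)\<leftarrow>zs. ev p d * ev q e)"
proof -
  obtain zs where zs: "set zs \<subseteq> carrier K \<times> carrier K" "comult K h = tensor_sum K K zs"
    using K.comult_closed[OF assms] by (rule tensor_sum_exhaust[OF K.kalg K.kalg])
  moreover have "ev h (d \<otimes>\<^bsub>D\<^esub> e) = (\<Sum>(p, q)\<leftarrow>zs. ev p d * ev q e)" for d e
    using K.comult_eval[OF assms, of d e] tensor_eval_sum[where \<alpha> = ev and \<beta> = ev, OF K.kalg K.kalg K.ev_lin K.ev_lin zs(1)] zs(2) by simp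
  ultimately show ?thesis using that by blast
qed

lemma mult_keys:
  "\<lbrakk>keys u \<subseteq> carrier G; keys v \<subseteq> carrier G\<rbrakk> \<Longrightarrow> keys (u \<otimes>\<^bsub>MA\<^esub> v) \<subseteq> carrier G"
  using MA.m_closed[of u v] by simp

lemma \<theta>_zero: "\<theta> r 0 = 0"
  using lin_map_zero[OF MA.module_axioms module_scalars \<theta>_lin[of r]] by simp

text \<open>Two splittings put the three factors of a product under separate functions:
  \<open>zs\<close> splits off the left factor, \<open>Y q\<close> separates the middle from the
  right one. Both sides are linear in the middle factor, so group elements decide.\<close>

lemma \<theta>_sandwich:
  assumes zs: "set zs \<subseteq> carrier K \<times> carrier K" "\<And>d e. ev h (d \<otimes>\<^bsub>D\<^esub> e) = (\<Sum>(p, q)\<leftarrow>zs. ev p d * ev q e)"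
    and Y: "\<And>q d e. q \<in> carrier K \<Longrightarrow> ev q (d \<otimes>\<^bsub>D\<^esub> e) = (\<Sum>(r, s)\<leftarrow>Y q. ev r d * ev s e)"
    and a: "a \<in> carrier G" and b: "b \<in> carrier G" and w: "keys w \<subseteq> carrier G"
  shows "\<theta> h (single a c \<otimes>\<^bsub>MA\<^esub> w \<otimes>\<^bsub>MA\<^esub> single b c')
    = c * c' * (\<Sum>(p, q)\<leftarrow>zs. ev p (\<delta> a) * (\<Sum>(r, s)\<leftarrow>Y q. \<theta> r w * ev s (\<delta> b)))"
  using w
proof (induction rule: poly_mapping_on_induct)
  case zero
  show ?case by (simp add: monoid_algebra_mult split_beta \<theta>_zero)
next
  case (add w w')
  have inner: "(\<Sum>(r, s)\<leftarrow>ys. \<theta> r (w + w') * t s) = (\<Sum>(r, s)\<leftarrow>ys. \<theta> r w * t s) + (\<Sum>(r, s)\<leftarrow>ys. \<theta> r w' * t s)"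
    for ys and t :: "'a \<Rightarrow> 'k"
    using lin_mapD(2)[OF \<theta>_lin, of w w'] add(1,2) by (induction ys) (auto simp: algebra_simps)
  have outer: "(\<Sum>(p, q)\<leftarrow>xs. t p * (F q + F' q)) = (\<Sum>(p, q)\<leftarrow>xs. t p * F q) + (\<Sum>(p, q)\<leftarrow>xs. t p * F' q)"
    for xs :: "('a \<times> 'a) list" and t F F' :: "'a \<Rightarrow> 'k" by (induction xs) (auto simp: algebra_simps)
  have "single a c \<otimes>\<^bsub>MA\<^esub> w \<otimes>\<^bsub>MA\<^esub> single b c' \<in> carrier MA"
    "single a c \<otimes>\<^bsub>MA\<^esub> w' \<otimes>\<^bsub>MA\<^esub> single b c' \<in> carrier MA"
    using a b add by (simp_all add: mult_keys)
  then show ?case unfolding inner outer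
    using add(3,4) lin_mapD(2)[OF \<theta>_lin[of h]] by (simp add: monoid_algebra_mult algebra_simps del: monoid_algebra_simps(1))
next
  case (single e c'')
  have sm: "\<theta> r (single e x) = x * ev r (\<delta> e)" if "e \<in> carrier G" for r e x
    using that by (simp add: \<theta>_def lin_ext_single[OF module_scalars])
  have "ev h (\<delta> (a \<otimes>\<^bsub>G\<^esub> e \<otimes>\<^bsub>G\<^esub> b)) = ev h (\<delta> a \<otimes>\<^bsub>D\<^esub> (\<delta> e \<otimes>\<^bsub>D\<^esub> \<delta> b))"
    using a b single by (metis G.m_assoc \<gamma>_mult \<gamma>_simps(2,3))
  also have "\<dots> = (\<Sum>(p, q)\<leftarrow>zs. ev p (\<delta> a) * (\<Sum>(r, s)\<leftarrow>Y q. ev r (\<delta> e) * ev s (\<delta> b)))"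
    unfolding zs(2) using zs(1) Y by (intro arg_cong[of _ _ sum_list] map_cong) auto
  finally have *: "ev h (\<delta> (a \<otimes>\<^bsub>G\<^esub> e \<otimes>\<^bsub>G\<^esub> b)) = \<dots>" .
  have inner: "(\<Sum>(r, s)\<leftarrow>ys. c'' * ev r (\<delta> e) * t s) = c'' * (\<Sum>(r, s)\<leftarrow>ys. ev r (\<delta> e) * t s)"
    for ys and t :: "'a \<Rightarrow> 'k" by (induction ys) (auto simp: algebra_simps)
  have outer: "(\<Sum>(p, q)\<leftarrow>xs. t p * (c'' * F q)) = c'' * (\<Sum>(p, q)\<leftarrow>xs. t p * F q)"
    for xs :: "('a \<times> 'a) list" and t F :: "'a \<Rightarrow> 'k" by (induction xs) (auto simp: algebra_simps)
  show ?case using a b single by (simp add: monoid_algebra_mult sm * inner outer)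
qed

text \<open>
  Writing \<open>h (d e f) = \<Sum> p d * r e * s f\<close>, the functional of \<open>h\<close> kills the ideal of all \<open>u\<close> with
  \<open>h (a u b) = 0\<close> for all \<open>a\<close> and \<open>b\<close>, which contains the common kernel of the finitely many \<open>r\<close>.
\<close>

lemma \<theta>_finite_dual:
  assumes h: "h \<in> carrier K"
  shows "\<theta> h \<in> finite_dual_carrier H"
proof -
  let ?f = "\<theta> h"
  define I where "I = {u \<in> carrier MA. \<forall>a\<in>carrier MA. \<forall>b\<in>carrier MA. ?f (a \<otimes>\<^bsub>MA\<^esub> u \<otimes>\<^bsub>MA\<^esub> b) = 0}"
  note I = sandwich_ideal[OF MA \<theta>_lin[of h], folded I_def]
  note f = lin_mapD[OF \<theta>_lin[of h]]
  have ideal: "ideal I H" by (rule ideal_cong[OF I(1)]) (simp_all add: k_algebra.axioms(2)[OF H])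
  obtain zs where zs: "set zs \<subseteq> carrier K \<times> carrier K"
    "\<And>d e. ev h (d \<otimes>\<^bsub>D\<^esub> e) = (\<Sum>(p, q)\<leftarrow>zs. ev p d * ev q e)" using comult_sum[OF h] by metis
  have "\<exists>ys. set ys \<subseteq> carrier K \<times> carrier K \<and> (\<forall>d e. ev q (d \<otimes>\<^bsub>D\<^esub> e) = (\<Sum>(r, s)\<leftarrow>ys. ev r d * ev s e))"
    if "q \<in> carrier K" for q using comult_sum[OF that] by metis
  then obtain Y where Y: "\<And>q d e. q \<in> carrier K \<Longrightarrow> ev q (d \<otimes>\<^bsub>D\<^esub> e) = (\<Sum>(r, s)\<leftarrow>Y q. ev r d * ev s e)" by metis
  \<comment> \<open>These are the functions applied to the middle factor, finitely many since both
    splittings are lists.\<close>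
  define X where "X = (\<Union>q\<in>snd ` set zs. fst ` set (Y q))"
  have X: "u \<in> I" if u: "u \<in> carrier MA" and r: "\<forall>r\<in>X. \<theta> r u = 0" for u
  proof -
    have *: "?f (single a c \<otimes>\<^bsub>MA\<^esub> u \<otimes>\<^bsub>MA\<^esub> single b c') = 0"
      if a: "a \<in> carrier G" and b: "b \<in> carrier G" for a b c c'
    proof -
      have "(\<Sum>(r, s)\<leftarrow>Y q. \<theta> r u * ev s (\<delta> b)) = 0" if "q \<in> snd ` set zs" for q
        using that r by (intro sum_list_zero) (force simp: X_def)
      then have "(\<Sum>(p, q)\<leftarrow>zs. ev p (\<delta> a) * (\<Sum>(r, s)\<leftarrow>Y q. \<theta> r u * ev s (\<delta> b))) = 0"
        by (intro sum_list_zero) force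
      then show ?thesis using \<theta>_sandwich[OF zs Y a b, of u c c'] u by simp
    qed
    have "?f (v \<otimes>\<^bsub>MA\<^esub> u \<otimes>\<^bsub>MA\<^esub> w) = 0" if v: "keys v \<subseteq> carrier G" and w: "keys w \<subseteq> carrier G" for v w
      using v
    proof (induction rule: poly_mapping_on_induct)
      case zero
      then show ?case by (simp add: monoid_algebra_mult \<theta>_zero)
    next
      case (add v v')
      then have "v \<otimes>\<^bsub>MA\<^esub> u \<otimes>\<^bsub>MA\<^esub> w \<in> carrier MA" "v' \<otimes>\<^bsub>MA\<^esub> u \<otimes>\<^bsub>MA\<^esub> w \<in> carrier MA"
        using u w by (simp_all add: mult_keys)
      then show ?case using add f(2) by (simp add: monoid_algebra_mult del: monoid_algebra_simps(1))
    next
      case (single a c)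
      show ?case using w
      proof (induction rule: poly_mapping_on_induct)
        case zero
        then show ?case by (simp add: monoid_algebra_mult \<theta>_zero)
      next
        case (add w w')
        then have "single a c \<otimes>\<^bsub>MA\<^esub> u \<otimes>\<^bsub>MA\<^esub> w \<in> carrier MA" "single a c \<otimes>\<^bsub>MA\<^esub> u \<otimes>\<^bsub>MA\<^esub> w' \<in> carrier MA"
          using u single by (simp_all add: mult_keys)
        then show ?case using add f(2) by (simp add: monoid_algebra_mult del: monoid_algebra_simps(1))
      qed (simp add: * single)
    qed
    then show ?thesis using u by (simp add: I_def)
  qed
  have "finite X" by (simp add: X_def)
  moreover have "l \<in> lin_map MA scalars" if "l \<in> \<theta> ` X" for l using that \<theta>_lin by auto
  ultimately have "\<exists>B. finite B \<and> B \<subseteq> carrier MA \<and> (\<forall>v\<in>carrier MA. \<exists>w\<in>carrier MA.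
      (\<forall>l\<in>\<theta> ` X. l w = 0) \<and> (\<exists>b\<in>lin_span MA B. v = w \<oplus>\<^bsub>MA\<^esub> b))"
    by (intro finitely_many_functionals MA.module_axioms finite_imageI)
  then obtain B where B: "finite B" "B \<subseteq> carrier MA"
    and B': "\<forall>v\<in>carrier MA. \<exists>w\<in>carrier MA. (\<forall>l\<in>\<theta> ` X. l w = 0) \<and> (\<exists>b\<in>lin_span MA B. v = w \<oplus>\<^bsub>MA\<^esub> b)"
    by (elim exE conjE)
  have span: "lin_span H B = lin_span MA B"
    by (simp add: lin_span_def submodule_def submodule_axioms_def subgroup_def m_inv_def)
  have "I <+>\<^bsub>MA\<^esub> lin_span MA B = carrier MA"
  proof
    show "I <+>\<^bsub>MA\<^esub> lin_span MA B \<subseteq> carrier MA"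
      using additive_subgroup.a_subset[OF ideal.axioms(1)[OF I(1)]]
        submoduleD(1)[OF lin_span_submodule[OF MA.module_axioms B(2)]] by (rule MA.set_add_closed)
    show "carrier MA \<subseteq> I <+>\<^bsub>MA\<^esub> lin_span MA B"
    proof
      fix v assume "v \<in> carrier MA"
      with B' obtain w b where "w \<in> carrier MA" "\<forall>l\<in>\<theta> ` X. l w = 0" "b \<in> lin_span MA B" "v = w \<oplus>\<^bsub>MA\<^esub> b" by blast
      moreover from this have "w \<in> I" by (intro X) auto
      ultimately show "v \<in> I <+>\<^bsub>MA\<^esub> lin_span MA B" unfolding set_add_def' by blast
    qed
  qed
  then have "finite_codim H I"
    unfolding finite_codim_def using B by (intro exI[of _ B]) (simp add: span set_add_def' del: monoid_algebra_simps(1))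
  then show ?thesis
    using ideal I(2) \<theta>_lin \<theta>_ext by (auto simp: finite_dual_carrier_def lin_map_def simp del: monoid_algebra_simps(1))
qed

lemma lin_map_H: "lin_map H V = lin_map MA V"
  by (simp add: lin_map_def)

lemma finite_dual_carrierD:
  assumes "f \<in> finite_dual_carrier H"
  shows "f \<in> lin_map MA scalars" "f \<in> extensional (carrier MA)"
  using assms by (auto simp: finite_dual_carrier_def lin_map_H)

text \<open>One inclusion rests on \<open>represented\<close>, since a linear functional is
  determined by its values on group elements. The equality allows the finite dual to be treated as
  an image of \<open>K\<close>.\<close>

lemma \<theta>_image: "\<theta> ` carrier K = finite_dual_carrier H"
proof (intro equalityI subsetI)
  fix f assume f: "f \<in> finite_dual_carrier H"
  then obtain h where h: "h \<in> carrier K" "\<And>d. ev h d = f (elt d)" using represented by (auto simp: elt_def)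
  have "f = \<theta> h"
    by (rule functional_eqI[OF finite_dual_carrierD(1)[OF f] \<theta>_lin finite_dual_carrierD(2)[OF f] \<theta>_ext])
      (simp add: h)
  then show "f \<in> \<theta> ` carrier K" using h by simp
qed (auto intro: \<theta>_finite_dual)

lemma finite_dualE:
  assumes "f \<in> finite_dual_carrier H"
  obtains h where "h \<in> carrier K" "f = \<theta> h"
  using assms \<theta>_image by blast

interpretation TMA: k_algebra "tensor MA MA" by (rule k_algebra_tensor[OF MA MA])

text \<open>The comultiplication is diagonal on the basis of group elements, so convolution becomes
  pointwise multiplication there.\<close>

lemma convolution:
  assumes f: "f \<in> lin_map MA scalars" and g: "g \<in> lin_map MA scalars" and u: "u \<in> carrier MA"
  shows "tensor_lift scalars (\<lambda>x y. f x * g y) (comult H u)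
    = lin_ext scalars (\<lambda>a. f (single a 1) * g (single a 1)) u"
proof -
  have bil: "bilinear MA MA scalars (\<lambda>x y. f x * g y)" using f g by (rule bilinear_scalars)
  have a: "single a 1 \<in> carrier MA" if "a \<in> keys u" for a using that u by auto
  have "tensor_lift scalars (\<lambda>x y. f x * g y) (comult H u)
    = lin_ext scalars (\<lambda>a. tensor_lift scalars (\<lambda>x y. f x * g y) (pure MA MA (single a 1) (single a 1))) u"
    unfolding group_hopf_simps
    by (rule lin_map_lin_ext[OF TMA.module_axioms module_scalars tensor_lift_lin_map[OF MA MA module_scalars bil]])
      (intro pure_closed MA a)
  also have "\<dots> = lin_ext scalars (\<lambda>a. f (single a 1) * g (single a 1)) u"
    by (rule lin_ext_cong[OF module_scalars]) (simp, rule tensor_lift_pure[OF MA MA module_scalars bil a a])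
  finally show ?thesis .
qed

lemma \<theta>_eqI: "(\<And>u. u \<in> carrier MA \<Longrightarrow> f u = lin_ext scalars (\<lambda>a. ev h (\<delta> a)) u) \<Longrightarrow> restrict f (carrier H) = \<theta> h"
  by (auto simp: \<theta>_def restrict_def)

lemma \<theta>_hom:
  assumes x: "x \<in> carrier K"
  shows "\<one>\<^bsub>FA\<^esub> = \<theta> \<one>\<^bsub>K\<^esub>" "\<zero>\<^bsub>FA\<^esub> = \<theta> \<zero>\<^bsub>K\<^esub>"
    and "y \<in> carrier K \<Longrightarrow> \<theta> x \<oplus>\<^bsub>FA\<^esub> \<theta> y = \<theta> (x \<oplus>\<^bsub>K\<^esub> y)"
    and "y \<in> carrier K \<Longrightarrow> \<theta> x \<otimes>\<^bsub>FA\<^esub> \<theta> y = \<theta> (x \<otimes>\<^bsub>K\<^esub> y)"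
    and "c \<odot>\<^bsub>FA\<^esub> \<theta> x = \<theta> (c \<odot>\<^bsub>K\<^esub> x)"
proof -
  have z: "ev \<zero>\<^bsub>K\<^esub> d = 0" for d using lin_map_zero[OF K.kmod module_scalars K.ev_lin] by simp
  show "\<one>\<^bsub>FA\<^esub> = \<theta> \<one>\<^bsub>K\<^esub>" "\<zero>\<^bsub>FA\<^esub> = \<theta> \<zero>\<^bsub>K\<^esub>"
    "y \<in> carrier K \<Longrightarrow> \<theta> x \<oplus>\<^bsub>FA\<^esub> \<theta> y = \<theta> (x \<oplus>\<^bsub>K\<^esub> y)" "c \<odot>\<^bsub>FA\<^esub> \<theta> x = \<theta> (c \<odot>\<^bsub>K\<^esub> x)"
    unfolding finite_dual_algebra_simps using x
    by (intro \<theta>_eqI; simp add: z lin_ext_scalars \<theta>_def sum.distrib sum_distrib_left algebra_simps)+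
  show "\<theta> x \<otimes>\<^bsub>FA\<^esub> \<theta> y = \<theta> (x \<otimes>\<^bsub>K\<^esub> y)" if y: "y \<in> carrier K"
    unfolding finite_dual_algebra_simps
  proof (rule \<theta>_eqI)
    fix u assume u: "u \<in> carrier MA"
    have "lin_ext scalars (\<lambda>a. \<theta> x (single a 1) * \<theta> y (single a 1)) u
        = lin_ext scalars (\<lambda>a. ev (x \<otimes>\<^bsub>K\<^esub> y) (\<delta> a)) u"
    proof (rule lin_ext_cong[OF module_scalars])
      fix a assume "a \<in> keys u"
      then have "a \<in> carrier G" using u by auto
      then show "\<theta> x (single a 1) * \<theta> y (single a 1) = ev (x \<otimes>\<^bsub>K\<^esub> y) (\<delta> a)"
        using x y by simp
    qed simp
    then show "tensor_lift scalars (\<lambda>a b. \<theta> x a * \<theta> y b) (comult H u) = lin_ext scalars (\<lambda>a. ev (x \<otimes>\<^bsub>K\<^esub> y) (\<delta> a)) u"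
      using convolution[OF \<theta>_lin \<theta>_lin u] by simp
  qed
qed

text \<open>Closure of the finite dual under its operations is inherited: \<theta> maps
  \<open>K\<close> onto it and respects the operations, convolution included.\<close>

lemma FA: "k_algebra FA"
  by (rule k_algebra_image[OF K.kalg, of \<theta>]) (simp_all add: \<theta>_image \<theta>_hom[OF K.one_closed] \<theta>_hom del: finite_dual_algebra_simps(2-))

lemma FD: "k_algebra FD"
  by (rule k_algebra_image[OF FA, of "\<lambda>x. x"]) simp_all

definition evF :: "(('g \<Rightarrow>\<^sub>0 'k) \<Rightarrow> 'k) \<Rightarrow> 'd \<Rightarrow> 'k" where "evF f d = f (elt d)"

lemma evF_\<theta> [simp]: "evF (\<theta> h) = ev h"
  by (simp add: evF_def fun_eq_iff)

lemma apply_lin: "a \<in> carrier MA \<Longrightarrow> (\<lambda>f. f a) \<in> lin_map FA scalars"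
  by (rule lin_mapI) simp_all

lemma evF_embedding: "linear_embedding FA evF"
  unfolding linear_embedding_def evF_def[abs_def]
proof (intro conjI allI apply_lin elt_closed inj_onI)
  fix f g assume "f \<in> carrier FA" "g \<in> carrier FA" "(\<lambda>d. f (elt d)) = (\<lambda>d. g (elt d))"
  then show "f = g" by (intro functional_eqI) (auto simp: finite_dual_carrierD fun_eq_iff)
qed

text \<open>Existence comes from the element \<open>k\<close> that represents \<open>f\<close>: a
  splitting of \<open>k\<close> gives a tensor with the required bilinear form. Uniqueness holds
  because values on pairs of group elements already determine a tensor over the finite dual.\<close>

lemma finite_dual_comult:
  assumes f: "f \<in> finite_dual_carrier H"
  shows "finite_dual_comult H f \<in> carrier (tensor FA FA)"
    and "tensor_eval evF evF (finite_dual_comult H f) (d, e) = f (elt d \<otimes>\<^bsub>MA\<^esub> elt e)"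
proof -
  obtain k where k: "k \<in> carrier K" "f = \<theta> k" using f by (rule finite_dualE)
  obtain zs where zs: "set zs \<subseteq> carrier K \<times> carrier K"
    "\<And>d e. ev k (d \<otimes>\<^bsub>D\<^esub> e) = (\<Sum>(p, q)\<leftarrow>zs. ev p d * ev q e)" using comult_sum[OF k(1)] by metis
  let ?ws = "map (\<lambda>(p, q). (\<theta> p, \<theta> q)) zs"
  let ?t = "tensor_sum FA FA ?ws"
  let ?spec = "\<lambda>t. \<forall>a\<in>carrier H. \<forall>b\<in>carrier H. tensor_lift scalars (\<lambda>p q. p a * q b) t = f (a \<otimes>\<^bsub>H\<^esub> b)"
  have ws: "set ?ws \<subseteq> carrier FA \<times> carrier FA" using zs(1) \<theta>_finite_dual by auto
  have t: "?t \<in> carrier (tensor FA FA)" by (rule tensor_sum_closed[OF FA FA ws])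
  note lin = lin_mapD[OF \<theta>_lin]
  have sum_add: "(\<Sum>(p, q)\<leftarrow>xs. (F p + F' p) * F'' q) = (\<Sum>(p, q)\<leftarrow>xs. F p * F'' q) + (\<Sum>(p, q)\<leftarrow>xs. F' p * F'' q)"
    "(\<Sum>(p, q)\<leftarrow>xs. F'' p * (F q + F' q)) = (\<Sum>(p, q)\<leftarrow>xs. F'' p * F q) + (\<Sum>(p, q)\<leftarrow>xs. F'' p * F' q)"
    "(\<Sum>(p, q)\<leftarrow>xs. (c * F p) * (c' * F' q)) = c * c' * (\<Sum>(p, q)\<leftarrow>xs. F p * F' q)"
    for xs :: "('a \<times> 'a) list" and F F' F'' :: "'a \<Rightarrow> 'k" and c c'
    by (induction xs) (auto simp: algebra_simps)
  have sm: "\<theta> r (single a x) = x * ev r (\<delta> a)" if "a \<in> carrier G" for r a x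
    using that by (simp add: \<theta>_def lin_ext_single[OF module_scalars])
  \<comment> \<open>Both sides are bilinear in \<open>a\<close> and \<open>b\<close>, so the
    splitting on pairs of group elements extends to the whole algebra.\<close>
  have bil: "(\<Sum>(p, q)\<leftarrow>zs. \<theta> p a * \<theta> q b) = \<theta> k (a \<otimes>\<^bsub>MA\<^esub> b)"
    if a: "keys a \<subseteq> carrier G" and b: "keys b \<subseteq> carrier G" for a b
    using a
  proof (induction rule: poly_mapping_on_induct)
    case zero
    then show ?case by (simp add: monoid_algebra_mult split_beta \<theta>_zero)
  next
    case (add a a')
    then show ?case using lin(2)[of a a'] lin(2)[of "a \<otimes>\<^bsub>MA\<^esub> b" "a' \<otimes>\<^bsub>MA\<^esub> b"] b
      by (simp add: monoid_algebra_mult sum_add mult_keys)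
  next
    case (single x c)
    show ?case using b
    proof (induction rule: poly_mapping_on_induct)
      case zero
      then show ?case by (simp add: monoid_algebra_mult split_beta \<theta>_zero)
    next
      case (add b b')
      then show ?case using lin(2)[of b b'] lin(2)[of "single x c \<otimes>\<^bsub>MA\<^esub> b" "single x c \<otimes>\<^bsub>MA\<^esub> b'"] single
        by (simp add: monoid_algebra_mult sum_add mult_keys)
    next
      case (single y c')
      have "\<delta> (x \<otimes>\<^bsub>G\<^esub> y) = \<delta> x \<otimes>\<^bsub>D\<^esub> \<delta> y"
        using single \<open>x \<in> carrier G\<close> by (metis \<gamma>_mult \<gamma>_simps(2,3))
      then show ?case using single \<open>x \<in> carrier G\<close> by (simp add: monoid_algebra_mult sm sum_add zs(2))
    qed
  qed
  have spec: "?spec ?t"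
  proof (intro ballI)
    fix a b assume a: "a \<in> carrier H" and b: "b \<in> carrier H"
    have "tensor_lift scalars (\<lambda>p q. p a * q b) ?t = (\<Sum>(p, q)\<leftarrow>?ws. p a * q b)"
      using tensor_eval_sum[OF FA FA _ _ ws, of "\<lambda>p _. p a" "\<lambda>q _. q b"] apply_lin a b by (simp add: tensor_eval_def)
    also have "\<dots> = (\<Sum>(p, q)\<leftarrow>zs. \<theta> p a * \<theta> q b)" by (simp add: split_def comp_def)
    finally show "tensor_lift scalars (\<lambda>p q. p a * q b) ?t = f (a \<otimes>\<^bsub>H\<^esub> b)" using bil a b k by simp
  qed
  have eval: "tensor_eval evF evF t (d, e) = f (elt d \<otimes>\<^bsub>MA\<^esub> elt e)" if "?spec t" for t d e
    using that elt_closed[of d] elt_closed[of e] by (simp add: tensor_eval_def evF_def del: monoid_algebra_simps(1))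
  have eq: "finite_dual_comult H f = ?t"
    unfolding finite_dual_comult_def
  proof (rule the_equality)
    fix t assume t': "t \<in> carrier (tensor FA FA) \<and> ?spec t"
    show "t = ?t"
    proof (rule linear_embeddingD(2)[OF linear_embedding_tensor[OF FA FA evF_embedding evF_embedding]])
      show "tensor_eval evF evF t p = tensor_eval evF evF ?t p" for p
        using eval[OF spec] eval[of t] t' by (cases p) simp
    qed (use t t' in auto)
  qed (use t spec in auto)
  show "finite_dual_comult H f \<in> carrier (tensor FA FA)" using t eq by simp
  show "tensor_eval evF evF (finite_dual_comult H f) (d, e) = f (elt d \<otimes>\<^bsub>MA\<^esub> elt e)" using eval[OF spec] eq by simp
qed

theorem function_hopf_finite_dual: "function_hopf FD D evF"
proof (intro function_hopf.intro function_hopf_axioms.intro FD K.G.group_axioms K.carrier_G)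
  have tens: "tensor FD FD = tensor FA FA" by (rule tensor_cong) simp_all
  show "inj_on evF (carrier FD)" using evF_embedding by (simp add: linear_embedding_def)
  show "(\<lambda>f. evF f d) \<in> alg_hom FD scalars" for d
  proof (rule alg_homI)
    show "(\<lambda>f. evF f d) \<in> lin_map FD scalars"
      using linear_embeddingD(1)[OF evF_embedding, of d] by (simp add: lin_map_def)
    show "evF \<one>\<^bsub>FD\<^esub> d = \<one>\<^bsub>scalars\<^esub>"
      using \<theta>_hom(1)[OF K.one_closed] by (simp del: finite_dual_algebra_simps)
    fix f g assume "f \<in> carrier FD" "g \<in> carrier FD"
    then obtain x y where "x \<in> carrier K" "f = \<theta> x" "y \<in> carrier K" "g = \<theta> y" by (auto elim!: finite_dualE)
    then show "evF (f \<otimes>\<^bsub>FD\<^esub> g) d = evF f d \<otimes>\<^bsub>scalars\<^esub> evF g d"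
      using \<theta>_hom(4) by (simp del: finite_dual_algebra_simps)
  qed
  fix f assume "f \<in> carrier FD"
  then have f: "f \<in> finite_dual_carrier H" by simp
  show "comult FD f \<in> carrier (tensor FD FD)" using finite_dual_comult(1)[OF f] by (simp add: tens)
  show "tensor_eval evF evF (comult FD f) (d, e) = evF f (d \<otimes>\<^bsub>D\<^esub> e)" for d e
    using finite_dual_comult(2)[OF f, of d e] by (simp add: evF_def elt_def monoid_algebra_mult \<gamma>_mult)
  show "counit FD f = evF f \<one>\<^bsub>D\<^esub>" by (simp add: evF_def elt_def \<gamma>_one)
  obtain k where k: "k \<in> carrier K" "f = \<theta> k" using f by (rule finite_dualE)
  \<comment> \<open>Composition with the antipode inverts group elements, which is what
    \<open>antipode K\<close> does to values; the result therefore stays in the finite dual.\<close>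
  have S: "antipode FD f = \<theta> (antipode K k)"
    unfolding finite_dual_simps
  proof (rule \<theta>_eqI)
    fix u assume u: "u \<in> carrier MA"
    have "f (antipode H u) = lin_ext scalars (\<lambda>a. f (single (inv\<^bsub>G\<^esub> a) 1)) u"
      unfolding group_hopf_simps using u
      by (intro lin_map_lin_ext[OF MA.module_axioms module_scalars finite_dual_carrierD(1)[OF f]]) auto
    also have "\<dots> = lin_ext scalars (\<lambda>a. ev (antipode K k) (\<delta> a)) u"
    proof (rule lin_ext_cong[OF module_scalars])
      fix a assume "a \<in> keys u"
      then have a: "a \<in> carrier G" using u by auto
      then have "\<delta> (inv\<^bsub>G\<^esub> a) = inv\<^bsub>D\<^esub> (\<delta> a)" by (metis \<gamma>_inv \<gamma>_simps(2,3))
      then show "f (single (inv\<^bsub>G\<^esub> a) 1) = ev (antipode K k) (\<delta> a)"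
        using a k by (simp add: K.antipode_eval)
    qed simp
    finally show "f (antipode H u) = lin_ext scalars (\<lambda>a. ev (antipode K k) (\<delta> a)) u" .
  qed
  then show "antipode FD f \<in> carrier FD" using k \<theta>_finite_dual K.antipode_closed by simp
  show "evF (antipode FD f) d = evF f (inv\<^bsub>D\<^esub> d)" for d unfolding S using k by (simp add: K.antipode_eval)
qed

theorem finite_dual_iso: "hopf_algebra FD \<and> (\<exists>f. f \<in> hopf_iso FD K)"
proof
  show "hopf_algebra FD" by (rule function_hopf.hopf[OF function_hopf_finite_dual])
  have "evF ` carrier FD = ev ` carrier K" by (simp add: \<theta>_image[symmetric] image_image)
  then show "\<exists>f. f \<in> hopf_iso FD K"
    by (rule function_hopf_iso[OF function_hopf_finite_dual K.function_hopf_axioms])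
qed

end

section \<open>Linear recurrences\<close>

text \<open>The span of the sequences i^n c^i, in a basis adapted to differences. Sequences run over
  all integers, hence \<open>c \<noteq> 0\<close>: negative powers must be genuine inverses.\<close>

inductive_set exp_poly :: "(int \<Rightarrow> 'k::field_char_0) set" where
  basis: "c \<noteq> 0 \<Longrightarrow> (\<lambda>i. (of_int i gchoose n) * c powi i) \<in> exp_poly"
| add: "\<lbrakk>s \<in> exp_poly; t \<in> exp_poly\<rbrakk> \<Longrightarrow> (\<lambda>i. s i + t i) \<in> exp_poly"
| smult: "s \<in> exp_poly \<Longrightarrow> (\<lambda>i. a * s i) \<in> exp_poly"

lemma exp_poly_diff:
  assumes "s \<in> exp_poly" "t \<in> exp_poly"
  shows "(\<lambda>i. s i - t i) \<in> exp_poly"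
  using exp_poly.add[OF assms(1) exp_poly.smult[OF assms(2), of "- 1"]] by simp

lemma exp_poly_zero: "(\<lambda>i. 0) \<in> exp_poly"
  using exp_poly.smult[OF exp_poly.basis[of 1 0], of 0] by simp

lemma gbinomial_int_Suc:
  "(of_int (i + 1) gchoose Suc n) = (of_int i gchoose n) + (of_int i gchoose Suc n :: 'k::field_char_0)"
  using gbinomial_Suc_Suc[of "of_int i :: 'k" n] by simp

text \<open>Pascal's rule at \<open>i - 1\<close> expresses the shifted binomial of index
  \<open>Suc n\<close> by the unshifted one and the shifted one of index \<open>n\<close>. This
  settles the root 0 of a characteristic polynomial, where a first-order step only says that the
  shifted sequence has the right form.\<close>

lemma exp_poly_unshift: "s \<in> exp_poly \<Longrightarrow> (\<lambda>i. s (i - 1)) \<in> exp_poly"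
proof (induction rule: exp_poly.induct)
  case (basis c n)
  show ?case
  proof (induction n)
    case 0
    have "(\<lambda>i. c powi (i - 1)) = (\<lambda>i. inverse c * ((of_int i gchoose 0) * c powi i))"
      using basis by (simp add: power_int_diff field_simps)
    then show ?case using exp_poly.smult[OF exp_poly.basis[OF basis, of 0]] by simp
  next
    case (Suc n)
    have "(\<lambda>i. (of_int (i - 1) gchoose Suc n) * c powi (i - 1))
      = (\<lambda>i. inverse c * ((of_int i gchoose Suc n) * c powi i) - (of_int (i - 1) gchoose n) * c powi (i - 1))"
    proof
      fix i
      show "(of_int (i - 1) gchoose Suc n) * c powi (i - 1)
        = inverse c * ((of_int i gchoose Suc n) * c powi i) - (of_int (i - 1) gchoose n) * c powi (i - 1)"
        using basis gbinomial_int_Suc[of "i - 1" n, where 'k = 'a] by (simp add: power_int_diff field_simps)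
    qed
    then show ?case using exp_poly_diff[OF exp_poly.smult[OF exp_poly.basis[OF basis, of "Suc n"]] Suc] by simp
  qed
qed (auto intro: exp_poly.intros)

text \<open>For d \<noteq> c the operator multiplies a basis sequence by d - c up to a term of lower
  index, which induction removes. For d = c that leading part is lost, and the solution has an index
  one higher, as in resonance.\<close>

lemma exp_poly_particular:
  fixes c :: "'k::field_char_0"
  assumes "s \<in> exp_poly" and c: "c \<noteq> 0"
  shows "\<exists>t\<in>exp_poly. \<forall>i. t (i + 1) - c * t i = s i"
  using assms(1)
proof (induction rule: exp_poly.induct)
  case (basis d n)
  have cancel: "e * (inverse e * x - c * (inverse e * y)) = x - c * y" if "e \<noteq> 0" for e x y
    using that by (simp add: field_simps)
  have powi_Suc: "d powi (i + 1) = d * d powi i" for i using basis by (simp add: power_int_add_1')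
  show ?case
  proof (cases "d = c")
    case True
    \<comment> \<open>The operator sends the basis sequence of index \<open>Suc n\<close> to
      \<open>c\<close> times the one of index \<open>n\<close>, whence the factor
      \<open>inverse c\<close>.\<close>
    let ?t = "\<lambda>i. inverse c * ((of_int i gchoose Suc n) * c powi i)"
    have "?t (i + 1) - c * ?t i = (of_int i gchoose n) * d powi i" for i
      using c True unfolding gbinomial_int_Suc powi_Suc[unfolded True] by (simp add: field_simps)
    then show ?thesis by (intro bexI[of _ ?t] exp_poly.smult exp_poly.basis c allI)
  next
    case False
    show ?thesis
    proof (induction n)
      case 0
      let ?t = "\<lambda>i. inverse (d - c) * ((of_int i gchoose 0) * d powi i)"
      have "?t (i + 1) - c * ?t i = (of_int i gchoose 0) * d powi i" for i
      proof -
        have "(d - c) * (?t (i + 1) - c * ?t i) = (d - c) * ((of_int i gchoose 0) * d powi i)"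
          using False by (subst cancel) (auto simp: powi_Suc left_diff_distrib)
        then show ?thesis using False by simp
      qed
      then show ?case by (intro bexI[of _ ?t] exp_poly.smult exp_poly.basis basis allI)
    next
      case (Suc n)
      then obtain t where t: "t \<in> exp_poly" "\<And>i. t (i + 1) - c * t i = (of_int i gchoose n) * d powi i" by blast
      \<comment> \<open>On the first term the operator yields (d - c) times the wanted sequence plus
        \<open>d\<close> times the one of index \<open>n\<close>; the latter is what
        \<open>d * t i\<close> takes away.\<close>
      let ?t = "\<lambda>i. inverse (d - c) * ((of_int i gchoose Suc n) * d powi i - d * t i)"
      have "?t (i + 1) - c * ?t i = (of_int i gchoose Suc n) * d powi i" for i
      proof -
        have "(d - c) * (?t (i + 1) - c * ?t i) = (of_int (i + 1) gchoose Suc n) * d powi (i + 1)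
            - c * ((of_int i gchoose Suc n) * d powi i) - d * (t (i + 1) - c * t i)"
          using False by (subst cancel) (auto simp: algebra_simps)
        also have "\<dots> = (d - c) * ((of_int i gchoose Suc n) * d powi i)"
          unfolding t(2) gbinomial_int_Suc powi_Suc by (simp add: algebra_simps)
        finally show ?thesis using False by simp
      qed
      moreover have "?t \<in> exp_poly"
        by (intro exp_poly.smult exp_poly_diff exp_poly.basis basis t)
      ultimately show ?case by (intro bexI[of _ ?t] allI)
    qed
  qed
next
  case (add s t)
  then obtain s' t' where "s' \<in> exp_poly" "\<And>i. s' (i + 1) - c * s' i = s i"
    "t' \<in> exp_poly" "\<And>i. t' (i + 1) - c * t' i = t i" by blast
  then show ?case by (intro bexI[of _ "\<lambda>i. s' i + t' i"] exp_poly.add) (auto simp: algebra_simps)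
next
  case (smult s a)
  then obtain t where t: "t \<in> exp_poly" "\<And>i. t (i + 1) - c * t i = s i" by blast
  have "a * t (i + 1) - c * (a * t i) = a * s i" for i
    unfolding t(2)[symmetric] by (simp add: algebra_simps)
  then show ?case using t by (intro bexI[of _ "\<lambda>i. a * t i"] exp_poly.smult) auto
qed

text \<open>Two sequences with the same first-order difference differ by a solution of r(i + 1) = c
  r(i), which is geometric when c \<noteq> 0. For \<open>c = 0\<close> the hypothesis describes the
  shifted sequence.\<close>

lemma exp_poly_first_order:
  fixes c :: "'k::field_char_0"
  assumes "(\<lambda>i. s (i + 1) - c * s i) \<in> exp_poly"
  shows "s \<in> exp_poly"
proof (cases "c = 0")
  case True
  then show ?thesis using exp_poly_unshift[OF assms] by simp
next
  case False
  obtain t where t: "t \<in> exp_poly" "\<And>i. t (i + 1) - c * t i = s (i + 1) - c * s i"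
    using exp_poly_particular[OF assms False] by blast
  define r where "r i = s i - t i" for i
  have step: "r (i + 1) = c * r i" for i using t(2)[of i] by (simp add: r_def algebra_simps)
  \<comment> \<open>Over the integers the recursion must also be followed downwards, which divides
    by \<open>c\<close>.\<close>
  have "r i = r 0 * ((of_int i gchoose 0) * c powi i)" for i
  proof (induction i rule: int_induct[of _ 0])
    case (step1 i)
    then show ?case using False by (simp add: step power_int_add_1 mult_ac)
  next
    case (step2 i)
    have "c * r (i - 1) = r i" using step[of "i - 1"] by simp
    then show ?case using step2 False by (simp add: power_int_diff field_simps)
  qed simp
  then have "r = (\<lambda>i. r 0 * ((of_int i gchoose 0) * c powi i))" by (rule ext)
  also have "\<dots> \<in> exp_poly" by (intro exp_poly.smult exp_poly.basis False)
  finally have "r \<in> exp_poly" .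
  from exp_poly.add[OF this t(1)] show ?thesis by (simp add: r_def)
qed

text \<open>If P = (X - c) Q, the sequence s(i + 1) - c s(i) satisfies the recurrence of
  \<open>Q\<close>. A root \<open>c\<close> exists because the field is algebraically closed, and it
  may be 0.\<close>

theorem exp_poly_recurrence:
  fixes P :: "'k::{alg_closed_field, field_char_0} poly"
  assumes "P \<noteq> 0" "\<And>i. (\<Sum>l\<le>degree P. coeff P l * s (i + int l)) = 0"
  shows "s \<in> exp_poly"
  using assms
proof (induction "degree P" arbitrary: P s)
  case 0
  then have "coeff P 0 \<noteq> 0" by (metis leading_coeff_0_iff)
  then have "s i = 0" for i using 0(1) 0(3)[of i] by simp
  then have "s = (\<lambda>i. 0)" by (rule ext)
  then show ?case using exp_poly_zero by simp
next
  case (Suc n)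
  then obtain c where "poly P c = 0" using alg_closed_imp_poly_has_root[of P] by auto
  then obtain Q where P: "P = [:- c, 1:] * Q" unfolding poly_eq_0_iff_dvd by (elim dvdE)
  have Q: "Q \<noteq> 0" using Suc(3) P by auto
  then have deg: "degree P = Suc (degree Q)" unfolding P by (subst degree_mult_eq) auto
  have coeff: "coeff P l = (case l of 0 \<Rightarrow> 0 | Suc m \<Rightarrow> coeff Q m) - c * coeff Q l" for l
    by (simp add: P coeff_pCons split: nat.split)
  have "(\<Sum>l\<le>degree Q. coeff Q l * (s (i + int l + 1) - c * s (i + int l))) = 0" for i
  proof -
    have "(\<Sum>l\<le>degree P. coeff P l * s (i + int l))
      = (\<Sum>l\<le>Suc (degree Q). (case l of 0 \<Rightarrow> 0 | Suc m \<Rightarrow> coeff Q m) * s (i + int l))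
        - (\<Sum>l\<le>Suc (degree Q). c * coeff Q l * s (i + int l))"
      unfolding deg coeff by (simp add: left_diff_distrib sum_subtractf del: sum.atMost_Suc)
    also have "(\<Sum>l\<le>Suc (degree Q). (case l of 0 \<Rightarrow> 0 | Suc m \<Rightarrow> coeff Q m) * s (i + int l))
      = (\<Sum>l\<le>degree Q. coeff Q l * s (i + int l + 1))"
      by (subst sum.atMost_Suc_shift) (simp add: add_ac)
    also have "(\<Sum>l\<le>Suc (degree Q). c * coeff Q l * s (i + int l)) = (\<Sum>l\<le>degree Q. c * coeff Q l * s (i + int l))"
      by (simp add: coeff_eq_0)
    finally show ?thesis using Suc(4)[of i] by (simp add: algebra_simps sum_subtractf)
  qed
  then have "(\<lambda>i. s (i + 1) - c * s i) \<in> exp_poly"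
    using Suc(2) deg Q by (intro Suc(1)[of Q]) auto
  then show ?case by (rule exp_poly_first_order)
qed

section \<open>Functionals killing an ideal of finite codimension\<close>

lemma poly_sum_superset:
  fixes F :: "nat \<Rightarrow> 'a::zero \<Rightarrow> 'b::comm_monoid_add"
  assumes "degree P \<le> N" "\<And>l. F l 0 = 0"
  shows "(\<Sum>l\<le>degree P. F l (coeff P l)) = (\<Sum>l\<le>N. F l (coeff P l))"
  using assms by (intro sum.mono_neutral_left) (auto simp: coeff_eq_0)

text \<open>Instead of counting dimensions, the induction removes one spanning vector at a time:
  \<open>b\<close> is added to \<open>N\<close>, and then eliminated between two polynomials
  obtained by induction. That \<open>N\<close> and \<open>B\<close> span is phrased through
  submodules, a form that survives enlarging \<open>N\<close>.\<close>

lemma finite_codim_annihilator: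
  fixes L :: "'k::field poly \<Rightarrow> 'v"
  assumes V: "module scalars V" and "finite B" "B \<subseteq> carrier V" "submodule N scalars V"
    and "\<And>M. \<lbrakk>submodule M scalars V; N \<subseteq> M; B \<subseteq> M\<rbrakk> \<Longrightarrow> carrier V \<subseteq> M"
    and "\<And>p. L p \<in> carrier V" "\<And>p q. L (p + q) = L p \<oplus>\<^bsub>V\<^esub> L q" "\<And>c p. L (Polynomial.smult c p) = c \<odot>\<^bsub>V\<^esub> L p"
  shows "\<exists>p. p \<noteq> 0 \<and> L p \<in> N"
  using assms(2-)
proof (induction arbitrary: N L rule: finite_induct)
  case empty
  have "carrier V \<subseteq> N" using empty(2) by (intro empty(3)) auto
  then have "L 1 \<in> N" using empty(4) by blast
  then show ?case by (intro exI[of _ 1]) simp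
next
  case (insert b B)
  interpret V: module scalars V by (rule V)
  have sm [simp]: "x \<in> carrier V \<Longrightarrow> c \<odot>\<^bsub>V\<^esub> x \<in> carrier V" for c x using V.smult_closed[of c x] by simp
  note N = submoduleD[OF insert.prems(2)] and L = insert.prems(4-6)
  have Nc: "x \<in> N \<Longrightarrow> x \<in> carrier V" for x using N(1) by blast
  have b: "b \<in> carrier V" using insert.prems by simp
  note smr = V.smult_r_distr[simplified] and sml = V.smult_l_distr[simplified]
    and sm0 = V.smult_l_null[simplified] and sma = V.smult_assoc1[simplified]
  define N' where "N' = {x \<oplus>\<^bsub>V\<^esub> c \<odot>\<^bsub>V\<^esub> b | x c. x \<in> N}"
  have N'I: "x \<oplus>\<^bsub>V\<^esub> c \<odot>\<^bsub>V\<^esub> b \<in> N'" if "x \<in> N" for x c using that by (auto simp: N'_def)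
  have N'E: "\<exists>x c. x \<in> N \<and> y = x \<oplus>\<^bsub>V\<^esub> c \<odot>\<^bsub>V\<^esub> b" if "y \<in> N'" for y using that by (auto simp: N'_def)
  have N': "submodule N' scalars V"
  proof (rule V.submodule_scaleI)
    show "N' \<subseteq> carrier V" using Nc b by (auto simp: N'_def)
    show "\<zero>\<^bsub>V\<^esub> \<in> N'" using N'I[OF N(2), of 0] b by (simp add: sm0)
    show "y \<oplus>\<^bsub>V\<^esub> z \<in> N'" if y: "y \<in> N'" and z: "z \<in> N'" for y z
    proof -
      obtain x c x' c' where x: "x \<in> N" "x' \<in> N" "y = x \<oplus>\<^bsub>V\<^esub> c \<odot>\<^bsub>V\<^esub> b" "z = x' \<oplus>\<^bsub>V\<^esub> c' \<odot>\<^bsub>V\<^esub> b"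
        using N'E[OF y] N'E[OF z] by blast
      then have "y \<oplus>\<^bsub>V\<^esub> z = (x \<oplus>\<^bsub>V\<^esub> x') \<oplus>\<^bsub>V\<^esub> (c + c') \<odot>\<^bsub>V\<^esub> b"
        using Nc b by (simp add: sml V.M.a_ac)
      then show ?thesis using N'I N(3) x by simp
    qed
    show "d \<odot>\<^bsub>V\<^esub> y \<in> N'" if y: "y \<in> N'" for d y
    proof -
      obtain x c where x: "x \<in> N" "y = x \<oplus>\<^bsub>V\<^esub> c \<odot>\<^bsub>V\<^esub> b" using N'E[OF y] by blast
      then have "d \<odot>\<^bsub>V\<^esub> y = d \<odot>\<^bsub>V\<^esub> x \<oplus>\<^bsub>V\<^esub> (d * c) \<odot>\<^bsub>V\<^esub> b" using Nc b by (simp add: smr sma)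
      then show ?thesis using N'I N(4) x by simp
    qed
  qed
  have "N \<subseteq> N'" using N'I[of _ 0] Nc b by (auto simp: sm0)
  have "b \<in> N'" using N'I[OF N(2), of 1] b V.smult_one by simp
  have top: "carrier V \<subseteq> M" if "submodule M scalars V" "N' \<subseteq> M" "B \<subseteq> M" for M
    using that \<open>N \<subseteq> N'\<close> \<open>b \<in> N'\<close> by (intro insert.prems(3)) auto
  have B: "B \<subseteq> carrier V" using insert.prems by simp
  obtain p where p: "p \<noteq> 0" "L p \<in> N'" using insert.IH[OF B N' top L] by blast
  \<comment> \<open>This factor makes the degree of \<open>q * ?X\<close> exceed that of
    \<open>p\<close>, so that adding a multiple of \<open>p\<close> cannot give zero.\<close>
  let ?X = "monom 1 (Suc (degree p)) :: 'k poly"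
  obtain q where q: "q \<noteq> 0" "L (q * ?X) \<in> N'"
    using insert.IH[OF B N' top, of "\<lambda>q. L (q * ?X)"] L by (auto simp: distrib_right)
  obtain x c where x: "x \<in> N" "L p = x \<oplus>\<^bsub>V\<^esub> c \<odot>\<^bsub>V\<^esub> b" using N'E[OF p(2)] by blast
  obtain y d where y: "y \<in> N" "L (q * ?X) = y \<oplus>\<^bsub>V\<^esub> d \<odot>\<^bsub>V\<^esub> b" using N'E[OF q(2)] by blast
  show ?case
  proof (cases "c = 0")
    case True
    then have "L p = x" using x b Nc by (simp add: sm0)
    then show ?thesis using x p by auto
  next
    case False
    \<comment> \<open>The multiple of \<open>p\<close> is chosen so that the components along
      \<open>b\<close> cancel.\<close>
    let ?r = "q * ?X + Polynomial.smult (- (d / c)) p"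
    have "L ?r = (y \<oplus>\<^bsub>V\<^esub> d \<odot>\<^bsub>V\<^esub> b) \<oplus>\<^bsub>V\<^esub> (- (d / c)) \<odot>\<^bsub>V\<^esub> (x \<oplus>\<^bsub>V\<^esub> c \<odot>\<^bsub>V\<^esub> b)"
      by (simp only: L x y)
    also have "\<dots> = (y \<oplus>\<^bsub>V\<^esub> d \<odot>\<^bsub>V\<^esub> b) \<oplus>\<^bsub>V\<^esub> ((- (d / c)) \<odot>\<^bsub>V\<^esub> x \<oplus>\<^bsub>V\<^esub> (- d) \<odot>\<^bsub>V\<^esub> b)"
      using False Nc[OF x(1)] b by (simp add: smr sma[symmetric])
    also have "\<dots> = (y \<oplus>\<^bsub>V\<^esub> (- (d / c)) \<odot>\<^bsub>V\<^esub> x) \<oplus>\<^bsub>V\<^esub> (d \<odot>\<^bsub>V\<^esub> b \<oplus>\<^bsub>V\<^esub> (- d) \<odot>\<^bsub>V\<^esub> b)"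
      using Nc[OF x(1)] Nc[OF y(1)] b by (simp add: V.M.a_ac)
    also have "d \<odot>\<^bsub>V\<^esub> b \<oplus>\<^bsub>V\<^esub> (- d) \<odot>\<^bsub>V\<^esub> b = \<zero>\<^bsub>V\<^esub>" using b sml[of b d "-d"] by (simp add: sm0)
    finally have "L ?r = y \<oplus>\<^bsub>V\<^esub> (- (d / c)) \<odot>\<^bsub>V\<^esub> x" using Nc[OF x(1)] Nc[OF y(1)] by simp
    then have "L ?r \<in> N" using N(3,4) x y by simp
    moreover have "degree (q * ?X) > degree p" using q by (subst degree_mult_eq) (auto simp: degree_monom_eq)
    then have "?r \<noteq> 0" by (metis add_eq_0_iff degree_minus degree_smult_le not_le smult_minus_left)
    ultimately show ?thesis by blast
  qed
qed

text \<open>The ideal contains a nonzero polynomial \<open>p\<close> evaluated at \<open>g\<close>,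
  which is \<open>L p\<close>. Multiplication by \<open>g\<^sup>i\<close> on the left and
  \<open>x\<^sup>j\<close> on the right keeps it in the ideal, and applying \<open>f\<close> gives a
  recurrence in \<open>i\<close> over all integers, with coefficients that do not depend on
  \<open>i\<close>.\<close>

lemma finite_dual_exp_poly:
  fixes f :: "(dihedral_gen word set \<Rightarrow>\<^sub>0 'k::{alg_closed_field, field_char_0}) \<Rightarrow> 'k"
  assumes f: "f \<in> finite_dual_carrier (group_hopf infinite_dihedral)"
  shows "(\<lambda>i. f (single (dih_elt (i, j)) 1)) \<in> exp_poly"
proof -
  interpret G: group infinite_dihedral by (rule group_infinite_dihedral)
  let ?A = "monoid_algebra infinite_dihedral :: ('k, _) module"
  let ?H = "group_hopf infinite_dihedral :: ('k, _) hopf"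
  have A: "k_algebra ?A" by (rule k_algebra_monoid_algebra) (rule G.monoid_axioms)
  have H: "k_algebra ?H" by (rule k_algebra_image[OF A, of "\<lambda>x. x"]) simp_all
  interpret A: k_algebra ?A by (rule A)
  interpret H: k_algebra ?H by (rule H)
  have closed [simp]: "dih_elt d \<in> carrier infinite_dihedral" for d
    using dih_elt_iso by (auto simp: iso_def hom_def)
  have mult: "dih_elt d \<otimes>\<^bsub>infinite_dihedral\<^esub> dih_elt e = dih_elt (d \<otimes>\<^bsub>dih\<^esub> e)" for d e
    using dih_elt_iso by (simp add: iso_def hom_def del: dih_simps(2) split_paired_All)
  obtain I where lin: "f \<in> lin_map ?A scalars" and I: "ideal I ?H" "finite_codim ?H I" and kill: "\<And>u. u \<in> I \<Longrightarrow> f u = 0"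
    using f by (auto simp: finite_dual_carrier_def lin_map_def)
  interpret I: ideal I ?H by (rule I(1))
  have sub: "submodule I scalars ?H"
    by (rule H.submodule_scaleI) (use I.a_subset I.zero_closed I.a_closed k_ideal_smult[OF H I(1)] in auto)
  obtain B where B: "finite B" "B \<subseteq> carrier ?H" "I <+>\<^bsub>?H\<^esub> lin_span ?H B = carrier ?H"
    using I(2) by (auto simp: finite_codim_def)
  have top: "carrier ?H \<subseteq> M" if M: "submodule M scalars ?H" "I \<subseteq> M" "B \<subseteq> M" for M
  proof -
    have "lin_span ?H B \<subseteq> M" by (rule lin_span_minimal[OF M(1,3)])
    then show ?thesis unfolding B(3)[symmetric] set_add_def'
      using submoduleD(3)[OF M(1)] M(2) by blast
  qed
  define e where "e i j = single (dih_elt (i, j)) (1 :: 'k)" for i j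
  define L where "L p = (\<Sum>l\<le>degree p. single (dih_elt (int l, False)) (coeff p l))" for p :: "'k poly"
  have L: "L p = (\<Sum>l\<le>N. single (dih_elt (int l, False)) (coeff p l))" if "degree p \<le> N" for p N
    unfolding L_def using that by (rule poly_sum_superset) simp
  have sum_closed: "keys (\<Sum>l\<le>N. single (dih_elt (int l, False)) (F l)) \<subseteq> carrier infinite_dihedral"
    for N :: nat and F :: "nat \<Rightarrow> 'k"
    by (induction N) (simp_all add: keys_add_subset)
  have Lc: "L p \<in> carrier ?H" for p using sum_closed by (simp add: L_def)
  have L_add: "L (p + q) = L p \<oplus>\<^bsub>?H\<^esub> L q" for p q
    using degree_add_le_max[of p q]
    by (simp add: L[of _ "max (degree p) (degree q)"] single_add sum.distrib)
  have L_smult: "L (Polynomial.smult c p) = c \<odot>\<^bsub>?H\<^esub> L p" for c p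
  proof -
    have "Poly_Mapping.map ((*) c) (\<Sum>l\<le>N. single (dih_elt (int l, False)) (F l))
      = (\<Sum>l\<le>N. single (dih_elt (int l, False)) (c * F l))" for N :: nat and F
      by (rule poly_mapping_eqI) (simp add: lookup_sum sum_distrib_left lookup_single when_def if_distrib cong: if_cong)
    then show ?thesis using L[of "Polynomial.smult c p" "degree p"] by (simp add: L_def degree_smult_le)
  qed
  obtain p where p: "p \<noteq> 0" "L p \<in> I"
    using finite_codim_annihilator[OF H.module_axioms B(1,2) sub top Lc L_add L_smult] by blast
  have "(\<Sum>l\<le>degree p. coeff p l * f (e (i + int l) j)) = 0" for i
  proof -
    have ec: "keys (e i j) \<subseteq> carrier infinite_dihedral" for i j by (simp add: e_def)
    have "f (e i False \<otimes>\<^bsub>?A\<^esub> (\<Sum>l\<le>N. single (dih_elt (int l, False)) (F l)) \<otimes>\<^bsub>?A\<^esub> e 0 j)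
        = (\<Sum>l\<le>N. F l * f (e (i + int l) j))" for N :: nat and F
    proof (induction N)
      case 0
      have "e i False \<otimes>\<^bsub>?A\<^esub> single (dih_elt (int 0, False)) (F 0) \<otimes>\<^bsub>?A\<^esub> e 0 j = F 0 \<odot>\<^bsub>?A\<^esub> e i j"
        by (simp add: e_def monoid_algebra_mult mult)
      then show ?case using lin_mapD(3)[OF lin, of "e i j" "F 0"] ec by simp
    next
      case (Suc N)
      let ?S = "\<Sum>l\<le>N. single (dih_elt (int l, False)) (F l)"
      let ?T = "single (dih_elt (int (Suc N), False)) (F (Suc N))"
      have "e i False \<otimes>\<^bsub>?A\<^esub> ?T \<otimes>\<^bsub>?A\<^esub> e 0 j = F (Suc N) \<odot>\<^bsub>?A\<^esub> e (i + int (Suc N)) j"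
        by (simp add: e_def monoid_algebra_mult mult)
      then have T: "f (e i False \<otimes>\<^bsub>?A\<^esub> ?T \<otimes>\<^bsub>?A\<^esub> e 0 j) = F (Suc N) * f (e (i + int (Suc N)) j)"
        "e i False \<otimes>\<^bsub>?A\<^esub> ?T \<otimes>\<^bsub>?A\<^esub> e 0 j \<in> carrier ?A"
        using lin_mapD(3)[OF lin, of "e (i + int (Suc N)) j" "F (Suc N)"] ec A.smult_closed[of "F (Suc N)" "e (i + int (Suc N)) j"] by simp_all
      have S: "e i False \<otimes>\<^bsub>?A\<^esub> ?S \<otimes>\<^bsub>?A\<^esub> e 0 j \<in> carrier ?A"
        using ec sum_closed by (intro A.m_closed) simp_all
      have "e i False \<otimes>\<^bsub>?A\<^esub> (\<Sum>l\<le>Suc N. single (dih_elt (int l, False)) (F l)) \<otimes>\<^bsub>?A\<^esub> e 0 j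
        = e i False \<otimes>\<^bsub>?A\<^esub> ?S \<otimes>\<^bsub>?A\<^esub> e 0 j \<oplus>\<^bsub>?A\<^esub> e i False \<otimes>\<^bsub>?A\<^esub> ?T \<otimes>\<^bsub>?A\<^esub> e 0 j"
        by (simp add: monoid_algebra_mult)
      then show ?case using lin_mapD(2)[OF lin S T(2)] T(1) Suc by simp
    qed
    then have "f (e i False \<otimes>\<^bsub>?A\<^esub> L p \<otimes>\<^bsub>?A\<^esub> e 0 j) = (\<Sum>l\<le>degree p. coeff p l * f (e (i + int l) j))"
      by (simp add: L_def)
    moreover have "e i False \<otimes>\<^bsub>?A\<^esub> L p \<otimes>\<^bsub>?A\<^esub> e 0 j \<in> I"
      using I.I_r_closed[OF I.I_l_closed[OF p(2), of "e i False"], of "e 0 j"] ec by simp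
    ultimately show ?thesis using kill by simp
  qed
  then show ?thesis using exp_poly_recurrence[OF p(1)] by (simp add: e_def)
qed

section \<open>Linear independence of exponential polynomials\<close>

text \<open>
  Descent on the sum of the degrees: applying \<open>s \<mapsto> s (n + 1) - c0 * s n\<close> lowers the degree of the
  coefficient of \<open>c0\<^sup>n\<close> and preserves the degrees of all other coefficients.
\<close>

lemma exp_poly_independent:
  fixes p :: "'k::field_char_0 \<Rightarrow> 'k poly"
  assumes "finite C" "\<And>c. c \<in> C \<Longrightarrow> c \<noteq> 0" "\<And>n. (\<Sum>c\<in>C. poly (p c) (of_nat n) * c ^ n) = 0" "c \<in> C"
  shows "p c = 0"
  using assms(3,4)
proof (induction "\<Sum>c\<in>C. if p c = 0 then 0 else Suc (degree (p c))" arbitrary: p c rule: less_induct)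
  case less
  let ?w = "\<lambda>q :: 'k poly. if q = 0 then 0 else Suc (degree q)"
  show ?case
  proof (rule ccontr)
    assume "p c \<noteq> 0"
    \<comment> \<open>The coefficient of d^n in the sequence s(n + 1) - c s(n).\<close>
    define p' where "p' d = Polynomial.smult d (pcompose (p d) [:1, 1:]) - Polynomial.smult c (p d)" for d
    have c: "c \<noteq> 0" using assms(2) less.prems by simp
    have le: "degree (p' d) \<le> degree (p d)" for d
      unfolding p'_def by (intro degree_diff_le order.trans[OF degree_smult_le]) (simp_all add: degree_pcompose)
    have lead: "coeff (p' d) (degree (p d)) = (d - c) * lead_coeff (p d)" for d
      using lead_coeff_comp[of "[:1, 1:]" "p d"] by (simp add: p'_def degree_pcompose algebra_simps)
    have w_le: "?w (p' d) \<le> ?w (p d)" for d using le[of d] by (auto simp: p'_def)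
    have "?w (p' c) < ?w (p c)"
    proof (cases "p' c = 0")
      case False
      then have "degree (p' c) \<noteq> degree (p c)" using lead[of c] by (metis diff_self leading_coeff_0_iff mult_zero_left)
      then show ?thesis using False le[of c] \<open>p c \<noteq> 0\<close> by simp
    qed (use \<open>p c \<noteq> 0\<close> in simp)
    have less': "(\<Sum>c\<in>C. ?w (p' c)) < (\<Sum>c\<in>C. ?w (p c))"
    proof (rule sum_strict_mono_ex1[OF assms(1)])
      show "\<forall>d\<in>C. ?w (p' d) \<le> ?w (p d)" using w_le by blast
      show "\<exists>d\<in>C. ?w (p' d) < ?w (p d)" using less.prems(2) \<open>?w (p' c) < ?w (p c)\<close> by (rule bexI[rotated])
    qed
    have "(\<Sum>d\<in>C. poly (p' d) (of_nat n) * d ^ n)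
      = (\<Sum>d\<in>C. poly (p d) (of_nat (Suc n)) * d ^ Suc n) - c * (\<Sum>d\<in>C. poly (p d) (of_nat n) * d ^ n)" for n
      unfolding sum_distrib_left sum_subtractf[symmetric]
      by (intro sum.cong) (auto simp: p'_def poly_pcompose algebra_simps)
    then have "(\<Sum>d\<in>C. poly (p' d) (of_nat n) * d ^ n) = 0" for n
      unfolding less.prems(1) by simp
    then have p': "p' d = 0" if "d \<in> C" for d using less.hyps[OF less'] that by blast
    \<comment> \<open>Since \<open>p' d\<close> is zero, so is its coefficient in degree
      \<open>degree (p d)\<close>, which is d - c times the leading coefficient of
      \<open>p d\<close>.\<close>
    have other: "p d = 0" if "d \<in> C" "d \<noteq> c" for d
      using lead[of d] p'[OF that(1)] that(2) by simp
    have "poly (p c) (of_nat n) = 0" for n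
    proof -
      have "(\<Sum>d\<in>C. poly (p d) (of_nat n) * d ^ n) = poly (p c) (of_nat n) * c ^ n"
        using assms(1) less.prems(2) other by (subst sum.remove[of C c]) (auto intro: sum.neutral)
      then show ?thesis using less.prems(1)[of n] c by simp
    qed
    \<comment> \<open>The one remaining coefficient polynomial vanishes at every natural number, and
      in characteristic 0 these are infinitely many roots.\<close>
    then have "range of_nat \<subseteq> {x. poly (p c) x = 0}" by auto
    then have "finite (range (of_nat :: nat \<Rightarrow> 'k))"
      using poly_roots_finite[OF \<open>p c \<noteq> 0\<close>] finite_subset by blast
    then show False using finite_imageD[of "of_nat :: nat \<Rightarrow> 'k" UNIV] by (simp add: inj_on_def)
  qed
qed

section \<open>Presented algebras\<close>

lemma free_monoid_simps [simp]:
  "carrier (free_monoid X) = lists X" "u \<otimes>\<^bsub>free_monoid X\<^esub> v = u @ v" "\<one>\<^bsub>free_monoid X\<^esub> = []"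
  by (simp_all add: free_monoid_def)

lemma monoid_free_monoid: "Group.monoid (free_monoid X)"
  by (rule monoidI) auto

lemma lin_ext_single_diff:
  assumes V: "module scalars V" and "b p \<in> carrier V" "b q = b p"
  shows "lin_ext V b (single p 1 - single q 1) = \<zero>\<^bsub>V\<^esub>"
proof -
  interpret V: module scalars V by (rule V)
  have "lin_ext V b (single p 1 + single q (- 1))
      = 1 \<odot>\<^bsub>V\<^esub> b p \<oplus>\<^bsub>V\<^esub> (- 1) \<odot>\<^bsub>V\<^esub> b p"
    using assms by (subst lin_ext_add[OF V]) (auto simp: lin_ext_single[OF V] split: if_splits)
  also have "\<dots> = \<zero>\<^bsub>V\<^esub>"
    using assms(2) V.smult_l_distr[of 1 "-1" "b p"] V.smult_l_null[of "b p"] by simp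
  finally show ?thesis by (simp add: single_uminus)
qed

context
  fixes X :: "'s set" and R :: "('s list \<Rightarrow>\<^sub>0 'k::field) set"
  assumes R: "R \<subseteq> carrier (monoid_algebra (free_monoid X) :: ('k, _) module)"
begin

private abbreviation (input) "MX \<equiv> monoid_algebra (free_monoid X) :: ('k, 's list \<Rightarrow>\<^sub>0 'k) module"
private abbreviation (input) "JX \<equiv> Idl\<^bsub>(monoid_algebra (free_monoid X) :: ('k, 's list \<Rightarrow>\<^sub>0 'k) module)\<^esub> R"

interpretation MX: k_algebra MX by (rule k_algebra_monoid_algebra[OF monoid_free_monoid])

lemma presented_ideal: "ideal JX MX"
  by (rule MX.genideal_ideal[OF R])

lemma k_algebra_presented: "k_algebra (presented_algebra X R)"
  unfolding presented_algebra_def by (rule k_algebra_quot[OF MX.k_algebra_axioms presented_ideal])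

lemma presented_carrierE:
  assumes "h \<in> carrier (presented_algebra X R)"
  obtains u where "keys u \<subseteq> lists X" "h = JX +>\<^bsub>MX\<^esub> u"
  using assms by (auto simp: presented_algebra_def quot_alg_simps)

lemma presented_coset:
  assumes "keys u \<subseteq> lists X"
  shows "JX +>\<^bsub>MX\<^esub> u \<in> carrier (presented_algebra X R)"
    and "keys v \<subseteq> lists X \<Longrightarrow>
      (JX +>\<^bsub>MX\<^esub> u) \<oplus>\<^bsub>presented_algebra X R\<^esub> (JX +>\<^bsub>MX\<^esub> v) = JX +>\<^bsub>MX\<^esub> (u + v)"
    and "keys v \<subseteq> lists X \<Longrightarrow>
      (JX +>\<^bsub>MX\<^esub> u) \<otimes>\<^bsub>presented_algebra X R\<^esub> (JX +>\<^bsub>MX\<^esub> v) = JX +>\<^bsub>MX\<^esub> (u \<otimes>\<^bsub>MX\<^esub> v)"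
    and "c \<odot>\<^bsub>presented_algebra X R\<^esub> (JX +>\<^bsub>MX\<^esub> u) = JX +>\<^bsub>MX\<^esub> (Poly_Mapping.map ((*) c) u)"
  unfolding presented_algebra_def
  using assms quot_add[OF MX.k_algebra_axioms presented_ideal, of u v]
    quot_mult[OF MX.k_algebra_axioms presented_ideal, of u v]
    quot_smult[OF MX.k_algebra_axioms presented_ideal, of u]
  by (auto simp: quot_alg_simps(1))

lemma presented_one_zero:
  "\<one>\<^bsub>presented_algebra X R\<^esub> = JX +>\<^bsub>MX\<^esub> single [] 1"
  "\<zero>\<^bsub>presented_algebra X R\<^esub> = JX +>\<^bsub>MX\<^esub> 0"
proof -
  interpret I: ideal JX MX by (rule presented_ideal)
  show "\<one>\<^bsub>presented_algebra X R\<^esub> = JX +>\<^bsub>MX\<^esub> single [] 1"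
    by (simp add: presented_algebra_def quot_alg_simps)
  show "\<zero>\<^bsub>presented_algebra X R\<^esub> = JX +>\<^bsub>MX\<^esub> 0"
    using I.a_rcos_const[of 0] I.zero_closed by (simp add: presented_algebra_def quot_alg_simps)
qed

lemma presented_relation:
  assumes "u - v \<in> R" "keys u \<subseteq> lists X" "keys v \<subseteq> lists X"
  shows "JX +>\<^bsub>MX\<^esub> u = JX +>\<^bsub>MX\<^esub> v"
proof -
  have "u - v \<in> JX" using MX.genideal_self[OF R] assms(1) by (rule subsetD)
  then show ?thesis
    using quot_eq_iff[OF MX.k_algebra_axioms presented_ideal, of u v]
      monoid_algebra_minus[OF monoid_free_monoid, of u X v] assms by simp
qed

context
  fixes B :: "('k, 'b, 'm) module_scheme" and v :: "'s \<Rightarrow> 'b"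
  assumes B: "k_algebra B" and v: "\<And>s. s \<in> X \<Longrightarrow> v s \<in> carrier B"
    and kill: "\<And>r. r \<in> R \<Longrightarrow> lin_ext B (\<lambda>w. foldr (\<lambda>s p. v s \<otimes>\<^bsub>B\<^esub> p) w \<one>\<^bsub>B\<^esub>) r = \<zero>\<^bsub>B\<^esub>"
begin

interpretation B: k_algebra B by (rule B)

private abbreviation (input) "word \<equiv> \<lambda>w. foldr (\<lambda>s p. v s \<otimes>\<^bsub>B\<^esub> p) w \<one>\<^bsub>B\<^esub>"

lemma foldr_closed: "w \<in> lists X \<Longrightarrow> word w \<in> carrier B"
  by (induction w) (auto simp: v)

lemma foldr_mult: "\<lbrakk>w \<in> lists X; w' \<in> lists X\<rbrakk> \<Longrightarrow> word (w @ w') = word w \<otimes>\<^bsub>B\<^esub> word w'"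
  using foldr_closed by (induction w) (auto simp: v B.m_assoc)

private lemma closed: "p \<in> carrier (free_monoid X) \<Longrightarrow> word p \<in> carrier B"
  using foldr_closed by simp

private lemma closed_keys:
  assumes "u \<in> carrier MX" "p \<in> keys u"
  shows "word p \<in> carrier B"
proof (rule closed)
  have "keys u \<subseteq> carrier (free_monoid X)" using assms(1) by (simp only: monoid_algebra_simps)
  then show "p \<in> carrier (free_monoid X)" using assms(2) by (rule subsetD)
qed

text \<open>The elements killed by the linear extension of \<open>word\<close> form a two-sided
  ideal, because that extension is multiplicative on the free algebra; containing \<open>R\<close>,
  it contains the ideal generated by \<open>R\<close>.\<close>

private lemma ideal_kill: "u \<in> JX \<Longrightarrow> lin_ext B word u = \<zero>\<^bsub>B\<^esub>"
proof -
  let ?L = "lin_ext B word"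
  let ?M = "{u \<in> carrier MX. ?L u = \<zero>\<^bsub>B\<^esub>}"
  have Bm: "module scalars B" by (rule B.module_axioms)
  have cl: "?L u \<in> carrier B" if "u \<in> carrier MX" for u
    by (rule lin_ext_closed[OF Bm closed_keys[OF that]])
  have sub: "submodule ?M scalars MX"
  proof (rule MX.submodule_scaleI)
    show "x \<oplus>\<^bsub>MX\<^esub> y \<in> ?M" if "x \<in> ?M" "y \<in> ?M" for x y
    proof -
      have "?L (x + y) = ?L x \<oplus>\<^bsub>B\<^esub> ?L y" using that closed_keys[of x] closed_keys[of y] by (intro lin_ext_add[OF Bm]) (auto simp del: monoid_algebra_simps)
      then show ?thesis using that by (simp add: keys_add_subset)
    qed
    show "c \<odot>\<^bsub>MX\<^esub> x \<in> ?M" if "x \<in> ?M" for c x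
    proof -
      have "?L (Poly_Mapping.map ((*) c) x) = c \<odot>\<^bsub>B\<^esub> ?L x" using that closed_keys[of x] by (intro lin_ext_smult[OF Bm]) (auto simp del: monoid_algebra_simps)
      then show ?thesis using that MX.smult_closed[of c x] B.smult_r_null[of c] by simp
    qed
  qed (auto simp: lin_ext_zero[OF Bm])
  have mult: "?L (x \<otimes>\<^bsub>MX\<^esub> y) = ?L x \<otimes>\<^bsub>B\<^esub> ?L y" if "x \<in> carrier MX" "y \<in> carrier MX" for x y
    using that by (intro lin_ext_mult[OF B closed _ monoid_free_monoid]) (simp_all add: foldr_mult del: foldr_append)
  have "ideal ?M MX"
  proof (rule idealI[OF MX.ring_axioms submodule.axioms(1)[OF sub]])
    fix a x assume a: "a \<in> ?M" and x: "x \<in> carrier MX"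
    then have a': "a \<in> carrier MX" "?L a = \<zero>\<^bsub>B\<^esub>" by auto
    show "x \<otimes>\<^bsub>MX\<^esub> a \<in> ?M" using mult[OF x a'(1)] MX.m_closed[OF x a'(1)] a' cl[OF x] by simp
    show "a \<otimes>\<^bsub>MX\<^esub> x \<in> ?M" using mult[OF a'(1) x] MX.m_closed[OF a'(1) x] a' cl[OF x] by simp
  qed
  then have "JX \<subseteq> ?M" by (rule MX.genideal_minimal) (use R kill in \<open>auto simp del: monoid_algebra_simps\<close>)
  then show "u \<in> JX \<Longrightarrow> ?L u = \<zero>\<^bsub>B\<^esub>" by auto
qed

lemma gen_hom_alg_hom: "gen_hom B v \<in> alg_hom (presented_algebra X R) B"
  unfolding gen_hom_def[abs_def] presented_algebra_def
  by (rule quot_lift_alg_hom[OF monoid_free_monoid presented_ideal B.module_axioms closed ideal_kill B])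
    (simp_all add: foldr_mult del: foldr_append)

lemma gen_hom_coset:
  "keys u \<subseteq> lists X \<Longrightarrow> gen_hom B v (JX +>\<^bsub>MX\<^esub> u) = lin_ext B word u"
  unfolding gen_hom_def
  by (rule quot_lift_coset[OF monoid_free_monoid presented_ideal B.module_axioms closed ideal_kill]) simp_all

lemma gen_hom_generator: "s \<in> X \<Longrightarrow> gen_hom B v (JX +>\<^bsub>MX\<^esub> single [s] 1) = v s"
  using v[of s] B.smult_one[of "v s"] by (simp add: gen_hom_coset lin_ext_single[OF B.module_axioms])

end

end

section \<open>Evaluating the generators on the dihedral group\<close>

fun gen_val :: "'k::field gen \<Rightarrow> int \<times> bool \<Rightarrow> 'k" where
  "gen_val Gen_F d = of_int (fst d)"
| "gen_val (Gen_phi c) d = c powi fst d"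
| "gen_val (Gen_psi c) d = (if snd d then - 1 else 1) * c powi fst d"

definition mon_val :: "'k::field gen list \<Rightarrow> int \<times> bool \<Rightarrow> 'k" where
  "mon_val w d = foldr (\<lambda>s p. gen_val s d * p) w 1"

lemma mon_val_simps [simp]:
  "mon_val [] d = 1" "mon_val (s # w) d = gen_val s d * mon_val w d"
  by (simp_all add: mon_val_def)

lemma mon_val_append: "mon_val (u @ w) d = mon_val u d * mon_val w d"
  by (induction u) auto

lemma mem_gens [simp]:
  "Gen_F \<in> gens" "Gen_phi c \<in> gens \<longleftrightarrow> c \<noteq> 0" "Gen_psi c \<in> gens \<longleftrightarrow> c \<noteq> 0"
  by (auto simp: gens_def)

text \<open>Maps out of the presented algebra are tested against this common property of the
  relations instead of against the seven families one by one.\<close>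

lemma relsE:
  assumes "r \<in> (rels :: ('k gen list \<Rightarrow>\<^sub>0 'k::field) set)"
  obtains p q where "r = mon p - mon q" "p \<in> lists gens" "q \<in> lists gens" "\<And>d. mon_val p d = mon_val q d"
  using assms unfolding rels_def
  by (elim UnE CollectE exE conjE; (elim singletonE)?) (erule that; auto simp: power_int_mult_distrib)+

lemma rels_carrier: "rels \<subseteq> carrier (monoid_algebra (free_monoid gens) :: ('k::field, _) module)"
proof
  fix r :: "'k gen list \<Rightarrow>\<^sub>0 'k" assume "r \<in> rels"
  then obtain p q where "r = mon p - mon q" "p \<in> lists gens" "q \<in> lists gens" by (rule relsE)
  then show "r \<in> carrier (monoid_algebra (free_monoid gens) :: ('k, _) module)"
    using keys_diff[of "mon p" "mon q"] by auto
qed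

abbreviation "DD \<equiv> dihedral_dual_algebra :: ('k::field, 'k elt) module"

lemma k_algebra_DD: "k_algebra (DD :: ('k::field, _) module)"
  unfolding dihedral_dual_algebra_def by (rule k_algebra_presented[OF rels_carrier])

definition mon_elt :: "'k::field gen list \<Rightarrow> 'k elt" where
  "mon_elt w = Idl\<^bsub>(monoid_algebra (free_monoid gens) :: ('k, _) module)\<^esub> rels
       +>\<^bsub>(monoid_algebra (free_monoid gens) :: ('k, _) module)\<^esub> mon w"

lemma gen_elt_mon: "gen_elt s = mon_elt [s]"
  by (simp add: gen_elt_def mon_elt_def)

lemma mon_elt_closed [simp]: "w \<in> lists gens \<Longrightarrow> mon_elt w \<in> carrier DD"
  unfolding mon_elt_def dihedral_dual_algebra_def by (rule presented_coset[OF rels_carrier]) simp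

lemma gen_elt_closed [simp]: "s \<in> gens \<Longrightarrow> gen_elt s \<in> carrier DD"
  by (simp add: gen_elt_mon)

lemma mon_elt_append:
  "\<lbrakk>u \<in> lists gens; w \<in> lists gens\<rbrakk> \<Longrightarrow> mon_elt (u @ w) = mon_elt u \<otimes>\<^bsub>DD\<^esub> mon_elt w"
  unfolding mon_elt_def dihedral_dual_algebra_def
  by (subst presented_coset(3)[OF rels_carrier]) (simp_all add: monoid_algebra_mult)

lemma mon_elt_rel:
  assumes "mon p - mon q \<in> rels" "p \<in> lists gens" "q \<in> lists gens"
  shows "mon_elt p = mon_elt q"
  unfolding mon_elt_def using assms by (intro presented_relation[OF rels_carrier]) auto

lemma DD_induct [consumes 1, case_names zero add smult]:
  assumes "h \<in> carrier (DD :: ('k::field, _) module)"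
    and zero: "P (\<zero>\<^bsub>DD\<^esub> :: 'k elt)"
    and add: "\<And>x y. \<lbrakk>x \<in> carrier DD; y \<in> carrier DD; P x; P y\<rbrakk> \<Longrightarrow> P (x \<oplus>\<^bsub>DD\<^esub> y)"
    and smult: "\<And>c w. w \<in> lists gens \<Longrightarrow> P (c \<odot>\<^bsub>DD\<^esub> mon_elt w)"
  shows "P h"
proof -
  let ?M = "monoid_algebra (free_monoid gens) :: ('k, _) module"
  let ?cl = "\<lambda>u. Idl\<^bsub>?M\<^esub> rels +>\<^bsub>?M\<^esub> u"
  obtain u where u: "keys u \<subseteq> lists gens" "h = ?cl u"
    using assms(1) unfolding dihedral_dual_algebra_def by (rule presented_carrierE[OF rels_carrier])
  show ?thesis unfolding u(2) using u(1)
  proof (induction rule: poly_mapping_on_induct)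
    case zero
    show ?case using assms(2) by (simp add: dihedral_dual_algebra_def presented_one_zero[OF rels_carrier])
  next
    case (add u v)
    then have "?cl u \<in> carrier DD" "?cl v \<in> carrier DD" "?cl (u + v) = ?cl u \<oplus>\<^bsub>DD\<^esub> ?cl v"
      unfolding dihedral_dual_algebra_def
      by (simp_all only: presented_coset(1,2)[OF rels_carrier])
    then show ?case using assms(3) add by simp
  next
    case (single w c)
    then show ?case
      using assms(4)[of w c] presented_coset(4)[OF rels_carrier, of "mon w" c]
      by (simp add: dihedral_dual_algebra_def mon_elt_def)
  qed
qed

definition elt_val :: "'k::field elt \<Rightarrow> int \<times> bool \<Rightarrow> 'k" where
  "elt_val h d = gen_hom scalars (\<lambda>s. gen_val s d) h"

text \<open>The condition on \<open>v\<close>, that monomials with equal values have equal images,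
  implies that the relations are respected, and it has a form that evaluation in \<open>B\<close>
  can decide.\<close>

lemma gen_hom_rels:
  fixes B :: "('k::field, 'b, 'm) module_scheme"
  assumes "k_algebra B" "\<And>s. s \<in> gens \<Longrightarrow> v s \<in> carrier B"
    and "\<And>p q. \<lbrakk>p \<in> lists gens; q \<in> lists gens; \<And>d. mon_val p d = (mon_val q d :: 'k)\<rbrakk> \<Longrightarrow>
      foldr (\<lambda>s p. v s \<otimes>\<^bsub>B\<^esub> p) p \<one>\<^bsub>B\<^esub> = foldr (\<lambda>s p. v s \<otimes>\<^bsub>B\<^esub> p) q \<one>\<^bsub>B\<^esub>"
  shows "gen_hom B v \<in> alg_hom DD B" "s \<in> gens \<Longrightarrow> gen_hom B v (gen_elt s) = v s"
proof -
  have kill: "lin_ext B (\<lambda>w. foldr (\<lambda>s p. v s \<otimes>\<^bsub>B\<^esub> p) w \<one>\<^bsub>B\<^esub>) r = \<zero>\<^bsub>B\<^esub>" if r: "r \<in> rels" for r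
  proof -
    obtain p q where pq: "r = mon p - mon q" "p \<in> lists gens" "q \<in> lists gens" "\<And>d. mon_val p d = mon_val q d"
      by (rule relsE[OF r]) (rule that)
    have "foldr (\<lambda>s p. v s \<otimes>\<^bsub>B\<^esub> p) p \<one>\<^bsub>B\<^esub> \<in> carrier B"
    proof -
      interpret B: k_algebra B by fact
      show ?thesis using pq(2) assms(2) by (induction p) auto
    qed
    then show ?thesis unfolding pq(1)
      by (intro lin_ext_single_diff k_algebra.axioms(1) assms(1)) (simp_all add: assms(3)[OF pq(2-4)])
  qed
  show "gen_hom B v \<in> alg_hom DD B" unfolding dihedral_dual_algebra_def
    by (rule gen_hom_alg_hom[OF rels_carrier assms(1,2) kill])
  show "s \<in> gens \<Longrightarrow> gen_hom B v (gen_elt s) = v s" unfolding gen_elt_def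
    by (rule gen_hom_generator[OF rels_carrier assms(1,2) kill])
qed

lemma elt_val_alg_hom: "(\<lambda>h. elt_val h d) \<in> alg_hom DD scalars"
  and elt_val_gen: "s \<in> gens \<Longrightarrow> elt_val (gen_elt s) d = gen_val s d"
  unfolding elt_val_def
  by (rule gen_hom_rels[OF k_algebra_scalars]; simp flip: mon_val_def)+

lemma elt_val_simps [simp]:
  "\<lbrakk>x \<in> carrier DD; y \<in> carrier DD\<rbrakk> \<Longrightarrow> elt_val (x \<oplus>\<^bsub>DD\<^esub> y) d = elt_val x d + elt_val y d"
  "\<lbrakk>x \<in> carrier DD; y \<in> carrier DD\<rbrakk> \<Longrightarrow> elt_val (x \<otimes>\<^bsub>DD\<^esub> y) d = elt_val x d * elt_val y d"
  "x \<in> carrier DD \<Longrightarrow> elt_val (c \<odot>\<^bsub>DD\<^esub> x) d = c * elt_val x d"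
  "elt_val \<one>\<^bsub>DD\<^esub> d = 1" "elt_val \<zero>\<^bsub>DD\<^esub> d = 0"
  using lin_mapD[OF alg_homD(1)[OF elt_val_alg_hom[of d]]] alg_homD(2,3)[OF elt_val_alg_hom[of d]]
    lin_map_zero[OF k_algebra.axioms(1)[OF k_algebra_DD] module_scalars alg_homD(1)[OF elt_val_alg_hom[of d]]] by auto

lemma DD_smult [simp]: "x \<in> carrier DD \<Longrightarrow> c \<odot>\<^bsub>DD\<^esub> x \<in> carrier DD"
  using module.smult_closed[OF k_algebra.axioms(1)[OF k_algebra_DD], of c x] by simp

lemma elt_val_mon: "w \<in> lists gens \<Longrightarrow> elt_val (mon_elt w) d = mon_val w d"
proof (induction w)
  case Nil
  show ?case using elt_val_simps(4)
    by (simp add: mon_elt_def dihedral_dual_algebra_def presented_one_zero[OF rels_carrier])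
next
  case (Cons s w)
  then show ?case using mon_elt_append[of "[s]" w] by (simp add: elt_val_gen gen_elt_mon[symmetric])
qed

section \<open>Normal forms of monomials and injectivity of the evaluation\<close>

definition can_mon :: "nat \<times> 'k \<times> bool \<Rightarrow> 'k gen list" where
  "can_mon = (\<lambda>(n, c, t). replicate n Gen_F @ [if t then Gen_psi c else Gen_phi c])"

lemma can_mon_mem: "fst (snd k) \<noteq> 0 \<Longrightarrow> can_mon k \<in> lists gens"
  by (cases k) (auto simp: can_mon_def)

lemma mon_val_can_mon:
  "mon_val (can_mon (n, c, t)) (i, j) = of_int i ^ n * c powi i * (if t \<and> j then - 1 else 1)"
proof -
  have "mon_val (replicate n Gen_F) (i, j) = (of_int i :: 'a) ^ n" by (induction n) auto
  then show ?thesis by (simp add: can_mon_def mon_val_append)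
qed

text \<open>\<open>F\<close> commutes with every generator, and a product of two generators of type
  \<phi> or \<psi> is again one of them. A letter put in front of a normal form thus passes the
  powers of \<open>F\<close> and merges with the last letter.\<close>

lemma mon_elt_canonical:
  assumes "w \<in> lists gens"
  shows "\<exists>k. fst (snd k) \<noteq> 0 \<and> mon_elt w = mon_elt (can_mon k)"
  using assms
proof (induction w)
  case Nil
  \<comment> \<open>A normal form ends in a letter of type \<phi> or \<psi>; for the empty word the
    relation for \<open>\<phi>\<^sub>1\<close> supplies it.\<close>
  have "mon_elt [Gen_phi 1] = mon_elt ([] :: 'a gen list)" by (rule mon_elt_rel) (auto simp: rels_def)
  then show ?case by (intro exI[of _ "(0, 1, False)"]) (simp add: can_mon_def)
next
  case (Cons s w)
  interpret DD: k_algebra "DD :: ('a, _) module" by (rule k_algebra_DD)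
  obtain n c t where k: "c \<noteq> 0" "mon_elt w = mon_elt (can_mon (n, c, t))" using Cons by auto
  have can: "can_mon (n, c, t) \<in> lists gens" using k by (intro can_mon_mem) simp
  have "mon_elt (s # w) = mon_elt [s] \<otimes>\<^bsub>DD\<^esub> mon_elt w"
    using mon_elt_append[of "[s]" w] Cons by simp
  also have "\<dots> = mon_elt (s # can_mon (n, c, t))"
    using mon_elt_append[of "[s]" "can_mon (n, c, t)"] Cons can k by simp
  finally have *: "mon_elt (s # w) = mon_elt (s # can_mon (n, c, t))" .
  let ?g = "if t then Gen_psi c else Gen_phi c"
  have F: "replicate n Gen_F \<in> lists gens" for n by auto
  show ?case
  proof (cases "s = Gen_F")
    case True
    then show ?thesis using k * by (intro exI[of _ "(Suc n, c, t)"]) (simp add: can_mon_def)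
  next
    case False
    have s: "s \<in> gens" using Cons by simp
    have comm: "mon_elt [s, Gen_F] = mon_elt [Gen_F, s]"
    proof (rule mon_elt_rel[symmetric])
      show "mon [Gen_F, s] - mon [s, Gen_F] \<in> rels" using s False by (cases s) (auto simp: rels_def)
    qed (use s in auto)
    have commn: "mon_elt ([s] @ replicate n Gen_F) = mon_elt (replicate n Gen_F @ [s])"
    proof (induction n)
      case (Suc n)
      have "mon_elt ([s] @ replicate (Suc n) Gen_F) = mon_elt ([s, Gen_F] @ replicate n Gen_F)" by simp
      also have "\<dots> = mon_elt [s, Gen_F] \<otimes>\<^bsub>DD\<^esub> mon_elt (replicate n Gen_F)"
        using s F by (intro mon_elt_append) auto
      also have "\<dots> = mon_elt ([Gen_F] @ ([s] @ replicate n Gen_F))"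
        unfolding comm using s F by (subst mon_elt_append[symmetric]) auto
      also have "\<dots> = mon_elt [Gen_F] \<otimes>\<^bsub>DD\<^esub> mon_elt ([s] @ replicate n Gen_F)"
        using s F by (intro mon_elt_append) auto
      also have "\<dots> = mon_elt ([Gen_F] @ (replicate n Gen_F @ [s]))"
        unfolding Suc using s F by (subst mon_elt_append[symmetric]) auto
      finally show ?case by simp
    qed simp
    obtain c' t' where c': "c' \<noteq> 0" "mon_elt [s, ?g] = mon_elt [if t' then Gen_psi c' else Gen_phi c']"
    proof (cases s)
      case (Gen_phi a)
      have "mon_elt [s, ?g] = mon_elt [if t then Gen_psi (a * c) else Gen_phi (a * c)]"
        using s k Gen_phi by (intro mon_elt_rel) (auto simp: rels_def)
      then show ?thesis using that[of "a * c" t] s k Gen_phi by auto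
    next
      case (Gen_psi a)
      \<comment> \<open>The order \<open>c * a\<close> follows the relation for \<psi> times \<phi>,
        in which the parameter of \<phi> comes first in the product.\<close>
      have "mon_elt [s, ?g] = mon_elt [if \<not> t then Gen_psi (c * a) else Gen_phi (a * c)]"
        using s k Gen_psi by (intro mon_elt_rel) (auto simp: rels_def)
      then show ?thesis using that[of "a * c" "\<not> t"] s k Gen_psi by (auto simp: mult.commute)
    qed (use False in simp)
    have g: "[?g] \<in> lists gens" using k by auto
    have "mon_elt (s # can_mon (n, c, t)) = mon_elt (([s] @ replicate n Gen_F) @ [?g])"
      by (simp add: can_mon_def)
    also have "\<dots> = mon_elt ([s] @ replicate n Gen_F) \<otimes>\<^bsub>DD\<^esub> mon_elt [?g]"
      using s F g by (intro mon_elt_append) auto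
    also have "\<dots> = mon_elt (replicate n Gen_F @ [s, ?g])"
      unfolding commn using s F g by (subst mon_elt_append[symmetric]) auto
    also have "\<dots> = mon_elt (replicate n Gen_F) \<otimes>\<^bsub>DD\<^esub> mon_elt [s, ?g]"
      using s F g by (intro mon_elt_append) auto
    also have "\<dots> = mon_elt (can_mon (n, c', t'))"
      unfolding c'(2) can_mon_def prod.case using F c' by (intro mon_elt_append[symmetric]) auto
    finally show ?thesis using * c'(1) by (intro exI[of _ "(n, c', t')"]) simp
  qed
qed

lemma DD_canonical:
  assumes "h \<in> carrier (DD :: ('k::field, _) module)"
  shows "\<exists>u. (\<forall>k\<in>keys u. fst (snd k) \<noteq> 0) \<and> h = lin_ext DD (\<lambda>k. mon_elt (can_mon k)) u"
  using assms
proof (induction rule: DD_induct)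
  case zero
  show ?case by (intro exI[of _ 0]) (simp add: lin_ext_zero[OF k_algebra.axioms(1)[OF k_algebra_DD]])
next
  case (add x y)
  then obtain u v where u: "\<forall>k\<in>keys u. fst (snd k) \<noteq> 0" "x = lin_ext DD (\<lambda>k. mon_elt (can_mon k)) u"
    and v: "\<forall>k\<in>keys v. fst (snd k) \<noteq> 0" "y = lin_ext DD (\<lambda>k. mon_elt (can_mon k)) v" by blast
  have "x \<oplus>\<^bsub>DD\<^esub> y = lin_ext DD (\<lambda>k. mon_elt (can_mon k)) (u + v)"
    unfolding u(2) v(2) using u(1) v(1)
    by (intro lin_ext_add[OF k_algebra.axioms(1)[OF k_algebra_DD], symmetric] mon_elt_closed can_mon_mem) auto
  then show ?case using u(1) v(1) Poly_Mapping.keys_add[of u v] by (intro exI[of _ "u + v"]) auto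
next
  case (smult c w)
  obtain k where k: "fst (snd k) \<noteq> 0" "mon_elt w = mon_elt (can_mon k)"
    using mon_elt_canonical[OF smult] by blast
  have "c \<odot>\<^bsub>DD\<^esub> mon_elt w = lin_ext DD (\<lambda>k. mon_elt (can_mon k)) (single k c)"
    unfolding k(2)
    by (rule lin_ext_single[OF k_algebra.axioms(1)[OF k_algebra_DD], symmetric]) (intro mon_elt_closed can_mon_mem k)
  then show ?case using k by (intro exI[of _ "single k c"]) auto
qed

text \<open>
  Restricting to rotations and to reflections separates the \<open>\<phi>\<close>- from the \<open>\<psi>\<close>-coefficients, as
  the characteristic is not 2.
\<close>

lemma canonical_independent:
  fixes u :: "nat \<times> 'k::field_char_0 \<times> bool \<Rightarrow>\<^sub>0 'k"
  assumes nz: "\<forall>k\<in>keys u. fst (snd k) \<noteq> 0"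
    and zero: "\<And>d. lin_ext scalars (\<lambda>k. mon_val (can_mon k) d) u = 0"
  shows "u = 0"
proof -
  let ?S = "keys u" and ?u = "lookup u"
  let ?C = "(\<lambda>k. fst (snd k)) ` ?S"
  define s where "s j k = (if j \<and> snd (snd k) then - 1 else 1 :: 'k)" for j and k :: "nat \<times> 'k \<times> bool"
  \<comment> \<open>The polynomial factor of c^i in the value function, on rotations or on
    reflections according to \<open>j\<close>. Its coefficients are sums or differences of a
    \<phi>-coefficient and a \<psi>-coefficient.\<close>
  define Q where "Q j c = (\<Sum>k\<in>{k \<in> ?S. fst (snd k) = c}. monom (?u k * s j k) (fst k))" for j c
  have Q_zero: "Q j c = 0" if "c \<in> ?C" for j c
  proof (rule exp_poly_independent[of ?C])
    fix n :: nat
    have "(\<Sum>c\<in>?C. poly (Q j c) (of_nat n) * c ^ n)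
      = (\<Sum>c\<in>?C. \<Sum>k\<in>{k \<in> ?S. fst (snd k) = c}. ?u k * s j k * of_nat n ^ fst k * fst (snd k) ^ n)"
      by (intro sum.cong refl) (auto simp: Q_def poly_sum poly_monom sum_distrib_right intro!: sum.cong)
    also have "\<dots> = (\<Sum>k\<in>?S. ?u k * s j k * of_nat n ^ fst k * fst (snd k) ^ n)"
      by (rule sum.group) auto
    also have "\<dots> = lin_ext scalars (\<lambda>k. mon_val (can_mon k) (int n, j)) u"
      unfolding lin_ext_scalars
    proof (rule sum.cong[OF HOL.refl])
      fix k
      show "?u k * s j k * of_nat n ^ fst k * fst (snd k) ^ n = ?u k * mon_val (can_mon k) (int n, j)"
        by (cases k) (simp add: mon_val_can_mon s_def)
    qed
    finally show "(\<Sum>c\<in>?C. poly (Q j c) (of_nat n) * c ^ n) = 0" using zero by simp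
  qed (use nz that in auto)
  have coeff_Q: "coeff (Q j c) n = ?u (n, c, False) + (if j then - 1 else 1) * ?u (n, c, True)" for j c n
  proof -
    have "coeff (Q j c) n = (\<Sum>k\<in>{k \<in> ?S. fst (snd k) = c}. if fst k = n then ?u k * s j k else 0)"
      by (simp add: Q_def coeff_sum)
    also have "\<dots> = (\<Sum>k\<in>{(n, c, False), (n, c, True)}. ?u k * s j k)"
      by (rule sum.mono_neutral_cong) (auto simp: in_keys_iff)
    finally show ?thesis by (simp add: s_def)
  qed
  have "?u (n, c, t) = 0" for n c t
  proof (cases "c \<in> ?C")
    case True
    then have "?u (n, c, False) + ?u (n, c, True) = 0" "?u (n, c, False) - ?u (n, c, True) = 0"
      using coeff_Q[of False c n] coeff_Q[of True c n] Q_zero by simp_all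
    moreover have "2 * x = (x + y) + (x - y)" "2 * y = (x + y) - (x - y)" for x y :: 'k by simp_all
    ultimately have "2 * ?u (n, c, False) = 0" "2 * ?u (n, c, True) = 0" by (metis diff_zero add_0)+
    then show ?thesis by (cases t) auto
  next
    case False
    then have "(n, c, t) \<notin> ?S" by force
    then show ?thesis by (simp add: in_keys_iff)
  qed
  then show ?thesis by (intro poly_mapping_eqI) (metis lookup_zero prod_cases3)
qed

text \<open>The difference of two elements with equal values is a combination of normal forms with
  vanishing value function, and \<open>canonical_independent\<close> makes its coefficients zero.
  The relations therefore capture every identity between the functions.\<close>

lemma elt_val_embedding: "linear_embedding DD (elt_val :: 'k::field_char_0 elt \<Rightarrow> _)"
  unfolding linear_embedding_def
proof (intro conjI allI alg_homD(1)[OF elt_val_alg_hom] inj_onI)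
  interpret DD: k_algebra "DD :: ('k, _) module" by (rule k_algebra_DD)
  fix x y :: "'k elt" assume x: "x \<in> carrier DD" and y: "y \<in> carrier DD" and eq: "elt_val x = elt_val y"
  let ?h = "x \<oplus>\<^bsub>DD\<^esub> (- 1) \<odot>\<^bsub>DD\<^esub> y"
  have h: "?h \<in> carrier DD" using x y by simp
  obtain u where u: "\<forall>k\<in>keys u. fst (snd k) \<noteq> 0" "?h = lin_ext DD (\<lambda>k. mon_elt (can_mon k)) u"
    using DD_canonical[OF h] by blast
  have cl: "mon_elt (can_mon k) \<in> carrier DD" if "k \<in> keys u" for k
    using that u(1) by (intro mon_elt_closed can_mon_mem) auto
  have "lin_ext scalars (\<lambda>k. mon_val (can_mon k) d) u = 0" for d
  proof -
    have "lin_ext scalars (\<lambda>k. mon_val (can_mon k) d) u = lin_ext scalars (\<lambda>k. elt_val (mon_elt (can_mon k)) d) u"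
      by (rule lin_ext_cong[OF module_scalars]) (use u(1) in \<open>auto simp: elt_val_mon can_mon_mem\<close>)
    also have "\<dots> = elt_val ?h d" unfolding u(2)
      by (rule lin_map_lin_ext[OF DD.module_axioms module_scalars alg_homD(1)[OF elt_val_alg_hom] cl, symmetric])
    also have "\<dots> = 0" using x y eq by simp
    finally show ?thesis .
  qed
  then have "u = 0" using canonical_independent u(1) by blast
  then have "?h = \<zero>\<^bsub>DD\<^esub>" using u(2) by (simp add: lin_ext_zero[OF DD.module_axioms])
  moreover have "(- 1) \<odot>\<^bsub>DD\<^esub> y \<oplus>\<^bsub>DD\<^esub> y = \<zero>\<^bsub>DD\<^esub>"
    using y DD.smult_l_distr[of "-1" 1 y] DD.smult_l_null[of y] DD.smult_one[of y] by simp
  ultimately show "x = y" using x y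
    by (metis DD.M.a_assoc DD.M.l_zero DD.M.r_zero DD_smult)
qed

section \<open>The Hopf structure of the presented algebra\<close>

lemma lin_map_minus:
  assumes V: "module scalars V" and f: "f \<in> lin_map V scalars" and x: "x \<in> carrier V"
  shows "f (\<ominus>\<^bsub>V\<^esub> x) = - f x"
proof -
  interpret V: module scalars V by (rule V)
  have "f (x \<oplus>\<^bsub>V\<^esub> \<ominus>\<^bsub>V\<^esub> x) = f x + f (\<ominus>\<^bsub>V\<^esub> x)" using lin_mapD(2)[OF f, of x "\<ominus>\<^bsub>V\<^esub> x"] x by simp
  then have "f x + f (\<ominus>\<^bsub>V\<^esub> x) = 0" using x lin_map_zero[OF V module_scalars f] by (simp add: V.M.r_neg)
  then show ?thesis by (simp add: add_eq_0_iff)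
qed

lemma opposite_simps [simp]:
  "carrier (opposite A) = carrier A" "x \<otimes>\<^bsub>opposite A\<^esub> y = y \<otimes>\<^bsub>A\<^esub> x" "\<one>\<^bsub>opposite A\<^esub> = \<one>\<^bsub>A\<^esub>"
  "\<zero>\<^bsub>opposite A\<^esub> = \<zero>\<^bsub>A\<^esub>" "x \<oplus>\<^bsub>opposite A\<^esub> y = x \<oplus>\<^bsub>A\<^esub> y" "c \<odot>\<^bsub>opposite A\<^esub> x = c \<odot>\<^bsub>A\<^esub> x"
  by (simp_all add: opposite_def)

lemma k_algebra_opposite:
  assumes A: "k_algebra A"
  shows "k_algebra (opposite A)"
proof -
  interpret A: k_algebra A by (rule A)
  have [simp]: "x \<in> carrier A \<Longrightarrow> c \<odot>\<^bsub>A\<^esub> x \<in> carrier A" for c x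
    using A.smult_closed[of c x] by simp
  show ?thesis
  proof (rule k_algebraI, unfold opposite_simps)
    show "\<exists>y\<in>carrier A. y \<oplus>\<^bsub>A\<^esub> x = \<zero>\<^bsub>A\<^esub>" if "x \<in> carrier A" for x
      using that by (intro bexI[of _ "\<ominus>\<^bsub>A\<^esub> x"]) (simp_all add: A.M.l_neg)
    show "x \<oplus>\<^bsub>A\<^esub> y = y \<oplus>\<^bsub>A\<^esub> x" if "x \<in> carrier A" "y \<in> carrier A" for x y
      using that by (rule A.M.a_comm)
  qed (simp_all add: A.M.a_assoc A.m_assoc A.l_distr A.r_distr A.smult_r_distr A.smult_mult_left A.smult_mult_right
      A.smult_l_distr[simplified] A.smult_assoc1[simplified] A.smult_one[simplified])
qed

text \<open>
  The relations hold in \<open>B\<close> because they hold after applying every algebra map \<open>\<beta> _ x\<close>.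
\<close>

lemma gen_hom_separated:
  fixes B :: "('k::field_char_0, 'b, 'm) module_scheme" and \<beta> :: "'b \<Rightarrow> 'x \<Rightarrow> 'k"
  assumes B: "k_algebra B" and \<beta>: "linear_embedding B \<beta>" "\<And>x. (\<lambda>b. \<beta> b x) \<in> alg_hom B scalars"
    and v: "\<And>s. s \<in> gens \<Longrightarrow> v s \<in> carrier B" "\<And>s x. s \<in> gens \<Longrightarrow> \<beta> (v s) x = gen_val s (\<tau> x)"
  shows "gen_hom B v \<in> alg_hom DD B" and "h \<in> carrier DD \<Longrightarrow> \<beta> (gen_hom B v h) x = elt_val h (\<tau> x)"
proof -
  interpret B: k_algebra B by (rule B)
  interpret DD: k_algebra "DD :: ('k, _) module" by (rule k_algebra_DD)
  let ?w = "\<lambda>w. foldr (\<lambda>s p. v s \<otimes>\<^bsub>B\<^esub> p) w \<one>\<^bsub>B\<^esub>"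
  have closed: "?w w \<in> carrier B" if "w \<in> lists gens" for w
    using that v(1) by (induction w) auto
  have val: "\<beta> (?w w) x = mon_val w (\<tau> x)" if "w \<in> lists gens" for w x
    using that
  proof (induction w)
    case Nil
    then show ?case using alg_homD(2)[OF \<beta>(2)[of x]] by simp
  next
    case (Cons s w)
    then show ?case using alg_homD(3)[OF \<beta>(2)[of x], of "v s" "?w w"] closed[of w] v by simp
  qed
  \<comment> \<open>The map \<tau> sends a point at which \<open>B\<close> is evaluated to a group
    element: the product of a pair for the comultiplication, the inverse for the antipode. Monomials
    with equal values thus have images that no evaluation distinguishes.\<close>
  have respects: "?w p = ?w q" if "p \<in> lists gens" "q \<in> lists gens" "\<And>d. mon_val p d = (mon_val q d :: 'k)" for p q
    using that by (intro linear_embeddingD(2)[OF \<beta>(1)] closed) (simp_all add: val)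
  show hom: "gen_hom B v \<in> alg_hom DD B" by (rule gen_hom_rels(1)[OF B v(1) respects])
  have gen: "gen_hom B v (gen_elt s) = v s" if "s \<in> gens" for s
    by (rule gen_hom_rels(2)[OF B v(1) respects that])
  note lin = lin_mapD[OF alg_homD(1)[OF hom]]
  have lin\<beta>: "\<beta> (y \<oplus>\<^bsub>B\<^esub> z) x = \<beta> y x + \<beta> z x" "\<beta> (c \<odot>\<^bsub>B\<^esub> y) x = c * \<beta> y x"
    "\<beta> (y \<otimes>\<^bsub>B\<^esub> z) x = \<beta> y x * \<beta> z x" "\<beta> \<one>\<^bsub>B\<^esub> x = 1"
    if "y \<in> carrier B" "z \<in> carrier B" for y z c
    using lin_mapD(2,3)[OF alg_homD(1)[OF \<beta>(2)[of x]]] alg_homD(2,3)[OF \<beta>(2)[of x]] that by simp_all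
  have beta_zero: "gen_hom B v \<zero>\<^bsub>DD\<^esub> = \<zero>\<^bsub>B\<^esub>" "\<beta> \<zero>\<^bsub>B\<^esub> x = 0"
    using lin_map_zero[OF DD.module_axioms B.module_axioms alg_homD(1)[OF hom]]
      lin_map_zero[OF B.module_axioms module_scalars alg_homD(1)[OF \<beta>(2)[of x]]] by simp_all
  show "\<beta> (gen_hom B v h) x = elt_val h (\<tau> x)" if "h \<in> carrier DD"
    using that
  proof (induction rule: DD_induct)
    case zero
    show ?case by (simp only: beta_zero elt_val_simps)
  next
    case (add y z)
    then show ?case by (simp add: lin(1,2) lin\<beta>(1))
  next
    case (smult c w)
    have "\<beta> (gen_hom B v (mon_elt w)) x = mon_val w (\<tau> x)" using smult
    proof (induction w)
      case Nil
      have one: "mon_elt [] = \<one>\<^bsub>DD\<^esub>"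
        by (simp add: mon_elt_def dihedral_dual_algebra_def presented_one_zero[OF rels_carrier])
      show ?case by (simp add: one alg_homD(2)[OF hom] lin\<beta>(4)[OF B.one_closed B.one_closed])
    next
      case (Cons s w)
      then have s: "s \<in> gens" and w: "w \<in> lists gens" by auto
      have "mon_elt (s # w) = gen_elt s \<otimes>\<^bsub>DD\<^esub> mon_elt w"
        using mon_elt_append[of "[s]" w] s w by (simp add: gen_elt_mon)
      then have "gen_hom B v (mon_elt (s # w)) = v s \<otimes>\<^bsub>B\<^esub> gen_hom B v (mon_elt w)"
        using alg_homD(3)[OF hom, of "gen_elt s" "mon_elt w"] s w gen[of s] by simp
      then show ?case
        using Cons.IH lin(1)[OF mon_elt_closed[OF w]] by (simp add: lin\<beta>(3) v s)
    qed
    then show ?case using smult lin(1)[OF mon_elt_closed[OF smult]]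
      by (simp add: elt_val_mon lin(3) lin\<beta>(2)[OF _ B.zero_closed])
  qed
qed

lemma dihedral_dual_simps [simp]:
  "carrier dihedral_dual = carrier DD" "mult dihedral_dual = mult DD" "one dihedral_dual = one DD"
  "zero dihedral_dual = zero DD" "add dihedral_dual = add DD" "smult dihedral_dual = smult DD"
  "comult dihedral_dual = gen_hom (tensor DD DD) comult_gen"
  "counit dihedral_dual = gen_hom scalars counit_gen"
  "antipode dihedral_dual = gen_hom (opposite DD) antipode_gen"
  by (simp_all add: dihedral_dual_def module.defs hopf.defs)

context
begin

interpretation DD: k_algebra "DD :: ('k::field_char_0, _) module" by (rule k_algebra_DD)
interpretation T: k_algebra "tensor DD DD :: ('k::field_char_0, _) module" by (rule k_algebra_tensor[OF k_algebra_DD k_algebra_DD])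

private lemma T_smult [simp]: "x \<in> carrier (tensor DD DD) \<Longrightarrow> c \<odot>\<^bsub>tensor DD DD\<^esub> x \<in> carrier (tensor DD DD)"
  for x :: "('k::field_char_0, _, _) tens" using T.smult_closed[of c x] by simp

private lemmas val_lin = alg_homD(1)[OF elt_val_alg_hom]
private lemmas pure_mem [simp] = pure_closed[OF k_algebra_DD k_algebra_DD]

private lemma eval_simps [simp]:
  fixes x y :: "('k::field_char_0, 'k elt, 'k elt) tens"
  assumes "x \<in> carrier (tensor DD DD)"
  shows "y \<in> carrier (tensor DD DD) \<Longrightarrow> tensor_eval elt_val elt_val (x \<oplus>\<^bsub>tensor DD DD\<^esub> y) p
      = tensor_eval elt_val elt_val x p + tensor_eval elt_val elt_val y p"
    and "tensor_eval elt_val elt_val (c \<odot>\<^bsub>tensor DD DD\<^esub> x) p = c * tensor_eval elt_val elt_val x p"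
    and "y \<in> carrier (tensor DD DD) \<Longrightarrow> tensor_eval elt_val elt_val (x \<ominus>\<^bsub>tensor DD DD\<^esub> y) p
      = tensor_eval elt_val elt_val x p - tensor_eval elt_val elt_val y p"
proof -
  note lin = tensor_eval_lin_map[where \<alpha> = elt_val and \<beta> = elt_val and p = p, OF k_algebra_DD k_algebra_DD val_lin val_lin]
  show add: "tensor_eval elt_val elt_val (x \<oplus>\<^bsub>tensor DD DD\<^esub> z) p
      = tensor_eval elt_val elt_val x p + tensor_eval elt_val elt_val z p" if "z \<in> carrier (tensor DD DD)" for z
    using lin_mapD(2)[OF lin assms that] by simp
  show "tensor_eval elt_val elt_val (c \<odot>\<^bsub>tensor DD DD\<^esub> x) p = c * tensor_eval elt_val elt_val x p"
    using lin_mapD(3)[OF lin assms] by simp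
  show "tensor_eval elt_val elt_val (x \<ominus>\<^bsub>tensor DD DD\<^esub> y) p
      = tensor_eval elt_val elt_val x p - tensor_eval elt_val elt_val y p" if "y \<in> carrier (tensor DD DD)"
    using add[of "\<ominus>\<^bsub>tensor DD DD\<^esub> y"] lin_map_minus[OF T.module_axioms lin that] that by (simp add: a_minus_def)
qed

private lemma eval_pure [simp]:
  "\<lbrakk>x \<in> carrier DD; y \<in> carrier DD\<rbrakk> \<Longrightarrow>
    tensor_eval elt_val elt_val (pure DD DD x y) (d, e) = elt_val x d * (elt_val y e :: 'k::field_char_0)"
  by (rule tensor_eval_pure[OF k_algebra_DD k_algebra_DD val_lin val_lin])

private lemma val_minus [simp]:
  assumes "x \<in> carrier (DD :: ('k::field_char_0, _) module)"
  shows "elt_val (\<ominus>\<^bsub>DD\<^esub> x) d = - elt_val x d"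
    and "y \<in> carrier DD \<Longrightarrow> elt_val (y \<ominus>\<^bsub>DD\<^esub> x) d = elt_val y d - elt_val x d"
proof -
  show *: "elt_val (\<ominus>\<^bsub>DD\<^esub> x) d = - elt_val x d"
    using lin_map_minus[OF DD.module_axioms val_lin assms] .
  show "y \<in> carrier DD \<Longrightarrow> elt_val (y \<ominus>\<^bsub>DD\<^esub> x) d = elt_val y d - elt_val x d"
    using assms * by (simp add: a_minus_def)
qed

text \<open>At a rotation in the first slot (\<phi> + \<psi>)/2 has the value c^i and (\<phi> -
  \<psi>)/2 vanishes; at a reflection it is the other way round. Exactly one summand survives, with
  c^(i + k) or c^(i - k), in accordance with x g^k = g^(-k) x. The minus sign for \<psi> accounts
  for the change of parity.\<close>

private lemma comult_gen_facts:
  assumes "s \<in> (gens :: 'k::field_char_0 gen set)"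
  shows "comult_gen s \<in> carrier (tensor DD DD)"
    and "tensor_eval elt_val elt_val (comult_gen s) p = gen_val s (fst p \<otimes>\<^bsub>dih\<^esub> snd p)"
proof -
  obtain i j k l where p: "p = ((i, j), (k, l))" by (metis prod.collapse)
  show "comult_gen s \<in> carrier (tensor DD DD)"
    using assms by (cases s) (simp_all add: T.minus_closed DD.minus_closed)
  show "tensor_eval elt_val elt_val (comult_gen s) p = gen_val s (fst p \<otimes>\<^bsub>dih\<^esub> snd p)"
  proof (cases s)
    case Gen_F
    then show ?thesis using p by (cases j) (simp_all add: elt_val_gen)
  next
    case (Gen_phi c)
    then have c: "c \<noteq> 0" using assms by simp
    have "inverse c powi k = inverse (c powi k)" "c powi (i + k) = c powi i * c powi k"
      "c powi (i - k) = c powi i * inverse (c powi k)"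
      using c by (simp_all add: power_int_inverse power_int_add power_int_diff divide_inverse)
    then show ?thesis using p c Gen_phi
      by (cases j) (simp_all add: DD.minus_closed elt_val_gen)
  next
    case (Gen_psi c)
    then have c: "c \<noteq> 0" using assms by simp
    have "inverse c powi k = inverse (c powi k)" "c powi (i + k) = c powi i * c powi k"
      "c powi (i - k) = c powi i * inverse (c powi k)"
      using c by (simp_all add: power_int_inverse power_int_add power_int_diff divide_inverse)
    then show ?thesis using p c Gen_psi
      by (cases j; cases l) (simp_all add: DD.minus_closed elt_val_gen)
  qed
qed

text \<open>A rotation is inverted by negating its exponent, a reflection is its own inverse. The
  two halves of the formulas for \<phi> and \<psi> select these cases; for \<open>F\<close> the
  factor \<open>\<psi>\<^sub>1\<close> does.\<close>

private lemma antipode_gen_facts: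
  assumes "s \<in> (gens :: 'k::field_char_0 gen set)"
  shows "antipode_gen s \<in> carrier DD"
    and "elt_val (antipode_gen s) d = gen_val s (inv\<^bsub>dih\<^esub> d)"
proof -
  obtain i j where d: "d = (i, j)" by (cases d)
  show "antipode_gen s \<in> carrier DD"
    using assms by (cases s) (simp_all add: DD.minus_closed)
  show "elt_val (antipode_gen s) d = gen_val s (inv\<^bsub>dih\<^esub> d)"
  proof (cases s)
    case Gen_F
    then show ?thesis using d by (cases j) (simp_all add: elt_val_gen inv_dih)
  next
    case (Gen_phi c)
    moreover have "inverse c powi i = c powi (- i)" by (simp add: power_int_inverse power_int_minus)
    ultimately show ?thesis using d assms by (cases j) (simp_all add: DD.minus_closed elt_val_gen inv_dih)
  next
    case (Gen_psi c)
    moreover have "inverse c powi i = c powi (- i)" by (simp add: power_int_inverse power_int_minus)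
    ultimately show ?thesis using d assms by (cases j) (simp_all add: DD.minus_closed elt_val_gen inv_dih)
  qed
qed

theorem function_hopf_dihedral_dual:
  "function_hopf (dihedral_dual :: ('k::field_char_0, _) hopf) dih elt_val"
proof (intro function_hopf.intro function_hopf_axioms.intro group_dih dih_simps(1))
  let ?K = "dihedral_dual :: ('k, _) hopf"
  show "k_algebra ?K" by (rule k_algebra_image[OF k_algebra_DD, of "\<lambda>x. x"]) simp_all
  have emb: "linear_embedding DD (elt_val :: 'k elt \<Rightarrow> _)" by (rule elt_val_embedding)
  then show "inj_on elt_val (carrier ?K)" by (simp add: linear_embedding_def)
  show "(\<lambda>h. elt_val h d) \<in> alg_hom ?K scalars" for d
    by (intro alg_homI lin_mapI) simp_all
  have tens: "tensor ?K ?K = tensor DD DD" by (rule tensor_cong) simp_all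
  have hom2: "(\<lambda>t. tensor_eval elt_val elt_val t p) \<in> alg_hom (tensor DD DD) scalars" for p
    by (rule tensor_eval_alg_hom[OF k_algebra_DD k_algebra_DD val_lin val_lin elt_val_alg_hom elt_val_alg_hom])
  note emb2 = linear_embedding_tensor[OF k_algebra_DD k_algebra_DD elt_val_embedding elt_val_embedding]
  have comult: "gen_hom (tensor DD DD) comult_gen \<in> alg_hom DD (tensor DD (DD :: ('k, _) module))"
    by (rule gen_hom_separated(1)[OF T.k_algebra_axioms emb2 hom2 comult_gen_facts])
  have comult_val: "tensor_eval elt_val elt_val (gen_hom (tensor DD DD) comult_gen h) p = elt_val h (fst p \<otimes>\<^bsub>dih\<^esub> snd p)"
    if "h \<in> carrier DD" for h :: "'k elt" and p
    by (rule gen_hom_separated(2)[OF T.k_algebra_axioms emb2 hom2 comult_gen_facts that])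
  \<comment> \<open>The antipode reverses products and is treated as a homomorphism into the
    opposite algebra. Scalars commute, so evaluations are algebra maps there too.\<close>
  have opp: "linear_embedding (opposite DD) (elt_val :: 'k elt \<Rightarrow> _)"
    using emb by (simp add: linear_embedding_def lin_map_def)
  have opp_hom: "(\<lambda>h. elt_val h d) \<in> alg_hom (opposite DD) scalars" for d
    by (intro alg_homI lin_mapI) simp_all
  have agen: "antipode_gen s \<in> carrier (opposite DD)" if "s \<in> gens" for s :: "'k gen"
    using antipode_gen_facts(1)[OF that] by simp
  have antipode: "gen_hom (opposite DD) antipode_gen \<in> alg_hom DD (opposite (DD :: ('k, _) module))"
    by (rule gen_hom_separated(1)[OF k_algebra_opposite[OF k_algebra_DD] opp opp_hom agen antipode_gen_facts(2)])
  have antipode_val: "elt_val (gen_hom (opposite DD) antipode_gen h) d = elt_val h (inv\<^bsub>dih\<^esub> d)"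
    if "h \<in> carrier DD" for h :: "'k elt" and d
    by (rule gen_hom_separated(2)[OF k_algebra_opposite[OF k_algebra_DD] opp opp_hom agen antipode_gen_facts(2) that])
  fix h assume "h \<in> carrier ?K"
  then have h: "h \<in> carrier DD" by simp
  show "comult ?K h \<in> carrier (tensor ?K ?K)"
    using lin_mapD(1)[OF alg_homD(1)[OF comult] h] by (simp add: tens)
  show "tensor_eval elt_val elt_val (comult ?K h) (d, e) = elt_val h (d \<otimes>\<^bsub>dih\<^esub> e)" for d e
    using comult_val[OF h, of "(d, e)"] by simp
  \<comment> \<open>On generators the counit is evaluation at the neutral element, so the two
    algebra maps coincide.\<close>
  have "counit_gen = (\<lambda>s :: 'k gen. gen_val s (0, False))"
  proof
    show "counit_gen s = gen_val s (0, False)" for s :: "'k gen" by (cases s) simp_all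
  qed
  then show "counit ?K h = elt_val h \<one>\<^bsub>dih\<^esub>" by (simp add: elt_val_def)
  show "antipode ?K h \<in> carrier ?K"
    using lin_mapD(1)[OF alg_homD(1)[OF antipode] h] by simp
  show "elt_val (antipode ?K h) d = elt_val h (inv\<^bsub>dih\<^esub> d)" for d
    using antipode_val[OF h, of d] by simp
qed

end

section \<open>Exponential polynomials as values of elements of the presented algebra\<close>

lemma exp_poly_elt:
  assumes "s \<in> (exp_poly :: (int \<Rightarrow> 'k::field_char_0) set)"
  shows "\<exists>h\<in>carrier DD. \<forall>i j. elt_val h (i, j) = s i"
proof -
  interpret DD: k_algebra "DD :: ('k, _) module" by (rule k_algebra_DD)
  show ?thesis using assms
  proof (induction rule: exp_poly.induct)
    case (basis c n)
    show ?case
    proof (induction n)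
      case 0
      show ?case using basis by (intro bexI[of _ "gen_elt (Gen_phi c)"]) (simp_all add: elt_val_gen)
    next
      case (Suc n)
      then obtain h where h: "h \<in> carrier DD" "\<And>i j. elt_val h (i, j) = (of_int i gchoose n) * c powi i" by blast
      \<comment> \<open>By (n + 1) C(i, n + 1) = (i - n) C(i, n), multiplication by F - n and
        division by n + 1 raise the binomial index; characteristic 0 permits the division.\<close>
      let ?h = "inverse (of_nat (Suc n)) \<odot>\<^bsub>DD\<^esub> (gen_elt Gen_F \<otimes>\<^bsub>DD\<^esub> h \<oplus>\<^bsub>DD\<^esub> (- of_nat n) \<odot>\<^bsub>DD\<^esub> h)"
      have "elt_val ?h (i, j) = (of_int i gchoose Suc n) * c powi i" for i j
      proof -
        have "elt_val ?h (i, j)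
            = inverse (of_nat (Suc n)) * ((of_int i * (of_int i gchoose n) - of_nat n * (of_int i gchoose n)) * c powi i)"
          using h(1) by (simp add: elt_val_gen h(2) left_diff_distrib mult.assoc del: of_nat_Suc)
        also have "(of_int i :: 'k) * (of_int i gchoose n) - of_nat n * (of_int i gchoose n)
          = of_nat (Suc n) * (of_int i gchoose Suc n)"
          using gbinomial_mult_1[of "of_int i :: 'k" n] by simp
        also have "inverse (of_nat (Suc n)) * (of_nat (Suc n) * (of_int i gchoose Suc n) * c powi i) = (of_int i gchoose Suc n) * c powi i"
          by (simp flip: mult.assoc del: of_nat_Suc)
        finally show ?thesis .
      qed
      then show ?case using h by (intro bexI[of _ ?h]) simp_all
    qed
  next
    case (add s t)
    then obtain x y where "x \<in> carrier DD" "\<And>i j. elt_val x (i, j) = s i" "y \<in> carrier DD" "\<And>i j. elt_val y (i, j) = t i" by blast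
    then show ?case by (intro bexI[of _ "x \<oplus>\<^bsub>DD\<^esub> y"]) simp_all
  next
    case (smult s a)
    then obtain x where "x \<in> carrier DD" "\<And>i j. elt_val x (i, j) = s i" by blast
    then show ?case by (intro bexI[of _ "a \<odot>\<^bsub>DD\<^esub> x"]) simp_all
  qed
qed

text \<open>The elements \<open>1 \<plusminus> \<psi>\<^sub>1\<close> separate the values on rotations from those on reflections.\<close>

lemma exp_poly_pair_elt:
  assumes "\<And>j. (\<lambda>i. f (i, j)) \<in> (exp_poly :: (int \<Rightarrow> 'k::field_char_0) set)"
  shows "\<exists>h\<in>carrier DD. \<forall>d. elt_val h d = f d"
proof -
  interpret DD: k_algebra "DD :: ('k, _) module" by (rule k_algebra_DD)
  obtain x y where x: "x \<in> carrier DD" "\<And>i j. elt_val x (i, j) = f (i, False)"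
    and y: "y \<in> carrier DD" "\<And>i j. elt_val y (i, j) = f (i, True)"
    using exp_poly_elt[OF assms[of False]] exp_poly_elt[OF assms[of True]] by blast
  let ?psi = "gen_elt (Gen_psi 1) :: 'k elt"
  let ?h = "(1 / 2) \<odot>\<^bsub>DD\<^esub> ((\<one>\<^bsub>DD\<^esub> \<oplus>\<^bsub>DD\<^esub> ?psi) \<otimes>\<^bsub>DD\<^esub> x \<oplus>\<^bsub>DD\<^esub> (\<one>\<^bsub>DD\<^esub> \<oplus>\<^bsub>DD\<^esub> (- 1) \<odot>\<^bsub>DD\<^esub> ?psi) \<otimes>\<^bsub>DD\<^esub> y)"
  have "elt_val ?h (i, j) = f (i, j)" for i j
    using x y by (cases j) (simp_all add: elt_val_gen)
  then show ?thesis using x y by (intro bexI[of _ ?h]) auto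
qed

theorem theorem3:
  shows "hopf_algebra (finite_dual (group_hopf infinite_dihedral)
             :: ('k::{alg_closed_field, field_char_0}, _) hopf)
       \<and> hopf_algebra (dihedral_dual :: ('k, _) hopf)
       \<and> (\<exists>f. f \<in> hopf_iso
               (finite_dual (group_hopf infinite_dihedral) :: ('k, _) hopf)
               (dihedral_dual :: ('k, _) hopf))"
proof -
  interpret K: function_hopf "dihedral_dual :: ('k, _) hopf" dih elt_val
    by (rule function_hopf_dihedral_dual)
  interpret R: represented_dual "dihedral_dual :: ('k, _) hopf" dih elt_val infinite_dihedral dih_elt
  proof (intro represented_dual.intro represented_dual_axioms.intro K.function_hopf_axioms group_infinite_dihedral dih_elt_iso)
    fix f :: "(dihedral_gen word set \<Rightarrow>\<^sub>0 'k) \<Rightarrow> 'k"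
    assume f: "f \<in> finite_dual_carrier (group_hopf infinite_dihedral)"
    \<comment> \<open>Rotations and reflections each give an exponential polynomial in the exponent,
      and the two together are the values of one element.\<close>
    have "\<exists>h\<in>carrier DD. \<forall>d. elt_val h d = f (single (dih_elt d) 1)"
      by (rule exp_poly_pair_elt) (rule finite_dual_exp_poly[OF f])
    then show "\<exists>h\<in>carrier dihedral_dual. \<forall>d. elt_val h d = f (single (dih_elt d) 1)"
      by simp
  qed
  show ?thesis using R.finite_dual_iso K.hopf by simp
qed

end
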